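(* Let $p=d>1$ with $d$ an integer. Suppose that $V$ is real-valued, $V\in L^q(\mathbb{R}^d)\cap L^1(\mathbb{R}^d)$ for some $q>1$, and $\int_{\mathbb{R}^d}V(x)\,dx>0$. Then $$\lim_{\alpha\to 0+}\alpha^{\frac{1}{d-1}}\log\frac{1}{|\lambda(\alpha V)|}=d\,\omega_d^{\frac{1}{d-1}}\left(\int_{\mathbb{R}^d}V(x)\,dx\right)^{-\frac{1}{d-1}},$$ where $\omega_d$ denotes the surface area of the unit sphere in $\mathbb{R}^d$.
   Context: For a real-valued function $V$ on $\mathbb{R}^d$ and $u\in W^{1,d}(\mathbb{R}^d)$ set (here $p=d$) $$Q_V[u]=\int_{\mathbb{R}^d}\left(|\nabla u|^d-V|u|^d\right)dx,\qquad \lambda(V)=\inf_{0\ne u\in W^{1,d}(\mathbb{R}^d)}\frac{Q_V[u]}{\int_{\mathbb{R}^d}|u|^d\,dx}.$$ *)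

theory Defs
  imports "HOL-Analysis.Analysis"
begin

text \<open>Functions are used in place of their almost-everywhere classes.\<close>

definition Lp :: "real \<Rightarrow> ('a::euclidean_space \<Rightarrow> 'b::euclidean_space) set" where
  "Lp p = {f. f \<in> borel_measurable lebesgue \<and> integrable lebesgue (\<lambda>x. norm (f x) powr p)}"

primrec Ck :: "nat \<Rightarrow> ('a::euclidean_space \<Rightarrow> real) \<Rightarrow> bool" where
  "Ck 0 f \<longleftrightarrow> continuous_on UNIV f"
| "Ck (Suc k) f \<longleftrightarrow> (\<forall>x. f differentiable (at x)) \<and>
     (\<forall>i\<in>Basis. Ck k (\<lambda>x. frechet_derivative f (at x) i))"

definition test_function :: "('a::euclidean_space \<Rightarrow> real) \<Rightarrow> bool" where
  "test_function \<phi> \<longleftrightarrow> (\<forall>k. Ck k \<phi>) \<and> compact (closure {x. \<phi> x \<noteq> 0})"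

definition locally_integrable :: "('a::euclidean_space \<Rightarrow> 'b::euclidean_space) \<Rightarrow> bool" where
  "locally_integrable f \<longleftrightarrow> (\<forall>K. compact K \<longrightarrow> set_integrable lebesgue K f)"

definition has_weak_gradient ::
  "('a::euclidean_space \<Rightarrow> real) \<Rightarrow> ('a \<Rightarrow> 'a) \<Rightarrow> bool" where
  "has_weak_gradient u g \<longleftrightarrow> locally_integrable u \<and> locally_integrable g \<and>
     (\<forall>\<phi>. test_function \<phi> \<longrightarrow> (\<forall>i\<in>Basis.
        (LINT x|lebesgue. u x * frechet_derivative \<phi> (at x) i)
          = - (LINT x|lebesgue. (g x \<bullet> i) * \<phi> x)))"

text \<open>Weak gradients are unique up to null sets, so the choice below does not affect
  membership in \<open>Lp\<close> or any integral.\<close>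

definition weak_gradient :: "('a::euclidean_space \<Rightarrow> real) \<Rightarrow> 'a \<Rightarrow> 'a" where
  "weak_gradient u = (SOME g. has_weak_gradient u g)"

definition W1 :: "real \<Rightarrow> ('a::euclidean_space \<Rightarrow> real) set" where
  "W1 p = {u \<in> Lp p. (\<exists>g. has_weak_gradient u g) \<and> weak_gradient u \<in> Lp p}"

definition Q :: "('a::euclidean_space \<Rightarrow> real) \<Rightarrow> ('a \<Rightarrow> real) \<Rightarrow> real" where
  "Q V u = (LINT x|lebesgue. norm (weak_gradient u x) ^ DIM('a) - V x * \<bar>u x\<bar> ^ DIM('a))"

text \<open>The condition \<open>u \<noteq> 0\<close> refers to the class of \<open>u\<close>. The infimum is taken in
  the reals: for \<open>V \<in> Lp q \<inter> Lp 1\<close> with \<open>q > 1\<close> the quotients are bounded below.\<close>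

definition lam :: "('a::euclidean_space \<Rightarrow> real) \<Rightarrow> real" where
  "lam V = (INF u \<in> {u \<in> W1 (real DIM('a)). \<not> (AE x in lebesgue. u x = 0)}.
      Q V u / (LINT x|lebesgue. \<bar>u x\<bar> ^ DIM('a)))"

text \<open>Hypersurface area as Minkowski content of codimension one: the limit of the volume of the
  \<open>\<epsilon>\<close>-neighbourhood divided by its width \<open>2\<epsilon>\<close>. For compact smooth
  hypersurfaces this is the usual area.\<close>

definition surface_area :: "'a::euclidean_space set \<Rightarrow> real" where
  "surface_area S = Lim (at_right 0) (\<lambda>\<epsilon>. measure lebesgue {x. infdist x S \<le> \<epsilon>} / (2 * \<epsilon>))"

end

theory Submission
  imports Defs "HOL-Real_Asymp.Real_Asymp"
begin

text \<open>
  Write \<open>d\<close> for the dimension and \<open>\<omega>\<close> for the area of the unit sphere. Everything rests on the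
  logarithmic capacity of a ball: with \<open>N u = \<integral>|\<nabla>u|^d + (d + 1) \<rho>^-d \<integral>|u|^d\<close>, the mean of \<open>|u|^d\<close>
  over a ball of radius \<open>r0\<close> is at most \<open>(1 + o(1)) \<omega>^-1 (ln (\<rho> / r0))^(d - 1) N u\<close>. For smooth \<open>u\<close>
  one tests \<open>div F\<close> against \<open>|u|^d\<close> for a radial Lipschitz field \<open>F\<close> that solves the Riccati equation
  \<open>div F = (d - 1) |F|^(d / (d - 1))\<close> between \<open>r0\<close> and \<open>\<rho>\<close>, and applies Young's inequality.

  For the lower bound on \<open>\<lambda>(\<alpha> V)\<close>, take \<open>\<alpha> (ln \<rho>)^(d - 1)\<close> of order one. The bounded, compactly
  supported part of \<open>V\<close> sees \<open>u\<close> only through its mean, up to an error \<open>C \<integral>|\<nabla>u|^d\<close> which the factor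
  \<open>\<alpha>\<close> makes negligible, because \<open>\<integral>|u(x + h) - u(x)|^d dx \<le> |h|^d \<integral>|\<nabla>u|^d\<close>. The remaining part is
  compared with means over balls of radius \<open>exp (-j)\<close> where \<open>|V|\<close> is about \<open>exp j\<close>; its contribution is
  governed by the small integral of \<open>|V| (1 + ln |V|)^(d - 1)\<close>, which is finite since \<open>q > 1\<close>. The
  matching upper bound comes from the trial functions \<open>ln (R / |x|) / ln R\<close>, truncated to \<open>[0, 1]\<close>.
\<close>

section \<open>Smooth bump functions\<close>

text \<open>The exponent d is critical: functions of finite energy may be unbounded, and a ball mean
  is controlled only up to a power of a logarithm. The field F comes from the positive d-harmonic
  function h = 1 + ln (rho / |x|): F = - |grad h|^(d - 2) grad h / h^(d - 1) satisfies the Riccati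
  equation because h is d-harmonic, and |F| = (|grad h| / h)^(d - 1). Making F linear inside r0 and
  cutting it off beyond rho costs only lower order factors. The mass term of N is what the limit
  measures. If rho is chosen so that alpha times the integral of V |u|^d is at most N u, then the
  Rayleigh quotient is at least - (d + 1) rho^-d, and the logarithm of the reciprocal of this size
  is d ln rho up to a constant. Hence constant factors and powers of alpha in front of rho^-d are
  harmless, and only the factor in front of (ln rho)^(d - 1) has to be sharp. For the same reason a
  crude bound on the mass of the trial functions is enough.\<close>

lemma Ck_SucI:
  assumes "\<And>x. (f has_derivative D x) (at x)" "\<And>i. i \<in> Basis \<Longrightarrow> Ck k (\<lambda>x. D x i)"
  shows "Ck (Suc k) f"
proof -
  have "frechet_derivative f (at x) = D x" for x
    using frechet_derivative_at[OF assms(1)[of x]] by simp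
  then show ?thesis
    using assms by (auto simp: differentiable_def)
qed

lemma Ck_Suc_derivative:
  assumes "Ck (Suc k) f"
  shows "(f has_derivative frechet_derivative f (at x)) (at x)"
    and "i \<in> Basis \<Longrightarrow> Ck k (\<lambda>x. frechet_derivative f (at x) i)"
  using assms by (auto simp: frechet_derivative_works)

lemma Ck_Suc_imp_Ck: "Ck (Suc k) f \<Longrightarrow> Ck k f"
proof (induction k arbitrary: f)
  case 0
  then show ?case
    by (auto intro!: differentiable_imp_continuous_on simp: differentiable_on_def)
next
  case (Suc k)
  then show ?case
    by (metis Ck.simps(2))
qed

lemma Ck_const: "Ck k (\<lambda>x. c)"
proof (induction k arbitrary: c)
  case (Suc k)
  show ?case
    by (rule Ck_SucI[where D="\<lambda>x h. 0"]) (auto intro!: derivative_eq_intros Suc)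
qed auto

lemma Ck_add: "Ck k f \<Longrightarrow> Ck k g \<Longrightarrow> Ck k (\<lambda>x. f x + g x)"
proof (induction k arbitrary: f g)
  case 0
  then show ?case by (auto intro!: continuous_intros)
next
  case (Suc k)
  show ?case
    by (rule Ck_SucI[OF has_derivative_add[OF Ck_Suc_derivative(1)[OF Suc.prems(1)]
          Ck_Suc_derivative(1)[OF Suc.prems(2)]]])
       (auto intro!: Suc.IH Ck_Suc_derivative(2) Suc.prems)
qed

lemma Ck_mult: "Ck k f \<Longrightarrow> Ck k g \<Longrightarrow> Ck k (\<lambda>x. f x * g x)"
proof (induction k arbitrary: f g)
  case 0
  then show ?case by (auto intro!: continuous_intros)
next
  case (Suc k)
  show ?case
    by (rule Ck_SucI[OF has_derivative_mult[OF Ck_Suc_derivative(1)[OF Suc.prems(1)]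
          Ck_Suc_derivative(1)[OF Suc.prems(2)]]])
       (auto intro!: Ck_add Suc.IH Ck_Suc_derivative(2) Suc.prems intro: Ck_Suc_imp_Ck Suc.prems)
qed

lemma Ck_prod:
  assumes "finite I" "\<And>i. i \<in> I \<Longrightarrow> Ck k (f i)"
  shows "Ck k (\<lambda>x. \<Prod>i\<in>I. f i x)"
  using assms by (induction I rule: finite_induct) (auto intro: Ck_const Ck_mult)

text \<open>The exponent \<open>k\<close> makes the family closed under differentiation. The
  parameter \<open>c\<close> is there for a limit: as \<open>c\<close> decreases to 0,
  \<open>exp_recip c 0\<close> tends to the indicator of the positive half line.\<close>

definition exp_recip :: "real \<Rightarrow> nat \<Rightarrow> real \<Rightarrow> real" where
  "exp_recip c k t = (if t \<le> 0 then 0 else exp (- c / t) / t ^ k)"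

lemma exp_recip_tendsto_0:
  assumes "c > 0"
  shows "(exp_recip c k \<longlongrightarrow> 0) (at 0)"
proof -
  have "((\<lambda>y. (y ^ k / exp y) / c ^ k) \<longlongrightarrow> 0 / c ^ k) at_top"
    by (intro tendsto_divide tendsto_power_div_exp_0 tendsto_const) (use assms in auto)
  moreover have "filterlim (\<lambda>t. c * inverse t) at_top (at_right 0)"
    by (intro filterlim_tendsto_pos_mult_at_top[OF tendsto_const assms] filterlim_inverse_at_top_right)
  ultimately have "((\<lambda>t. ((c * inverse t) ^ k / exp (c * inverse t)) / c ^ k) \<longlongrightarrow> 0) (at_right 0)"
    by (auto dest: filterlim_compose)
  moreover have "\<forall>\<^sub>F t in at_right 0. ((c * inverse t) ^ k / exp (c * inverse t)) / c ^ k = exp_recip c k t"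
    unfolding eventually_at_right_field using assms
    by (auto intro!: exI[of _ 1] simp: exp_recip_def exp_minus field_simps)
  ultimately have "(exp_recip c k \<longlongrightarrow> 0) (at_right 0)"
    by (rule Lim_transform_eventually)
  moreover have "(exp_recip c k \<longlongrightarrow> 0) (at_left 0)"
    by (rule tendsto_eventually) (auto simp: eventually_at_left_field exp_recip_def intro!: exI[of _ "-1"])
  ultimately show ?thesis
    by (simp add: filterlim_at_split)
qed

lemma exp_recip_has_derivative:
  assumes "c > 0"
  shows "(exp_recip c k has_real_derivative
    - real k * exp_recip c (Suc k) t + c * exp_recip c (k + 2) t) (at t)"
proof -
  consider "t < 0" | "t = 0" | "t > 0" by linarith
  then show ?thesis
  proof cases
    case 1
    have "((\<lambda>t. 0) has_real_derivative 0) (at t)" by simp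
    then have "(exp_recip c k has_real_derivative 0) (at t)"
      by (rule has_field_derivative_transform_within_open[where S="{..<0}"])
         (use 1 in \<open>auto simp: exp_recip_def\<close>)
    with 1 show ?thesis by (simp add: exp_recip_def)
  next
    case 2
    \<comment> \<open>The difference quotient of \<open>exp_recip c k\<close> at 0 is
      \<open>exp_recip c (Suc k)\<close> itself.\<close>
    have "((\<lambda>h. exp_recip c (Suc k) h) \<longlongrightarrow> 0) (at 0)"
      by (rule exp_recip_tendsto_0[OF assms])
    then have "(exp_recip c k has_real_derivative 0) (at 0)"
      unfolding DERIV_def
      by (rule Lim_transform_eventually)
         (auto simp: eventually_at exp_recip_def field_simps intro!: exI[of _ 1])
    with 2 show ?thesis by (simp add: exp_recip_def)
  next
    case 3
    have "((\<lambda>t. exp (- c / t) / t ^ k) has_real_derivative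
      (exp (- c / t) * (c / t\<^sup>2) * t ^ k - exp (- c / t) * (real k * t ^ (k - 1))) / (t ^ k * t ^ k)) (at t)"
      using 3 by (auto intro!: derivative_eq_intros simp: power2_eq_square)
    also have "(exp (- c / t) * (c / t\<^sup>2) * t ^ k - exp (- c / t) * (real k * t ^ (k - 1))) / (t ^ k * t ^ k) =
      - real k * exp_recip c (Suc k) t + c * exp_recip c (k + 2) t"
      using 3 by (cases k) (simp_all add: exp_recip_def field_simps power2_eq_square)
    finally have "((\<lambda>t. exp (- c / t) / t ^ k) has_real_derivative
      - real k * exp_recip c (Suc k) t + c * exp_recip c (k + 2) t) (at t)" .
    then show ?thesis
      by (rule has_field_derivative_transform_within_open[where S="{0<..}"])
         (use 3 in \<open>auto simp: exp_recip_def\<close>)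
  qed
qed

lemma Ck_exp_recip_inner:
  fixes e :: "'a::euclidean_space"
  assumes "c > 0"
  shows "Ck n (\<lambda>x. exp_recip c k (e \<bullet> x + b))"
proof (induction n arbitrary: k)
  case 0
  have "continuous_on UNIV (exp_recip c k)"
    by (rule DERIV_continuous_on, rule has_field_derivative_at_within, rule exp_recip_has_derivative[OF assms])
  from continuous_on_compose2[OF this, of UNIV "\<lambda>x. e \<bullet> x + b"] show ?case
    by (simp add: continuous_intros)
next
  case (Suc n)
  have D: "((\<lambda>x. exp_recip c k (e \<bullet> x + b)) has_derivative
     (\<lambda>h. (- real k * exp_recip c (Suc k) (e \<bullet> x + b) + c * exp_recip c (k + 2) (e \<bullet> x + b)) * (e \<bullet> h))) (at x)" for x
  proof -
    have "((\<lambda>x. e \<bullet> x + b) has_derivative (\<lambda>h. e \<bullet> h)) (at x)"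
      by (auto intro!: derivative_eq_intros)
    from has_derivative_compose[OF this exp_recip_has_derivative[OF assms, unfolded has_field_derivative_def]]
    show ?thesis by simp
  qed
  show ?case
    by (rule Ck_SucI[OF D]) (intro Ck_mult Ck_add Ck_const Suc)
qed

text \<open>One factor per face of the box. The values lie in [0, 1] and tend to the indicator of
  the box as \<open>c\<close> tends to 0, so dominated convergence carries identities from test
  functions to open boxes.\<close>

definition box_bump :: "'a::euclidean_space \<Rightarrow> 'a \<Rightarrow> real \<Rightarrow> 'a \<Rightarrow> real" where
  "box_bump a b c x = (\<Prod>i\<in>Basis. exp_recip c 0 (i \<bullet> x + (- (a \<bullet> i))) * exp_recip c 0 ((- i) \<bullet> x + b \<bullet> i))"

lemma box_bump_eq_0: "x \<notin> box a b \<Longrightarrow> box_bump a b c x = 0"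
  by (auto simp: box_bump_def mem_box exp_recip_def inner_commute not_less intro!: bexI)

lemma test_function_box_bump:
  assumes "c > 0"
  shows "test_function (box_bump a b c)"
  unfolding test_function_def
proof (intro conjI allI)
  show "Ck k (box_bump a b c)" for k
    unfolding box_bump_def by (intro Ck_prod Ck_mult Ck_exp_recip_inner assms) auto
  have "{x. box_bump a b c x \<noteq> 0} \<subseteq> box a b"
    using box_bump_eq_0 by blast
  then show "compact (closure {x. box_bump a b c x \<noteq> 0})"
    using bounded_box bounded_subset compact_closure by metis
qed

lemma exp_recip_0_bounds: "c > 0 \<Longrightarrow> 0 \<le> exp_recip c 0 t" "c > 0 \<Longrightarrow> exp_recip c 0 t \<le> 1"
  by (auto simp: exp_recip_def)

lemma box_bump_bounds:
  assumes "c > 0" shows "0 \<le> box_bump a b c x" "box_bump a b c x \<le> 1"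
proof -
  have *: "0 \<le> exp_recip c 0 s * exp_recip c 0 t" "exp_recip c 0 s * exp_recip c 0 t \<le> 1" for s t
    using exp_recip_0_bounds[OF assms] by (auto intro!: mult_le_one)
  show "0 \<le> box_bump a b c x" "box_bump a b c x \<le> 1"
    unfolding box_bump_def using * by (auto intro!: prod_nonneg prod_le_1)
qed

lemma box_bump_tendsto: "(\<lambda>n. box_bump a b (1 / real (Suc n)) x) \<longlonglongrightarrow> indicator (box a b) x"
proof (cases "x \<in> box a b")
  case False
  then show ?thesis by (simp add: box_bump_eq_0)
next
  case True
  have *: "(\<lambda>n. exp_recip (1 / real (Suc n)) 0 t) \<longlonglongrightarrow> 1" if "t > 0" for t
  proof -
    have "(\<lambda>n. inverse (real (Suc n))) \<longlonglongrightarrow> 0"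
      by (rule LIMSEQ_inverse_real_of_nat)
    then have "(\<lambda>n. exp (- (inverse (real (Suc n))) / t)) \<longlonglongrightarrow> exp (- 0 / t)"
      using that by (intro tendsto_intros) auto
    then show ?thesis using that by (simp add: exp_recip_def divide_inverse)
  qed
  have "(\<lambda>n. box_bump a b (1 / real (Suc n)) x) \<longlonglongrightarrow> (\<Prod>i\<in>(Basis::'a set). 1 * 1)"
    unfolding box_bump_def using True
    by (intro tendsto_prod tendsto_mult *) (auto simp: mem_box inner_commute)
  with True show ?thesis by simp
qed

lemma continuous_on_test_function: "test_function \<phi> \<Longrightarrow> continuous_on UNIV \<phi>"
  unfolding test_function_def by (metis Ck.simps(1))

section \<open>The fundamental lemma of the calculus of variations\<close>

text \<open>The positive and the negative part of \<open>f\<close> are densities of two measures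
  that agree on open boxes. Boxes are stable under intersection and generate the Borel sets, so the
  measures, and then their densities, agree.\<close>

lemma AE_zero_if_box_integrals_zero:
  fixes f :: "'a::euclidean_space \<Rightarrow> real"
  assumes [measurable]: "f \<in> borel_measurable borel"
    and int: "\<And>a b. set_integrable lborel (box a b) f"
    and zero: "\<And>a b. (LINT x:box a b|lborel. f x) = 0"
  shows "AE x in lborel. f x = 0"
proof -
  \<comment> \<open>\<open>ennreal\<close> sends negative numbers to 0, so these densities are the
    positive and the negative part of \<open>f\<close>.\<close>
  let ?M = "density lborel (\<lambda>x. ennreal (f x))" and ?N = "density lborel (\<lambda>x. ennreal (- f x))"
  have emM: "emeasure (density lborel (\<lambda>x. ennreal (g x))) (box a b) =
      ennreal (LINT x|lborel. max 0 (indicator (box a b) x * g x))"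
    if [measurable]: "g \<in> borel_measurable borel" and "set_integrable lborel (box a b) g" for g and a b :: 'a
  proof -
    have i: "integrable lborel (\<lambda>x. max 0 (indicator (box a b) x * g x))"
      using that(2) unfolding set_integrable_def by (auto intro!: integrable_max)
    have "emeasure (density lborel (\<lambda>x. ennreal (g x))) (box a b) = (\<integral>\<^sup>+x. ennreal (g x) * indicator (box a b) x \<partial>lborel)"
      by (intro emeasure_density) auto
    also have "\<dots> = (\<integral>\<^sup>+x. ennreal (max 0 (indicator (box a b) x * g x)) \<partial>lborel)"
      by (intro nn_integral_cong) (auto simp: indicator_def max_def ennreal_neg)
    also have "\<dots> = ennreal (LINT x|lborel. max 0 (indicator (box a b) x * g x))"
      by (rule nn_integral_eq_integral[OF i]) auto
    finally show ?thesis .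
  qed
  have neg: "set_integrable lborel (box a b) (\<lambda>x. - f x)" for a b
    using int[of a b] by (simp add: set_integrable_def)
  have eq: "emeasure ?M (box a b) = emeasure ?N (box a b)" for a b
  proof -
    let ?h = "\<lambda>x. indicator (box a b) x * f x"
    have i: "integrable lborel ?h" using int[of a b] by (simp add: set_integrable_def)
    have "(LINT x|lborel. max 0 (?h x)) - (LINT x|lborel. max 0 (- ?h x)) = (LINT x|lborel. max 0 (?h x) - max 0 (- ?h x))"
      using i by (intro Bochner_Integration.integral_diff[symmetric] integrable_max) auto
    also have "\<dots> = (LINT x|lborel. ?h x)"
      by (intro Bochner_Integration.integral_cong) auto
    also have "\<dots> = 0" using zero[of a b] by (simp add: set_lebesgue_integral_def)
    finally have "(LINT x|lborel. max 0 (?h x)) = (LINT x|lborel. max 0 (- ?h x))" by simp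
    then show ?thesis
      by (subst (1 2) emM) (use int neg in auto)
  qed
  have "?M = ?N"
  proof (rule measure_eqI_generator_eq)
    let ?E = "range (\<lambda>(a, b). box a b :: 'a set)"
    show "Int_stable ?E"
      by (auto simp: Int_stable_def box_Int_box)
    show "?E \<subseteq> Pow UNIV" "sets ?M = sigma_sets UNIV ?E" "sets ?N = sigma_sets UNIV ?E"
      by (simp_all add: borel_eq_box)
    let ?A = "\<lambda>n::nat. box (- (real n *\<^sub>R One)) (real n *\<^sub>R One) :: 'a set"
    show "range ?A \<subseteq> ?E" "(\<Union>i. ?A i) = UNIV"
      unfolding UN_box_eq_UNIV by auto
    show "emeasure ?M (?A i) \<noteq> \<infinity>" for i
      by (subst emM) (use int in auto)
    show "\<And>X. X \<in> ?E \<Longrightarrow> emeasure ?M X = emeasure ?N X"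
      using eq by auto
  qed
  then have "AE x in lborel. ennreal (f x) = ennreal (- f x)"
    by (intro sigma_finite_measure.density_unique[OF sigma_finite_lborel]) auto
  \<comment> \<open>One of the two truncated values is 0 at every point, so their equality forces
    \<open>f x = 0\<close>.\<close>
  then show ?thesis
  proof eventually_elim
    case (elim x)
    then show "f x = 0"
      by (cases "f x \<ge> 0"; cases "f x = 0") (auto simp: ennreal_neg)
  qed
qed

text \<open>The bumps of a box are dominated by its indicator, so testing against them and letting
  their parameter tend to 0 gives the integral of \<open>f\<close> over the box.\<close>

lemma fundamental_lemma:
  fixes f :: "'a::euclidean_space \<Rightarrow> real"
  assumes [measurable]: "f \<in> borel_measurable borel"
    and int: "\<And>a b. set_integrable lborel (box a b) f"
    and zero: "\<And>\<phi>. test_function \<phi> \<Longrightarrow> (LINT x|lborel. f x * \<phi> x) = 0"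
  shows "AE x in lborel. f x = 0"
proof (rule AE_zero_if_box_integrals_zero)
  fix a b :: 'a
  let ?b = "\<lambda>n. box_bump a b (1 / real (Suc n))"
  have m: "?b n \<in> borel_measurable borel" for n
    by (intro borel_measurable_continuous_onI continuous_on_test_function test_function_box_bump) auto
  have bd: "norm (f x * ?b n x) \<le> norm (indicator (box a b) x *\<^sub>R f x)" for n x
  proof (cases "x \<in> box a b")
    case True
    have "\<bar>?b n x\<bar> \<le> 1" using box_bump_bounds[of "1 / real (Suc n)" a b x] by auto
    from mult_left_mono[OF this, of "\<bar>f x\<bar>"] show ?thesis using True by (simp add: abs_mult)
  qed (simp add: box_bump_eq_0)
  have "(\<lambda>n. LINT x|lborel. f x * ?b n x) \<longlonglongrightarrow> (LINT x|lborel. f x * indicator (box a b) x)"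
  proof (rule integral_dominated_convergence)
    show "integrable lborel (\<lambda>x. norm (indicator (box a b) x *\<^sub>R f x))"
      using int[of a b] by (auto simp: set_integrable_def)
    show "AE x in lborel. (\<lambda>n. f x * ?b n x) \<longlonglongrightarrow> f x * indicator (box a b) x"
      by (intro AE_I2 tendsto_mult_left box_bump_tendsto)
    show "AE x in lborel. norm (f x * ?b n x) \<le> norm (indicator (box a b) x *\<^sub>R f x)" for n
      using bd by simp
    show "(\<lambda>x. f x * ?b n x) \<in> borel_measurable lborel" for n
      using m[of n] by simp
  qed simp
  moreover have "(LINT x|lborel. f x * ?b n x) = 0" for n
    by (intro zero test_function_box_bump) auto
  ultimately show "(LINT x:box a b|lborel. f x) = 0"
    by (simp add: LIMSEQ_const_iff set_lebesgue_integral_def mult.commute)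
qed (use int in auto)

section \<open>Weak gradients\<close>

lemma integral_lborel_shift:
  fixes f :: "'a::euclidean_space \<Rightarrow> 'b::{banach, second_countable_topology}"
  assumes [measurable]: "f \<in> borel_measurable borel"
  shows "(LINT x|lborel. f (x + h)) = (LINT x|lborel. f x)"
proof -
  have "(LINT x|lborel. f x) = (LINT x|distr lborel borel ((+) h). f x)"
    by (simp add: lborel_distr_plus)
  also have "\<dots> = (LINT x|lborel. f (x + h))"
    by (subst integral_distr) (auto simp: add.commute)
  finally show ?thesis by simp
qed

lemma nn_integral_lborel_shift:
  fixes f :: "'a::euclidean_space \<Rightarrow> ennreal"
  assumes [measurable]: "f \<in> borel_measurable borel"
  shows "(\<integral>\<^sup>+x. f (x + h) \<partial>lborel) = (\<integral>\<^sup>+x. f x \<partial>lborel)"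
proof -
  have "(\<integral>\<^sup>+x. f x \<partial>lborel) = (\<integral>\<^sup>+x. f x \<partial>distr lborel borel ((+) h))"
    by (simp add: lborel_distr_plus)
  also have "\<dots> = (\<integral>\<^sup>+x. f (x + h) \<partial>lborel)"
    by (subst nn_integral_distr) (auto simp: add.commute)
  finally show ?thesis by simp
qed

lemma integrable_lborel_shift:
  fixes f :: "'a::euclidean_space \<Rightarrow> 'b::{banach, second_countable_topology}"
  assumes "integrable lborel f"
  shows "integrable lborel (\<lambda>x. f (x + h))"
proof -
  have "integrable (distr lborel borel ((+) h)) f"
    using assms by (simp add: lborel_distr_plus)
  then have "integrable lborel (\<lambda>x. f (h + x))"
    by (subst (asm) integrable_distr_eq) (use assms in auto)
  then show ?thesis by (simp add: add.commute)
qed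

text \<open>The second bound sees \<open>w\<close> only through \<open>B\<close> and
  \<open>r\<close>. This uniformity lets Fubini act on a whole family of translates.\<close>

lemma integrable_mult_bounded_support:
  fixes u :: "'a::euclidean_space \<Rightarrow> real"
  assumes u: "set_integrable lborel (cball 0 r) u" and [measurable]: "u \<in> borel_measurable borel"
    and [measurable]: "w \<in> borel_measurable borel"
    and w: "\<And>x. \<bar>w x\<bar> \<le> B" "\<And>x. norm x > r \<Longrightarrow> w x = 0"
  shows "integrable lborel (\<lambda>x. u x * w x)"
    and "(LINT x|lborel. \<bar>u x * w x\<bar>) \<le> (LINT x|lborel. indicator (cball 0 r) x * \<bar>u x\<bar>) * B"
proof -
  have i: "integrable lborel (\<lambda>x. (indicator (cball 0 r) x * \<bar>u x\<bar>) * B)"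
    using integrable_abs[OF u[unfolded set_integrable_def]] by (auto simp: abs_mult)
  have bd: "\<bar>u x * w x\<bar> \<le> (indicator (cball 0 r) x * \<bar>u x\<bar>) * B" for x
    using w[of x] by (cases "norm x > r") (auto simp: abs_mult mult_left_mono)
  show i2: "integrable lborel (\<lambda>x. u x * w x)"
    by (rule Bochner_Integration.integrable_bound[OF i])
       (auto intro!: AE_I2 order_trans[OF _ abs_ge_self] bd simp del: abs_mult)
  show "(LINT x|lborel. \<bar>u x * w x\<bar>) \<le> (LINT x|lborel. indicator (cball 0 r) x * \<bar>u x\<bar>) * B"
    by (subst integral_mult_left_zero[symmetric]) (intro integral_mono integrable_abs i i2 bd)
qed

lemma Fubini_unit_interval:
  fixes H :: "real \<Rightarrow> 'a::euclidean_space \<Rightarrow> real"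
  assumes [measurable]: "case_prod H \<in> borel_measurable (borel \<Otimes>\<^sub>M borel)"
    and int: "\<And>t. 0 \<le> t \<Longrightarrow> t \<le> 1 \<Longrightarrow> integrable lborel (H t)"
    and bd: "\<And>t. 0 \<le> t \<Longrightarrow> t \<le> 1 \<Longrightarrow> (LINT x|lborel. \<bar>H t x\<bar>) \<le> C"
  shows "integrable (lborel \<Otimes>\<^sub>M lborel) (\<lambda>(t, x). indicator {0..1} t * H t x)"
    and "(LINT x|lborel. LINT t|lborel. indicator {0..1} t * H t x) =
         (LINT t|lborel. indicator {0..1} t * (LINT x|lborel. H t x))"
    and "integrable lborel (\<lambda>x. LINT t|lborel. indicator {0..1} t * H t x)"
proof -
  show i: "integrable (lborel \<Otimes>\<^sub>M lborel) (\<lambda>(t, x). indicator {0..1} t * H t x)"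
  proof (rule lborel_pair.Fubini_integrable)
    show "(\<lambda>(t, x). indicator {0..1} t * H t x) \<in> borel_measurable (lborel \<Otimes>\<^sub>M lborel)"
      by measurable
    have "integrable lborel (\<lambda>t::real. indicator {0..1} t * C)"
      by (intro integrable_mult_left integrable_real_indicator) auto
    then show "integrable lborel (\<lambda>t. LINT x|lborel. norm (case (t, x) of (t, x) \<Rightarrow> indicator {0..1} t * H t x))"
      by (rule Bochner_Integration.integrable_bound)
         (use bd in \<open>auto simp: abs_mult indicator_def intro!: AE_I2 order_trans[OF _ abs_ge_self]\<close>)
    show "AE t in lborel. integrable lborel (\<lambda>x. case (t, x) of (t, x) \<Rightarrow> indicator {0..1} t * H t x)"
      using int by (intro AE_I2) (auto simp: indicator_def)
  qed
  show "(LINT x|lborel. LINT t|lborel. indicator {0..1} t * H t x) =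
         (LINT t|lborel. indicator {0..1} t * (LINT x|lborel. H t x))"
    using lborel_pair.Fubini_integral[OF i] by simp
  show "integrable lborel (\<lambda>x. LINT t|lborel. indicator {0..1} t * H t x)"
    using lborel_pair.integrable_snd[OF i] by simp
qed

section \<open>Support, derivatives and translates of test functions\<close>

lemma test_function_support:
  assumes "test_function \<phi>"
  obtains r where "r > 0" "\<And>x. norm x > r \<Longrightarrow> \<phi> x = 0"
    "\<And>x h. norm x > r \<Longrightarrow> frechet_derivative \<phi> (at x) h = 0"
proof -
  have "bounded {x. \<phi> x \<noteq> 0}"
    using assms unfolding test_function_def by (meson bounded_subset closure_subset compact_imp_bounded)
  then obtain r where r: "r > 0" "\<And>x. \<phi> x \<noteq> 0 \<Longrightarrow> norm x \<le> r"
    by (auto simp: bounded_pos)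
  have z: "\<phi> x = 0" if "norm x > r" for x using r(2)[of x] that by force
  have "frechet_derivative \<phi> (at x) h = 0" if "norm x > r" for x h
  proof -
    have "((\<lambda>x. 0) has_derivative (\<lambda>h. 0)) (at x)" by simp
    then have "(\<phi> has_derivative (\<lambda>h. 0)) (at x)"
      by (rule has_derivative_transform_within_open[where s="- cball 0 r"]) (use that z in \<open>auto simp: not_le\<close>)
    then show ?thesis using frechet_derivative_at by metis
  qed
  with r z show ?thesis using that by blast
qed

lemma test_function_has_derivative:
  "test_function \<phi> \<Longrightarrow> (\<phi> has_derivative frechet_derivative \<phi> (at x)) (at x)"
  unfolding test_function_def using Ck_Suc_derivative(1)[of 0] by blast

lemma test_function_derivative_expand:
  assumes "test_function \<phi>"
  shows "frechet_derivative \<phi> (at x) h = (\<Sum>i\<in>Basis. (h \<bullet> i) * frechet_derivative \<phi> (at x) i)"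
proof -
  interpret bounded_linear "frechet_derivative \<phi> (at x)"
    using test_function_has_derivative[OF assms] by (rule has_derivative_bounded_linear)
  have "frechet_derivative \<phi> (at x) h = frechet_derivative \<phi> (at x) (\<Sum>i\<in>Basis. (h \<bullet> i) *\<^sub>R i)"
    by (simp add: euclidean_representation)
  then show ?thesis by (simp add: sum scaleR)
qed

lemma test_function_derivative_continuous:
  assumes "test_function \<phi>"
  shows "continuous_on UNIV (\<lambda>x. frechet_derivative \<phi> (at x) h)"
proof -
  have "continuous_on UNIV (\<lambda>x. frechet_derivative \<phi> (at x) i)" if "i \<in> Basis" for i
    using assms that Ck_Suc_derivative(2)[of 0 \<phi> i] unfolding test_function_def by (metis Ck.simps(1))
  then show ?thesis
    by (subst test_function_derivative_expand[OF assms]) (auto intro!: continuous_intros)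
qed

lemma test_function_bounded:
  assumes "test_function \<phi>"
  obtains B where "\<And>x. \<bar>\<phi> x\<bar> \<le> B" "\<And>x. \<bar>frechet_derivative \<phi> (at x) h\<bar> \<le> B"
proof -
  obtain r where r: "r > 0" "\<And>x. norm x > r \<Longrightarrow> \<phi> x = 0"
    "\<And>x h. norm x > r \<Longrightarrow> frechet_derivative \<phi> (at x) h = 0"
    using test_function_support[OF assms] by metis
  have *: "\<exists>B. \<forall>x. \<bar>w x\<bar> \<le> B" if "continuous_on UNIV w" "\<And>x. norm x > r \<Longrightarrow> w x = 0" for w :: "'a \<Rightarrow> real"
  proof -
    have "compact (w ` cball 0 r)"
      using that(1) by (intro compact_continuous_image) (auto intro: continuous_on_subset)
    then obtain B where "B > 0" "\<forall>y\<in>w ` cball 0 r. norm y \<le> B"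
      using compact_imp_bounded bounded_pos by metis
    then show ?thesis using that(2)
      by (intro exI[of _ B]) (metis abs_zero imageI less_eq_real_def mem_cball_0 not_le real_norm_def)
  qed
  obtain B1 where B1: "\<And>x. \<bar>\<phi> x\<bar> \<le> B1"
    using *[of \<phi>] continuous_on_test_function[OF assms] r(2) by metis
  obtain B2 where B2: "\<And>x. \<bar>frechet_derivative \<phi> (at x) h\<bar> \<le> B2"
    using *[OF test_function_derivative_continuous[OF assms], of h] r(3) by metis
  show ?thesis
    by (rule that[of "max B1 B2"]) (use B1 B2 in \<open>auto simp: le_max_iff_disj\<close>)
qed

lemma Ck_shift:
  fixes f :: "'a::euclidean_space \<Rightarrow> real"
  assumes "Ck k f"
  shows "Ck k (\<lambda>x. f (x + h))"
  using assms
proof (induction k arbitrary: f)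
  case 0
  then have "continuous_on UNIV f" by simp
  from continuous_on_compose2[OF this, of UNIV "\<lambda>x. x + h"] show ?case
    by (simp add: continuous_intros)
next
  case (Suc k)
  have "((\<lambda>x. f (x + h)) has_derivative frechet_derivative f (at (x + h))) (at x)" for x
    using has_derivative_compose[of "\<lambda>x. x + h" "\<lambda>x. x" x UNIV f, OF _ Ck_Suc_derivative(1)[OF Suc.prems]]
    by (simp add: has_derivative_add_const)
  then show ?case
    by (rule Ck_SucI) (intro Suc.IH Ck_Suc_derivative(2)[OF Suc.prems])
qed

lemma test_function_shift:
  fixes \<phi> :: "'a::euclidean_space \<Rightarrow> real"
  assumes "test_function \<phi>"
  shows "test_function (\<lambda>x. \<phi> (x + h))"
    and "frechet_derivative (\<lambda>x. \<phi> (x + h)) (at x) = frechet_derivative \<phi> (at (x + h))"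
proof -
  have "bounded {x. \<phi> x \<noteq> 0}"
    using assms unfolding test_function_def by (meson bounded_subset closure_subset compact_imp_bounded)
  then have "bounded ((\<lambda>x. - h + x) ` {x. \<phi> x \<noteq> 0})"
    by (rule bounded_translation)
  then have "bounded {x. \<phi> (x + h) \<noteq> 0}"
    by (rule bounded_subset) (auto simp: image_iff intro!: exI[of _ "_ + h"])
  then show "test_function (\<lambda>x. \<phi> (x + h))"
    using assms unfolding test_function_def by (auto intro: Ck_shift)
  have "((\<lambda>x. \<phi> (x + h)) has_derivative frechet_derivative \<phi> (at (x + h))) (at x)"
    using has_derivative_compose[of "\<lambda>x. x + h" "\<lambda>x. x" x UNIV \<phi>, OF _ test_function_has_derivative[OF assms]]
    by (simp add: has_derivative_add_const)
  then show "frechet_derivative (\<lambda>x. \<phi> (x + h)) (at x) = frechet_derivative \<phi> (at (x + h))"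
    by (rule frechet_derivative_at[symmetric])
qed

text \<open>Borel representatives are used because \<open>u (x + t *\<^sub>R h)\<close> has to be
  jointly measurable in \<open>t\<close> and \<open>x\<close> for Fubini. The direction
  \<open>h\<close> is arbitrary since differences of \<open>u\<close> in every direction occur
  later.\<close>

definition borel_weak_gradient :: "('a::euclidean_space \<Rightarrow> real) \<Rightarrow> ('a \<Rightarrow> 'a) \<Rightarrow> bool" where
  "borel_weak_gradient u g \<longleftrightarrow> u \<in> borel_measurable borel \<and> g \<in> borel_measurable borel \<and>
    (\<forall>r. set_integrable lborel (cball 0 r) u) \<and> (\<forall>r. set_integrable lborel (cball 0 r) g) \<and>
    (\<forall>\<phi> h. test_function \<phi> \<longrightarrow> (LINT x|lborel. u x * frechet_derivative \<phi> (at x) h)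
       = - (LINT x|lborel. (g x \<bullet> h) * \<phi> x))"

section \<open>Borel representatives of locally integrable functions\<close>

lemma locally_integrable_measurable:
  assumes "locally_integrable f"
  shows "f \<in> borel_measurable lebesgue"
proof (rule borel_measurable_LIMSEQ_metric)
  show "(\<lambda>x. indicator (cball 0 (real n)) x *\<^sub>R f x) \<in> borel_measurable lebesgue" for n
    using assms unfolding locally_integrable_def set_integrable_def
    by (intro borel_measurable_integrable) auto
  show "(\<lambda>n. indicator (cball 0 (real n)) x *\<^sub>R f x) \<longlonglongrightarrow> f x" for x
  proof (rule tendsto_eventually)
    obtain N where "norm x \<le> real N" using real_arch_simple by blast
    then show "\<forall>\<^sub>F n in sequentially. indicator (cball 0 (real n)) x *\<^sub>R f x = f x"
      by (intro eventually_sequentiallyI[of N]) (auto simp: indicator_def intro: order_trans)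
  qed
qed

lemma borel_representative:
  fixes g :: "'a::euclidean_space \<Rightarrow> 'b::euclidean_space"
  assumes "g \<in> borel_measurable lebesgue"
  obtains g' where "g' \<in> borel_measurable borel" "AE x in lborel. g x = g' x"
proof -
  have "\<forall>i. \<exists>g'\<in>borel_measurable lborel. AE x in lborel. g x \<bullet> i = g' x"
    using assms by (intro allI completion_ex_borel_measurable_real) auto
  then obtain G where G: "\<And>i. G i \<in> borel_measurable lborel" "\<And>i. AE x in lborel. g x \<bullet> i = G i x"
    by metis
  show ?thesis
  proof (rule that[of "\<lambda>x. \<Sum>i\<in>Basis. G i x *\<^sub>R i"])
    show "(\<lambda>x. \<Sum>i\<in>Basis. G i x *\<^sub>R i) \<in> borel_measurable borel"
      using G(1) by auto
    have "AE x in lborel. \<forall>i\<in>Basis. g x \<bullet> i = G i x"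
      using G(2) by (intro AE_finite_allI) auto
    then show "AE x in lborel. g x = (\<Sum>i\<in>Basis. G i x *\<^sub>R i)"
    proof eventually_elim
      case (elim x)
      have "g x = (\<Sum>i\<in>Basis. (g x \<bullet> i) *\<^sub>R i)" by (simp add: euclidean_representation)
      with elim show ?case by simp
    qed
  qed
qed

lemma lebesgue_integral_AE_borel:
  fixes f :: "'a::euclidean_space \<Rightarrow> 'b::{banach, second_countable_topology}"
  assumes f: "f \<in> borel_measurable lebesgue" and f': "f' \<in> borel_measurable borel"
    and ae: "AE x in lborel. f x = f' x"
  shows "integrable lebesgue f \<longleftrightarrow> integrable lborel f'"
    and "(LINT x|lebesgue. f x) = (LINT x|lborel. f' x)"
proof -
  have f'2: "f' \<in> borel_measurable lebesgue"
    using f' by (simp add: measurable_completion)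
  have ae': "AE x in lebesgue. f x = f' x"
    using ae by (rule AE_completion)
  show "integrable lebesgue f \<longleftrightarrow> integrable lborel f'"
    using integrable_cong_AE[OF f f'2 ae'] integrable_completion[of f' lborel] f' by simp
  show "(LINT x|lebesgue. f x) = (LINT x|lborel. f' x)"
    using integral_cong_AE[OF f f'2 ae'] integral_completion[of f' lborel] f' by simp
qed

lemma integral_weak_gradient_expand:
  fixes u :: "'a::euclidean_space \<Rightarrow> real"
  assumes u[measurable]: "u \<in> borel_measurable borel" and g[measurable]: "g \<in> borel_measurable borel"
    and ui: "\<And>r. set_integrable lborel (cball 0 r) u" and gi: "\<And>r. set_integrable lborel (cball 0 r) g"
    and t: "test_function \<phi>"
    and eq: "\<And>i. i \<in> Basis \<Longrightarrow> (LINT x|lborel. u x * frechet_derivative \<phi> (at x) i)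
       = - (LINT x|lborel. (g x \<bullet> i) * \<phi> x)"
  shows "(LINT x|lborel. u x * frechet_derivative \<phi> (at x) h) = - (LINT x|lborel. (g x \<bullet> h) * \<phi> x)"
proof -
  obtain r where r: "r > 0" "\<And>x. norm x > r \<Longrightarrow> \<phi> x = 0"
    "\<And>x h. norm x > r \<Longrightarrow> frechet_derivative \<phi> (at x) h = 0"
    using test_function_support[OF t] by metis
  have [measurable]: "\<phi> \<in> borel_measurable borel" "(\<lambda>x. frechet_derivative \<phi> (at x) i) \<in> borel_measurable borel" for i
    by (intro borel_measurable_continuous_onI continuous_on_test_function
        test_function_derivative_continuous t)+
  have gi': "set_integrable lborel (cball 0 r) (\<lambda>x. g x \<bullet> i)" for i
    using integrable_inner_left[OF gi[of r, unfolded set_integrable_def], of i]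
    by (auto simp: set_integrable_def)
  have i1: "integrable lborel (\<lambda>x. u x * frechet_derivative \<phi> (at x) i)" for i
  proof -
    obtain B where "\<And>x. \<bar>frechet_derivative \<phi> (at x) i\<bar> \<le> B"
      using test_function_bounded[OF t, of i] by metis
    then show ?thesis using r by (intro integrable_mult_bounded_support(1)[OF ui[of r]]) auto
  qed
  have i2: "integrable lborel (\<lambda>x. (g x \<bullet> i) * \<phi> x)" for i
  proof -
    obtain B where "\<And>x. \<bar>\<phi> x\<bar> \<le> B" using test_function_bounded[OF t] by metis
    then show ?thesis using r by (intro integrable_mult_bounded_support(1)[OF gi'[of i]]) auto
  qed
  have "(LINT x|lborel. u x * frechet_derivative \<phi> (at x) h) =
      (LINT x|lborel. (\<Sum>i\<in>Basis. (h \<bullet> i) * (u x * frechet_derivative \<phi> (at x) i)))"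
    by (subst test_function_derivative_expand[OF t]) (simp add: sum_distrib_left mult_ac)
  also have "\<dots> = (\<Sum>i\<in>Basis. (h \<bullet> i) * (LINT x|lborel. u x * frechet_derivative \<phi> (at x) i))"
    using i1 by (subst Bochner_Integration.integral_sum) auto
  also have "\<dots> = - (\<Sum>i\<in>Basis. (h \<bullet> i) * (LINT x|lborel. (g x \<bullet> i) * \<phi> x))"
    by (simp add: eq sum_negf)
  also have "\<dots> = - (LINT x|lborel. (\<Sum>i\<in>Basis. (h \<bullet> i) * ((g x \<bullet> i) * \<phi> x)))"
    using i2 by (subst Bochner_Integration.integral_sum) auto
  also have "\<dots> = - (LINT x|lborel. (g x \<bullet> h) * \<phi> x)"
    by (simp add: euclidean_inner[of "g _" h] sum_distrib_left mult_ac)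
  finally show ?thesis .
qed

lemma locally_integrable_AE_borel:
  fixes f :: "'a::euclidean_space \<Rightarrow> 'b::euclidean_space"
  assumes "locally_integrable f" "f' \<in> borel_measurable borel" "AE x in lborel. f x = f' x"
  shows "set_integrable lborel (cball 0 r) f'"
proof -
  have "set_integrable lebesgue (cball 0 r) f"
    using assms(1) unfolding locally_integrable_def by auto
  then have "integrable lebesgue (\<lambda>x. indicator (cball 0 r) x *\<^sub>R f x)"
    by (simp add: set_integrable_def)
  then have "integrable lborel (\<lambda>x. indicator (cball 0 r) x *\<^sub>R f' x)"
    by (subst (asm) lebesgue_integral_AE_borel(1)[where f'="\<lambda>x. indicator (cball 0 r) x *\<^sub>R f' x"])
       (use assms(2,3) borel_measurable_integrable[OF \<open>integrable lebesgue _\<close>] in \<open>auto intro!: borel_measurable_scaleR borel_measurable_indicator\<close>)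
  then show ?thesis by (simp add: set_integrable_def)
qed

lemma has_weak_gradient_borel:
  fixes u :: "'a::euclidean_space \<Rightarrow> real"
  assumes "has_weak_gradient u g"
    and u': "u' \<in> borel_measurable borel" "AE x in lborel. u x = u' x"
    and g': "g' \<in> borel_measurable borel" "AE x in lborel. g x = g' x"
  shows "borel_weak_gradient u' g'"
proof -
  have l: "locally_integrable u" "locally_integrable g"
    using assms unfolding has_weak_gradient_def by auto
  have m[measurable]: "u \<in> borel_measurable lebesgue" "g \<in> borel_measurable lebesgue"
    using l by (auto intro: locally_integrable_measurable)
  note [measurable] = u'(1) g'(1)
  have ui: "set_integrable lborel (cball 0 r) u'" and gi: "set_integrable lborel (cball 0 r) g'" for r
    using locally_integrable_AE_borel[OF l(1) u'] locally_integrable_AE_borel[OF l(2) g'] by auto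
  have "(LINT x|lborel. u' x * frechet_derivative \<phi> (at x) h) = - (LINT x|lborel. (g' x \<bullet> h) * \<phi> x)"
    if t: "test_function \<phi>" for \<phi> h
  proof (rule integral_weak_gradient_expand[OF u'(1) g'(1) ui gi t])
    fix i :: 'a assume i: "i \<in> Basis"
    have [measurable]: "\<phi> \<in> borel_measurable borel" "(\<lambda>x. frechet_derivative \<phi> (at x) i) \<in> borel_measurable borel"
      by (intro borel_measurable_continuous_onI continuous_on_test_function
          test_function_derivative_continuous t)+
    have [measurable]: "\<phi> \<in> borel_measurable lebesgue" "(\<lambda>x. frechet_derivative \<phi> (at x) i) \<in> borel_measurable lebesgue"
      by (auto intro: measurable_completion)
    have "(LINT x|lborel. u' x * frechet_derivative \<phi> (at x) i) = (LINT x|lebesgue. u x * frechet_derivative \<phi> (at x) i)"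
      using u'(2) by (intro lebesgue_integral_AE_borel(2)[symmetric]) auto
    also have "\<dots> = - (LINT x|lebesgue. (g x \<bullet> i) * \<phi> x)"
      using assms(1) t i unfolding has_weak_gradient_def by auto
    also have "(LINT x|lebesgue. (g x \<bullet> i) * \<phi> x) = (LINT x|lborel. (g' x \<bullet> i) * \<phi> x)"
      using g'(2) by (intro lebesgue_integral_AE_borel(2)) auto
    finally show "(LINT x|lborel. u' x * frechet_derivative \<phi> (at x) i) = - (LINT x|lborel. (g' x \<bullet> i) * \<phi> x)" .
  qed
  then show ?thesis
    using ui gi u'(1) g'(1) unfolding borel_weak_gradient_def by auto
qed

text \<open>Each component of \<open>g1 - g2\<close> annihilates all test functions. As
  \<open>weak_gradient\<close> is an arbitrary choice, this is what identifies it with an explicitly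
  computed gradient.\<close>

lemma borel_weak_gradient_unique:
  fixes u :: "'a::euclidean_space \<Rightarrow> real"
  assumes 1: "borel_weak_gradient u g1" and 2: "borel_weak_gradient u g2"
  shows "AE x in lborel. g1 x = g2 x"
proof -
  have [measurable]: "g1 \<in> borel_measurable borel" "g2 \<in> borel_measurable borel"
    and gi: "set_integrable lborel (cball 0 r) g1" "set_integrable lborel (cball 0 r) g2" for r
    using 1 2 by (auto simp: borel_weak_gradient_def)
  have gi': "set_integrable lborel (cball 0 r) (\<lambda>x. g1 x \<bullet> i)" "set_integrable lborel (cball 0 r) (\<lambda>x. g2 x \<bullet> i)" for i r
    using integrable_inner_left[OF gi(1)[of r, unfolded set_integrable_def], of i]
      integrable_inner_left[OF gi(2)[of r, unfolded set_integrable_def], of i]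
    by (auto simp: set_integrable_def)
  have "AE x in lborel. (g1 x - g2 x) \<bullet> i = 0" for i
  proof (rule fundamental_lemma)
    show "set_integrable lborel (box a b) (\<lambda>x. (g1 x - g2 x) \<bullet> i)" for a b
    proof -
      obtain r where "box a b \<subseteq> cball 0 r"
        using bounded_box[of a b] unfolding bounded_iff by (metis mem_cball_0 subsetI)
      then show ?thesis
        using set_integrable_subset[OF set_integral_diff(1)[OF gi'(1)[of r i] gi'(2)[of r i]], of "box a b"]
        by (auto simp: inner_diff_left)
    qed
    fix \<phi> :: "'a \<Rightarrow> real" assume t: "test_function \<phi>"
    have [measurable]: "\<phi> \<in> borel_measurable borel"
      by (intro borel_measurable_continuous_onI continuous_on_test_function t)
    obtain r where r: "r > 0" "\<And>x. norm x > r \<Longrightarrow> \<phi> x = 0"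
      using test_function_support[OF t] by metis
    obtain B where B: "\<And>x. \<bar>\<phi> x\<bar> \<le> B" using test_function_bounded[OF t] by metis
    have i: "integrable lborel (\<lambda>x. (g1 x \<bullet> i) * \<phi> x)" "integrable lborel (\<lambda>x. (g2 x \<bullet> i) * \<phi> x)"
      using r B by (auto intro!: integrable_mult_bounded_support(1)[OF gi'(1)] integrable_mult_bounded_support(1)[OF gi'(2)])
    have "(LINT x|lborel. ((g1 x - g2 x) \<bullet> i) * \<phi> x) = (LINT x|lborel. (g1 x \<bullet> i) * \<phi> x) - (LINT x|lborel. (g2 x \<bullet> i) * \<phi> x)"
      using i by (simp add: inner_diff_left left_diff_distrib)
    also have "\<dots> = 0"
      using 1 2 t unfolding borel_weak_gradient_def by (metis (no_types, lifting) diff_self minus_equation_iff)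
    finally show "(LINT x|lborel. ((g1 x - g2 x) \<bullet> i) * \<phi> x) = 0" .
  qed simp
  then have "AE x in lborel. \<forall>i\<in>Basis. (g1 x - g2 x) \<bullet> i = 0"
    by (intro AE_finite_allI) auto
  then show ?thesis
  proof eventually_elim
    case (elim x)
    show ?case by (rule euclidean_eqI) (use elim in \<open>simp add: inner_diff_left\<close>)
  qed
qed

section \<open>Difference quotients of Sobolev functions\<close>

text \<open>Convexity of the power on the nonnegative half line. The same tangent inequality later
  yields Jensen's inequality and also Young's inequality, in the form
  \<open>p * a ^ (p - 1) * b \<le> b ^ p + (p - 1) * a ^ p\<close>.\<close>

lemma power_tangent_le:
  fixes a b :: real
  assumes "a \<ge> 0" "b \<ge> 0"
  shows "a ^ p + real p * a ^ (p - 1) * (b - a) \<le> b ^ p"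
proof (cases p)
  case (Suc n)
  have "a ^ Suc n + real (Suc n) * a ^ n * (b - a) \<le> b ^ Suc n"
  proof (induction n)
    case (Suc n)
    \<comment> \<open>The induction hypothesis is multiplied by \<open>b\<close>; the defect is a
      nonnegative multiple of the square of \<open>b - a\<close>.\<close>
    have "a ^ Suc (Suc n) + real (Suc (Suc n)) * a ^ Suc n * (b - a)
      = b * (a ^ Suc n + real (Suc n) * a ^ n * (b - a)) - real (Suc n) * a ^ n * (b - a)\<^sup>2"
      by (simp add: algebra_simps power2_eq_square)
    also have "\<dots> \<le> b * b ^ Suc n - 0"
      using assms Suc by (intro diff_mono mult_left_mono) auto
    finally show ?case by simp
  qed simp
  then show ?thesis using Suc by simp
qed simp

text \<open>The tangent inequality at the mean \<open>m\<close> of \<open>norm (f x)\<close> is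
  integrated against \<open>w\<close>, where the linear term cancels. The right side is an extended
  integral because the inequality is applied before finiteness is known.\<close>

lemma jensen_power:
  fixes w :: "'a::euclidean_space \<Rightarrow> real" and f :: "'a \<Rightarrow> 'b::euclidean_space"
  assumes [measurable]: "w \<in> borel_measurable borel" "f \<in> borel_measurable borel"
    and w: "\<And>x. w x \<ge> 0" "integrable lborel w" "(LINT x|lborel. w x) = 1" and p: "p \<ge> 1"
  shows "ennreal (norm (LINT x|lborel. w x *\<^sub>R f x) ^ p) \<le> (\<integral>\<^sup>+x. ennreal (w x * norm (f x) ^ p) \<partial>lborel)"
proof (cases "integrable lborel (\<lambda>x. w x *\<^sub>R f x)")
  case False
  \<comment> \<open>The Bochner integral of a non-integrable function is 0, and
    \<open>0 ^ p = 0\<close> because \<open>p \<ge> 1\<close>.\<close>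
  then show ?thesis using p by (simp add: not_integrable_integral_eq power_0_left)
next
  case i: True
  show ?thesis
  proof (cases "(\<integral>\<^sup>+x. ennreal (w x * norm (f x) ^ p) \<partial>lborel) = \<infinity>")
    case False
    then have ip: "integrable lborel (\<lambda>x. w x * norm (f x) ^ p)"
      using w(1) by (intro integrableI_nonneg) (auto simp: top.not_eq_extremum)
    have i1: "integrable lborel (\<lambda>x. w x * norm (f x))"
      using integrable_norm[OF i] w(1) by simp
    define m where "m = (LINT x|lborel. w x * norm (f x))"
    have m0: "m \<ge> 0" unfolding m_def using w(1) by (intro Bochner_Integration.integral_nonneg) auto
    have "norm (LINT x|lborel. w x *\<^sub>R f x) \<le> (LINT x|lborel. norm (w x *\<^sub>R f x))"
      by (rule integral_norm_bound)
    then have le: "norm (LINT x|lborel. w x *\<^sub>R f x) \<le> m"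
      using w(1) by (simp add: m_def)
    have "m ^ p = m ^ p * (LINT x|lborel. w x) + real p * m ^ (p - 1) * (LINT x|lborel. w x * norm (f x))
       - real p * m ^ (p - 1) * m * (LINT x|lborel. w x)"
      by (simp add: w(3) m_def)
    also have "\<dots> = (LINT x|lborel. m ^ p * w x + real p * m ^ (p - 1) * (w x * norm (f x)) - real p * m ^ (p - 1) * m * w x)"
      using i1 w(2) by simp
    also have "\<dots> \<le> (LINT x|lborel. w x * norm (f x) ^ p)"
    proof (intro integral_mono ip)
      show "integrable lborel (\<lambda>x. m ^ p * w x + real p * m ^ (p - 1) * (w x * norm (f x)) - real p * m ^ (p - 1) * m * w x)"
        using i1 w(2) by auto
      fix x
      show "m ^ p * w x + real p * m ^ (p - 1) * (w x * norm (f x)) - real p * m ^ (p - 1) * m * w x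
         \<le> w x * norm (f x) ^ p"
        using mult_left_mono[OF power_tangent_le[OF m0 norm_ge_zero[of "f x"], of p] w(1)[of x]]
        by (simp add: algebra_simps)
    qed
    finally have "norm (LINT x|lborel. w x *\<^sub>R f x) ^ p \<le> (LINT x|lborel. w x * norm (f x) ^ p)"
      using power_mono[OF le, of p] by simp
    then have "ennreal (norm (LINT x|lborel. w x *\<^sub>R f x) ^ p) \<le> ennreal (LINT x|lborel. w x * norm (f x) ^ p)"
      by (rule ennreal_leI)
    also have "\<dots> = (\<integral>\<^sup>+x. ennreal (w x * norm (f x) ^ p) \<partial>lborel)"
      using w(1) by (intro nn_integral_eq_integral[symmetric] ip) auto
    finally show ?thesis .
  qed simp
qed

lemma set_integrable_cball_inner:
  fixes g :: "'a::euclidean_space \<Rightarrow> 'b::euclidean_space"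
  assumes "set_integrable lborel (cball 0 r) g"
  shows "set_integrable lborel (cball 0 r) (\<lambda>x. g x \<bullet> h)"
  using integrable_inner_left[OF assms[unfolded set_integrable_def], of h]
  by (auto simp: set_integrable_def)

text \<open>For \<open>t\<close> in [0, 1] the translates of \<open>\<psi>\<close> all vanish
  outside the ball of radius \<open>r + norm h\<close>, so a single bound on the inner integrals
  serves every \<open>t\<close>.\<close>

lemma Fubini_shift:
  fixes w :: "'a::euclidean_space \<Rightarrow> real"
  assumes [measurable]: "w \<in> borel_measurable borel" "\<psi> \<in> borel_measurable borel"
    and wi: "\<And>r. set_integrable lborel (cball 0 r) w"
    and b: "\<And>x. \<bar>\<psi> x\<bar> \<le> B" "\<And>x. norm x > r \<Longrightarrow> \<psi> x = 0"
  shows "(LINT x|lborel. LINT t|lborel. indicator {0..1} t * (w x * \<psi> (x - t *\<^sub>R h))) =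
         (LINT t|lborel. indicator {0..1} t * (LINT x|lborel. w x * \<psi> (x - t *\<^sub>R h)))"
    and "(LINT x|lborel. LINT t|lborel. indicator {0..1} t * (w (x + t *\<^sub>R h) * \<psi> x)) =
         (LINT t|lborel. indicator {0..1} t * (LINT x|lborel. w (x + t *\<^sub>R h) * \<psi> x))"
    and "integrable lborel (\<lambda>x. LINT t|lborel. indicator {0..1} t * (w (x + t *\<^sub>R h) * \<psi> x))"
proof -
  have supp: "\<psi> (x - t *\<^sub>R h) = 0" if "norm x > r + norm h" "0 \<le> t" "t \<le> 1" for t x
  proof (rule b(2))
    have "norm (t *\<^sub>R h) \<le> norm h" using that by (simp add: mult_left_le_one_le)
    then show "norm (x - t *\<^sub>R h) > r" using that norm_triangle_ineq2[of x "t *\<^sub>R h"] by linarith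
  qed
  have 1: "integrable lborel (\<lambda>x. w x * \<psi> (x - t *\<^sub>R h))"
    "(LINT x|lborel. \<bar>w x * \<psi> (x - t *\<^sub>R h)\<bar>) \<le> (LINT x|lborel. indicator (cball 0 (r + norm h)) x * \<bar>w x\<bar>) * B"
    if "0 \<le> t" "t \<le> 1" for t
    using integrable_mult_bounded_support[OF wi[of "r + norm h"], where w="\<lambda>x. \<psi> (x - t *\<^sub>R h)" and B=B] b(1) supp that
    by auto
  have 2: "integrable lborel (\<lambda>x. w (x + t *\<^sub>R h) * \<psi> x)"
    "(LINT x|lborel. \<bar>w (x + t *\<^sub>R h) * \<psi> x\<bar>) \<le> (LINT x|lborel. indicator (cball 0 (r + norm h)) x * \<bar>w x\<bar>) * B"
    if "0 \<le> t" "t \<le> 1" for t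
    using integrable_lborel_shift[OF 1(1)[OF that], of "t *\<^sub>R h"] 1(2)[OF that]
      integral_lborel_shift[of "\<lambda>x. \<bar>w x * \<psi> (x - t *\<^sub>R h)\<bar>" "t *\<^sub>R h"] by auto
  show "(LINT x|lborel. LINT t|lborel. indicator {0..1} t * (w x * \<psi> (x - t *\<^sub>R h))) =
         (LINT t|lborel. indicator {0..1} t * (LINT x|lborel. w x * \<psi> (x - t *\<^sub>R h)))"
    by (rule Fubini_unit_interval(2)[OF _ 1]) measurable
  show "(LINT x|lborel. LINT t|lborel. indicator {0..1} t * (w (x + t *\<^sub>R h) * \<psi> x)) =
         (LINT t|lborel. indicator {0..1} t * (LINT x|lborel. w (x + t *\<^sub>R h) * \<psi> x))"
    by (rule Fubini_unit_interval(2)[OF _ 2]) measurable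
  show "integrable lborel (\<lambda>x. LINT t|lborel. indicator {0..1} t * (w (x + t *\<^sub>R h) * \<psi> x))"
    by (rule Fubini_unit_interval(3)[OF _ 2]) measurable
qed

lemma test_function_FTC:
  assumes t: "test_function \<phi>"
  shows "\<phi> (x - h) - \<phi> x = - (LINT t|lborel. indicator {0..1} t * frechet_derivative \<phi> (at (x - t *\<^sub>R h)) h)"
proof -
  have lin: "frechet_derivative \<phi> (at y) (- (s *\<^sub>R h)) = - (s * frechet_derivative \<phi> (at y) h)" for s y
  proof -
    interpret bounded_linear "frechet_derivative \<phi> (at y)"
      using test_function_has_derivative[OF t] by (rule has_derivative_bounded_linear)
    show ?thesis by (simp add: neg scaleR)
  qed
  have d: "((\<lambda>t. - \<phi> (x - t *\<^sub>R h)) has_vector_derivative frechet_derivative \<phi> (at (x - t *\<^sub>R h)) h) (at t within {0..1})" for t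
  proof -
    have "((\<lambda>t. x - t *\<^sub>R h) has_derivative (\<lambda>s. - (s *\<^sub>R h))) (at t within {0..1})"
      by (auto intro!: derivative_eq_intros)
    from has_derivative_minus[OF has_derivative_compose[OF this test_function_has_derivative[OF t]]]
    show ?thesis
      by (simp add: has_vector_derivative_def lin)
  qed
  have c: "continuous_on {0..1} (\<lambda>t. frechet_derivative \<phi> (at (x - t *\<^sub>R h)) h)"
    by (rule continuous_on_compose2[OF test_function_derivative_continuous[OF t]]) (auto intro!: continuous_intros)
  from integral_FTC_Icc[OF _ d c]
  have "(LINT t|lborel. indicator {0..1} t *\<^sub>R frechet_derivative \<phi> (at (x - t *\<^sub>R h)) h) = \<phi> x - \<phi> (x - h)"
    by simp
  then show ?thesis by simp
qed

text \<open>Both sides agree against every test function once the translations are moved onto it.\<close>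

theorem weak_gradient_difference:
  fixes u :: "'a::euclidean_space \<Rightarrow> real"
  assumes wg: "borel_weak_gradient u g"
  shows "AE x in lborel. u (x + h) - u x = (LINT t|lborel. indicator {0..1} t * (g (x + t *\<^sub>R h) \<bullet> h))"
proof -
  have [measurable]: "u \<in> borel_measurable borel" "g \<in> borel_measurable borel"
    and ui: "\<And>r. set_integrable lborel (cball 0 r) u" and gi: "\<And>r. set_integrable lborel (cball 0 r) g"
    using wg by (auto simp: borel_weak_gradient_def)
  note gi' = set_integrable_cball_inner[OF gi, of _ h]
  define I where "I x = (LINT t|lborel. indicator {0..1} t * (g (x + t *\<^sub>R h) \<bullet> h))" for x
  have [measurable]: "I \<in> borel_measurable borel"
    unfolding I_def by measurable
  have i0: "integrable lborel (\<lambda>x. u (x + h) * \<psi> x)" "integrable lborel (\<lambda>x. u x * \<psi> x)" "integrable lborel (\<lambda>x. I x * \<psi> x)"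
    if [measurable]: "\<psi> \<in> borel_measurable borel" and b: "\<And>x. \<bar>\<psi> x\<bar> \<le> B" "\<And>x. norm x > r \<Longrightarrow> \<psi> x = 0" for \<psi> B r
  proof -
    have "norm (x - h) > r" if "norm x > r + norm h" for x
      using that norm_triangle_ineq2[of x h] by linarith
    then have "integrable lborel (\<lambda>x. u x * \<psi> (x - h))"
      using integrable_mult_bounded_support(1)[OF ui[of "r + norm h"], where w="\<lambda>x. \<psi> (x - h)" and B=B] b by auto
    from integrable_lborel_shift[OF this, of h] show "integrable lborel (\<lambda>x. u (x + h) * \<psi> x)" by simp
    show "integrable lborel (\<lambda>x. u x * \<psi> x)"
      by (rule integrable_mult_bounded_support(1)[OF ui _ _ b]) auto
    have "integrable lborel (\<lambda>x. LINT t|lborel. indicator {0..1} t * (g (x + t *\<^sub>R h) \<bullet> h * \<psi> x))"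
      by (rule Fubini_shift(3)[OF _ _ gi' b]) auto
    then show "integrable lborel (\<lambda>x. I x * \<psi> x)"
      unfolding I_def by (simp only: mult.assoc[symmetric] integral_mult_left_zero)
  qed
  have "AE x in lborel. u (x + h) - u x - I x = 0"
  proof (rule fundamental_lemma)
    fix a b :: 'a
    obtain r where r: "box a b \<subseteq> cball 0 r"
      using bounded_box[of a b] unfolding bounded_iff by (metis mem_cball_0 subsetI)
    have "integrable lborel (\<lambda>x. u (x + h) * indicator (box a b) x - u x * indicator (box a b) x - I x * indicator (box a b) x)"
      using r by (intro Bochner_Integration.integrable_diff i0[where B=1 and r=r]) (auto simp: indicator_def)
    then show "set_integrable lborel (box a b) (\<lambda>x. u (x + h) - u x - I x)"
      by (simp add: set_integrable_def algebra_simps)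
  next
    fix \<phi> :: "'a \<Rightarrow> real" assume t: "test_function \<phi>"
    obtain r where r: "r > 0" "\<And>x. norm x > r \<Longrightarrow> \<phi> x = 0"
      "\<And>x h. norm x > r \<Longrightarrow> frechet_derivative \<phi> (at x) h = 0"
      using test_function_support[OF t] by metis
    obtain B where B: "\<And>x. \<bar>\<phi> x\<bar> \<le> B" "\<And>x. \<bar>frechet_derivative \<phi> (at x) h\<bar> \<le> B"
      using test_function_bounded[OF t, of h] by metis
    have [measurable]: "\<phi> \<in> borel_measurable borel" "(\<lambda>x. frechet_derivative \<phi> (at x) h) \<in> borel_measurable borel"
      by (intro borel_measurable_continuous_onI continuous_on_test_function
          test_function_derivative_continuous t)+
    note i = i0[of \<phi> B r, OF _ B(1) r(2)]
    have i': "integrable lborel (\<lambda>x. u x * \<phi> (x - h))"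
      using integrable_lborel_shift[OF i(1), of "- h"] by simp
    have "(LINT x|lborel. I x * \<phi> x) = (LINT x|lborel. LINT t|lborel. indicator {0..1} t * (g (x + t *\<^sub>R h) \<bullet> h * \<phi> x))"
      unfolding I_def by (simp only: mult.assoc[symmetric] integral_mult_left_zero)
    also have "\<dots> = (LINT t|lborel. indicator {0..1} t * (LINT x|lborel. (g (x + t *\<^sub>R h) \<bullet> h) * \<phi> x))"
      by (rule Fubini_shift(2)[OF _ _ gi' B(1) r(2)]) auto
    also have "\<dots> = (LINT t|lborel. indicator {0..1} t * (LINT x|lborel. (g x \<bullet> h) * \<phi> (x - t *\<^sub>R h)))"
      using integral_lborel_shift[of "\<lambda>x. (g x \<bullet> h) * \<phi> (x - t *\<^sub>R h)" "t *\<^sub>R h" for t]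
      by simp
    also have "\<dots> = (LINT t|lborel. indicator {0..1} t * - (LINT x|lborel. u x * frechet_derivative \<phi> (at (x - t *\<^sub>R h)) h))"
    proof -
      \<comment> \<open>A translate of a test function is a test function, so the weak gradient
        identity applies for each fixed \<open>t\<close>.\<close>
      have "(LINT x|lborel. u x * frechet_derivative \<phi> (at (x - t *\<^sub>R h)) h) = - (LINT x|lborel. (g x \<bullet> h) * \<phi> (x - t *\<^sub>R h))" for t
        using wg test_function_shift[OF t, of "- (t *\<^sub>R h)"] unfolding borel_weak_gradient_def by auto
      then show ?thesis by simp
    qed
    also have "\<dots> = - (LINT t|lborel. indicator {0..1} t * (LINT x|lborel. u x * frechet_derivative \<phi> (at (x - t *\<^sub>R h)) h))"
      by simp
    also have "\<dots> = - (LINT x|lborel. LINT t|lborel. indicator {0..1} t * (u x * frechet_derivative \<phi> (at (x - t *\<^sub>R h)) h))"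
      by (subst Fubini_shift(1)[OF _ _ ui B(2) r(3)]) auto
    also have "\<dots> = (LINT x|lborel. u x * (\<phi> (x - h) - \<phi> x))"
      by (subst test_function_FTC[OF t]) (simp add: mult.left_commute)
    also have "\<dots> = (LINT x|lborel. u x * \<phi> (x - h)) - (LINT x|lborel. u x * \<phi> x)"
      using i(2) i' by (simp add: right_diff_distrib)
    also have "(LINT x|lborel. u x * \<phi> (x - h)) = (LINT x|lborel. u (x + h) * \<phi> x)"
      using integral_lborel_shift[of "\<lambda>x. u x * \<phi> (x - h)" h] by simp
    finally have "(LINT x|lborel. I x * \<phi> x) = (LINT x|lborel. u (x + h) * \<phi> x) - (LINT x|lborel. u x * \<phi> x)" .
    then show "(LINT x|lborel. (u (x + h) - u x - I x) * \<phi> x) = 0"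
      using i by (simp add: left_diff_distrib)
  qed measurable
  then show ?thesis
    unfolding I_def by eventually_elim simp
qed

text \<open>Jensen's inequality for the uniform distribution on [0, 1] is applied to the difference
  formula. Tonelli and translation invariance then make the inner integral independent of
  \<open>t\<close>.\<close>

lemma translation_estimate:
  fixes u :: "'a::euclidean_space \<Rightarrow> real"
  assumes wg: "borel_weak_gradient u g" and p: "p \<ge> 1"
  shows "(\<integral>\<^sup>+x. ennreal (\<bar>u (x + h) - u x\<bar> ^ p) \<partial>lborel) \<le>
    ennreal (norm h ^ p) * (\<integral>\<^sup>+x. ennreal (norm (g x) ^ p) \<partial>lborel)"
proof -
  have [measurable]: "u \<in> borel_measurable borel" "g \<in> borel_measurable borel"
    using wg by (auto simp: borel_weak_gradient_def)
  have "(\<integral>\<^sup>+x. ennreal (\<bar>u (x + h) - u x\<bar> ^ p) \<partial>lborel) \<le>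
    (\<integral>\<^sup>+x. (\<integral>\<^sup>+t. ennreal (indicator {0..1} t * norm (g (x + t *\<^sub>R h) \<bullet> h) ^ p) \<partial>lborel) \<partial>lborel)"
  proof (rule nn_integral_mono_AE)
    have w: "integrable lborel (indicator {0..1} :: real \<Rightarrow> real)" "(LINT t|lborel. indicator {0..1::real} t) = (1::real)"
      by (auto intro!: integrable_real_indicator simp: content_real)
    show "AE x in lborel. ennreal (\<bar>u (x + h) - u x\<bar> ^ p) \<le> (\<integral>\<^sup>+t. ennreal (indicator {0..1} t * norm (g (x + t *\<^sub>R h) \<bullet> h) ^ p) \<partial>lborel)"
      using weak_gradient_difference[OF wg, of h]
    proof eventually_elim
      case (elim x)
      show ?case
        using jensen_power[of "indicator {0..1} :: real \<Rightarrow> real" "\<lambda>t. g (x + t *\<^sub>R h) \<bullet> h" p] w p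
        by (simp add: elim)
    qed
  qed
  also have "\<dots> = (\<integral>\<^sup>+t. (\<integral>\<^sup>+x. ennreal (indicator {0..1} t * norm (g (x + t *\<^sub>R h) \<bullet> h) ^ p) \<partial>lborel) \<partial>lborel)"
    by (rule lborel_pair.Fubini') measurable
  also have "\<dots> \<le> (\<integral>\<^sup>+t. indicator {0..1::real} t * (ennreal (norm h ^ p) * (\<integral>\<^sup>+x. ennreal (norm (g x) ^ p) \<partial>lborel)) \<partial>lborel)"
  proof (rule nn_integral_mono)
    fix t :: real
    have "(\<integral>\<^sup>+x. ennreal (indicator {0..1} t * norm (g (x + t *\<^sub>R h) \<bullet> h) ^ p) \<partial>lborel)
       \<le> (\<integral>\<^sup>+x. indicator {0..1} t * (ennreal (norm h ^ p) * ennreal (norm (g (x + t *\<^sub>R h)) ^ p)) \<partial>lborel)"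
    proof (rule nn_integral_mono)
      fix x
      have "norm (g (x + t *\<^sub>R h) \<bullet> h) ^ p \<le> (norm h * norm (g (x + t *\<^sub>R h))) ^ p"
        using Cauchy_Schwarz_ineq2[of "g (x + t *\<^sub>R h)" h] by (intro power_mono) (auto simp: mult.commute)
      then show "ennreal (indicator {0..1} t * norm (g (x + t *\<^sub>R h) \<bullet> h) ^ p) \<le> indicator {0..1} t * (ennreal (norm h ^ p) * ennreal (norm (g (x + t *\<^sub>R h)) ^ p))"
        by (auto simp: indicator_def ennreal_mult[symmetric] power_mult_distrib intro!: ennreal_leI)
    qed
    also have "\<dots> = indicator {0..1} t * (ennreal (norm h ^ p) * (\<integral>\<^sup>+x. ennreal (norm (g (x + t *\<^sub>R h)) ^ p) \<partial>lborel))"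
      by (simp add: nn_integral_cmult)
    also have "(\<integral>\<^sup>+x. ennreal (norm (g (x + t *\<^sub>R h)) ^ p) \<partial>lborel) = (\<integral>\<^sup>+x. ennreal (norm (g x) ^ p) \<partial>lborel)"
      by (rule nn_integral_lborel_shift) measurable
    finally show "(\<integral>\<^sup>+x. ennreal (indicator {0..1} t * norm (g (x + t *\<^sub>R h) \<bullet> h) ^ p) \<partial>lborel) \<le>
       indicator {0..1} t * (ennreal (norm h ^ p) * (\<integral>\<^sup>+x. ennreal (norm (g x) ^ p) \<partial>lborel))" .
  qed
  also have "\<dots> = ennreal (norm h ^ p) * (\<integral>\<^sup>+x. ennreal (norm (g x) ^ p) \<partial>lborel)"
    by (subst nn_integral_multc) auto
  finally show ?thesis .
qed

text \<open>The gradient is carried explicitly, so that the inequalities meet neither the arbitrary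
  choice in \<open>weak_gradient\<close> nor the completed measure.\<close>

definition sobolev_pair :: "nat \<Rightarrow> ('a::euclidean_space \<Rightarrow> real) \<Rightarrow> ('a \<Rightarrow> 'a) \<Rightarrow> bool" where
  "sobolev_pair p u g \<longleftrightarrow> borel_weak_gradient u g \<and>
    integrable lborel (\<lambda>x. \<bar>u x\<bar> ^ p) \<and> integrable lborel (\<lambda>x. norm (g x) ^ p)"

section \<open>Sobolev functions and their Borel representatives\<close>

lemma powr_of_nat_eq_power: "x \<ge> 0 \<Longrightarrow> p \<ge> 1 \<Longrightarrow> x powr real p = x ^ p"
  by (cases "x = 0") (auto simp: powr_realpow power_0_left)

lemma Lp_borel:
  fixes f :: "'a::euclidean_space \<Rightarrow> 'b::euclidean_space"
  assumes "f \<in> borel_measurable lebesgue" "f' \<in> borel_measurable borel" "AE x in lborel. f x = f' x" "p \<ge> 1"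
  shows "f \<in> Lp (real p) \<longleftrightarrow> integrable lborel (\<lambda>x. norm (f' x) ^ p)"
proof -
  note [measurable] = assms(1,2)
  have "integrable lebesgue (\<lambda>x. norm (f x) ^ p) \<longleftrightarrow> integrable lborel (\<lambda>x. norm (f' x) ^ p)"
    using assms(3) by (intro lebesgue_integral_AE_borel) auto
  then show ?thesis
    using assms(1,4) by (simp add: Lp_def powr_of_nat_eq_power)
qed

lemma W1_sobolev_pair:
  fixes u :: "'a::euclidean_space \<Rightarrow> real"
  assumes "u \<in> W1 (real p)" "p \<ge> 1"
  obtains u' g' where "sobolev_pair p u' g'" "AE x in lborel. u x = u' x" "AE x in lborel. weak_gradient u x = g' x"
proof -
  have wg: "has_weak_gradient u (weak_gradient u)"
  proof -
    have "\<exists>g. has_weak_gradient u g"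
      using assms unfolding W1_def by blast
    then show ?thesis
      unfolding weak_gradient_def by (rule someI_ex)
  qed
  have m: "u \<in> borel_measurable lebesgue" "weak_gradient u \<in> borel_measurable lebesgue"
    using assms unfolding W1_def Lp_def by auto
  obtain u' where u': "u' \<in> borel_measurable borel" "AE x in lborel. u x = u' x"
    using borel_representative[OF m(1)] by metis
  obtain g' where g': "g' \<in> borel_measurable borel" "AE x in lborel. weak_gradient u x = g' x"
    using borel_representative[OF m(2)] by metis
  have "sobolev_pair p u' g'"
    unfolding sobolev_pair_def
    using has_weak_gradient_borel[OF wg u' g'] Lp_borel[OF m(1) u' assms(2)] Lp_borel[OF m(2) g' assms(2)] assms(1)
    by (auto simp: W1_def)
  then show ?thesis using that u' g' by blast
qed

text \<open>Serves the trial functions: membership in \<open>W1\<close> and the value of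
  \<open>Q\<close> are defined through the chosen \<open>weak_gradient\<close>, which uniqueness
  replaces by the explicit \<open>g\<close>.\<close>

lemma has_weak_gradient_W1:
  fixes u :: "'a::euclidean_space \<Rightarrow> real"
  assumes wg: "has_weak_gradient u g" and [measurable]: "u \<in> borel_measurable borel" "g \<in> borel_measurable borel"
    and i: "integrable lborel (\<lambda>x. \<bar>u x\<bar> ^ p)" "integrable lborel (\<lambda>x. norm (g x) ^ p)" and p: "p \<ge> 1"
  shows "u \<in> W1 (real p)" "AE x in lborel. weak_gradient u x = g x"
proof -
  have wg': "has_weak_gradient u (weak_gradient u)"
    unfolding weak_gradient_def using wg by (metis someI)
  then have m: "weak_gradient u \<in> borel_measurable lebesgue"
    by (auto intro: locally_integrable_measurable simp: has_weak_gradient_def)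
  obtain g' where g': "g' \<in> borel_measurable borel" "AE x in lborel. weak_gradient u x = g' x"
    using borel_representative[OF m] by metis
  have "AE x in lborel. g' x = g x"
    by (rule borel_weak_gradient_unique[OF has_weak_gradient_borel[OF wg' _ _ g'] has_weak_gradient_borel[OF wg]]) auto
  with g'(2) show ae: "AE x in lborel. weak_gradient u x = g x" by auto
  have mu: "u \<in> borel_measurable lebesgue" by (auto intro: measurable_completion)
  show "u \<in> W1 (real p)"
    using Lp_borel[OF m _ ae p] Lp_borel[OF mu _ _ p, of u] i wg by (auto simp: W1_def)
qed

section \<open>Mollification\<close>

text \<open>The kernel is only Lipschitz. Differentiability of \<open>mollify u\<close> comes from
  the weak gradient, through the continuity of \<open>mollify g\<close>, and not from
  differentiating the kernel.\<close>

locale mollifier =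
  fixes \<rho> :: "'a::euclidean_space \<Rightarrow> real" and \<epsilon> K B :: real
  assumes \<rho>_measurable [measurable]: "\<rho> \<in> borel_measurable borel"
    and \<rho>_nonneg: "0 \<le> \<rho> x" and \<rho>_le: "\<rho> x \<le> B"
    and \<rho>_support: "norm x > \<epsilon> \<Longrightarrow> \<rho> x = 0"
    and \<rho>_Lipschitz: "\<bar>\<rho> x - \<rho> y\<bar> \<le> K * norm (x - y)"
    and \<rho>_integrable: "integrable lborel \<rho>" and \<rho>_integral: "(LINT x|lborel. \<rho> x) = 1"
    and \<epsilon>_pos: "\<epsilon> > 0" and K_nonneg: "K \<ge> 0"
begin

definition mollify :: "('a \<Rightarrow> 'b::euclidean_space) \<Rightarrow> 'a \<Rightarrow> 'b" where
  "mollify v x = (LINT z|lborel. \<rho> z *\<^sub>R v (x + z))"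

lemma mollify_measurable [measurable]:
  assumes [measurable]: "v \<in> borel_measurable borel"
  shows "mollify v \<in> borel_measurable borel"
  unfolding mollify_def by measurable

lemma integrable_mollify:
  fixes v :: "'a \<Rightarrow> 'b::euclidean_space"
  assumes [measurable]: "v \<in> borel_measurable borel" and vi: "\<And>r. set_integrable lborel (cball 0 r) v"
  shows "integrable lborel (\<lambda>y. \<rho> (y - x) *\<^sub>R v y)" and "integrable lborel (\<lambda>z. \<rho> z *\<^sub>R v (x + z))"
proof -
  show 1: "integrable lborel (\<lambda>y. \<rho> (y - x) *\<^sub>R v y)"
  proof (rule Bochner_Integration.integrable_bound)
    show "integrable lborel (\<lambda>y. B * norm (indicator (cball 0 (norm x + \<epsilon>)) y *\<^sub>R v y))"
      using vi[of "norm x + \<epsilon>"] unfolding set_integrable_def by (intro integrable_mult_right integrable_norm)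
    show "AE y in lborel. norm (\<rho> (y - x) *\<^sub>R v y) \<le> norm (B * norm (indicator (cball 0 (norm x + \<epsilon>)) y *\<^sub>R v y))"
    proof (rule AE_I2)
      fix y
      have B: "B \<ge> 0" using \<rho>_nonneg[of 0] \<rho>_le[of 0] by linarith
      show "norm (\<rho> (y - x) *\<^sub>R v y) \<le> norm (B * norm (indicator (cball 0 (norm x + \<epsilon>)) y *\<^sub>R v y))"
      proof (cases "norm y \<le> norm x + \<epsilon>")
        case True
        then show ?thesis using \<rho>_nonneg \<rho>_le B by (auto simp: abs_mult intro!: mult_right_mono)
      next
        case False
        then have "norm (y - x) > \<epsilon>" using norm_triangle_ineq2[of y x] by linarith
        then show ?thesis by (simp add: \<rho>_support)
      qed
    qed
  qed measurable
  show "integrable lborel (\<lambda>z. \<rho> z *\<^sub>R v (x + z))"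
    using integrable_lborel_shift[OF 1, of x] by (simp add: add.commute)
qed

lemma mollify_eq:
  assumes [measurable]: "v \<in> borel_measurable borel"
  shows "mollify v x = (LINT y|lborel. \<rho> (y - x) *\<^sub>R v y)"
  unfolding mollify_def
  using integral_lborel_shift[of "\<lambda>y. \<rho> (y - x) *\<^sub>R v y" x] by (simp add: add.commute)

text \<open>On a ball of radius \<open>R\<close> the Lipschitz bound of \<open>\<rho>\<close> makes
  \<open>mollify v\<close> Lipschitz, with constant \<open>K\<close> times the mass of
  \<open>v\<close> in the ball of radius \<open>R + \<epsilon>\<close>.\<close>

lemma mollify_continuous:
  fixes v :: "'a \<Rightarrow> 'b::euclidean_space"
  assumes [measurable]: "v \<in> borel_measurable borel" and vi: "\<And>r. set_integrable lborel (cball 0 r) v"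
  shows "continuous_on UNIV (mollify v)"
proof -
  have "continuous_on (ball 0 R) (mollify v)" for R
  proof -
    define C where "C = (LINT y|lborel. norm (indicator (cball 0 (R + \<epsilon>)) y *\<^sub>R v y))"
    have i: "integrable lborel (\<lambda>y. norm (indicator (cball 0 (R + \<epsilon>)) y *\<^sub>R v y))"
      using vi[of "R + \<epsilon>"] unfolding set_integrable_def by (intro integrable_norm)
    have "(K * C)-lipschitz_on (ball 0 R) (mollify v)"
    proof (rule lipschitz_onI)
      fix x x' :: 'a assume x: "x \<in> ball 0 R" "x' \<in> ball 0 R"
      have "mollify v x - mollify v x' = (LINT y|lborel. \<rho> (y - x) *\<^sub>R v y - \<rho> (y - x') *\<^sub>R v y)"
        using integrable_mollify(1)[OF assms] by (simp add: mollify_eq)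
      also have "norm \<dots> \<le> (LINT y|lborel. norm (\<rho> (y - x) *\<^sub>R v y - \<rho> (y - x') *\<^sub>R v y))"
        by (rule integral_norm_bound)
      also have "\<dots> \<le> (LINT y|lborel. K * norm (x - x') * norm (indicator (cball 0 (R + \<epsilon>)) y *\<^sub>R v y))"
      proof (rule integral_mono)
        show "integrable lborel (\<lambda>y. norm (\<rho> (y - x) *\<^sub>R v y - \<rho> (y - x') *\<^sub>R v y))"
          by (intro integrable_norm Bochner_Integration.integrable_diff integrable_mollify(1) assms)
        show "integrable lborel (\<lambda>y. K * norm (x - x') * norm (indicator (cball 0 (R + \<epsilon>)) y *\<^sub>R v y))"
          by (intro integrable_mult_right i)
        fix y
        show "norm (\<rho> (y - x) *\<^sub>R v y - \<rho> (y - x') *\<^sub>R v y) \<le> K * norm (x - x') * norm (indicator (cball 0 (R + \<epsilon>)) y *\<^sub>R v y)"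
        proof (cases "norm y \<le> R + \<epsilon>")
          case True
          have "norm (\<rho> (y - x) *\<^sub>R v y - \<rho> (y - x') *\<^sub>R v y) = \<bar>\<rho> (y - x) - \<rho> (y - x')\<bar> * norm (v y)"
            by (simp add: scaleR_left_diff_distrib[symmetric])
          also have "\<dots> \<le> (K * norm (x' - x)) * norm (v y)"
            using \<rho>_Lipschitz[of "y - x" "y - x'"] by (intro mult_right_mono) auto
          finally show ?thesis using True by (simp add: norm_minus_commute)
        next
          case False
          have "norm (y - x) > \<epsilon>" "norm (y - x') > \<epsilon>"
            using norm_triangle_ineq2[of y x] norm_triangle_ineq2[of y x'] False x by auto
          then show ?thesis by (simp add: \<rho>_support K_nonneg)
        qed
      qed
      also have "\<dots> = K * norm (x - x') * C"
        by (simp add: C_def)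
      finally show "dist (mollify v x) (mollify v x') \<le> K * C * dist x x'"
        by (simp add: dist_norm mult_ac)
    next
      show "0 \<le> K * C"
        unfolding C_def by (intro mult_nonneg_nonneg K_nonneg Bochner_Integration.integral_nonneg) auto
    qed
    then show ?thesis by (rule lipschitz_on_continuous_on)
  qed
  then have "isCont (mollify v) x" for x
    by (rule continuous_on_interior[of "ball 0 (norm x + 1)"]) auto
  then show ?thesis by (simp add: continuous_at_imp_continuous_on)
qed

text \<open>Averaging turns the difference formula, valid for \<open>u\<close> almost everywhere,
  into one valid at every point.\<close>

lemma mollify_difference:
  assumes wg: "borel_weak_gradient u g"
  shows "mollify u (x + h) - mollify u x = (LINT t|lborel. indicator {0..1} t * (mollify g (x + t *\<^sub>R h) \<bullet> h))"
proof -
  have [measurable]: "u \<in> borel_measurable borel" "g \<in> borel_measurable borel"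
    and ui: "\<And>r. set_integrable lborel (cball 0 r) u" and gi: "\<And>r. set_integrable lborel (cball 0 r) g"
    using wg by (auto simp: borel_weak_gradient_def)
  have b: "\<bar>\<rho> (y - x)\<bar> \<le> B" for y
    using \<rho>_nonneg[of "y - x"] \<rho>_le[of "y - x"] by simp
  have s: "\<rho> (y - x) = 0" if "norm y > norm x + \<epsilon>" for y
    using that norm_triangle_ineq2[of y x] by (intro \<rho>_support) linarith
  have u1: "mollify u (x + h) = (LINT y|lborel. \<rho> (y - x) * u (y + h))"
    using integral_lborel_shift[of "\<lambda>y. \<rho> (y - (x + h)) * u y" h] by (simp add: mollify_eq)
  have i1: "integrable lborel (\<lambda>y. \<rho> (y - x) * u (y + h))"
    using integrable_lborel_shift[OF integrable_mollify(1)[OF _ ui, of "x + h"], of h] by simp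
  have i2: "integrable lborel (\<lambda>y. \<rho> (y - x) * u y)"
    using integrable_mollify(1)[OF _ ui, of x] by simp
  have "mollify u (x + h) - mollify u x = (LINT y|lborel. \<rho> (y - x) * (u (y + h) - u y))"
    unfolding u1 using i1 i2 by (simp add: mollify_eq right_diff_distrib)
  also have "\<dots> = (LINT y|lborel. \<rho> (y - x) * (LINT t|lborel. indicator {0..1} t * (g (y + t *\<^sub>R h) \<bullet> h)))"
    by (rule integral_cong_AE) (use weak_gradient_difference[OF wg, of h] in \<open>auto\<close>)
  also have "\<dots> = (LINT y|lborel. LINT t|lborel. indicator {0..1} t * ((g (y + t *\<^sub>R h) \<bullet> h) * \<rho> (y - x)))"
    by (subst integral_mult_right_zero[symmetric]) (simp add: mult_ac)
  also have "\<dots> = (LINT t|lborel. indicator {0..1} t * (LINT y|lborel. (g (y + t *\<^sub>R h) \<bullet> h) * \<rho> (y - x)))"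
    by (rule Fubini_shift(2)[OF _ _ set_integrable_cball_inner[OF gi] b s]) auto
  also have "\<dots> = (LINT t|lborel. indicator {0..1} t * (mollify g (x + t *\<^sub>R h) \<bullet> h))"
  proof -
    have "(LINT y|lborel. (g (y + t *\<^sub>R h) \<bullet> h) * \<rho> (y - x)) = mollify g (x + t *\<^sub>R h) \<bullet> h" for t
    proof -
      have "(LINT y|lborel. (g (y + t *\<^sub>R h) \<bullet> h) * \<rho> (y - x)) = (LINT y|lborel. (\<rho> (y - (x + t *\<^sub>R h)) *\<^sub>R g y) \<bullet> h)"
        using integral_lborel_shift[of "\<lambda>y. (\<rho> (y - (x + t *\<^sub>R h)) *\<^sub>R g y) \<bullet> h" "t *\<^sub>R h"]
        by (simp add: mult.commute)
      also have "\<dots> = mollify g (x + t *\<^sub>R h) \<bullet> h"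
        using integral_inner_left[OF integrable_mollify(1)[OF _ gi, of "x + t *\<^sub>R h"]] by (simp add: mollify_eq)
      finally show ?thesis .
    qed
    then show ?thesis by simp
  qed
  finally show ?thesis .
qed

lemma mollify_has_derivative:
  assumes wg: "borel_weak_gradient u g"
  shows "(mollify u has_derivative (\<lambda>h. mollify g x \<bullet> h)) (at x)"
proof -
  have [measurable]: "g \<in> borel_measurable borel" and gi: "\<And>r. set_integrable lborel (cball 0 r) g"
    using wg by (auto simp: borel_weak_gradient_def)
  have "isCont (mollify g) x"
    using mollify_continuous[OF _ gi] by (simp add: continuous_on_eq_continuous_at)
  then have cont: "\<exists>d>0. \<forall>y. norm (y - x) < d \<longrightarrow> norm (mollify g y - mollify g x) < e" if "e > 0" for e
    using that unfolding continuous_at_eps_delta dist_norm by blast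
  have mg: "continuous_on UNIV (mollify g)"
    by (rule mollify_continuous[OF _ gi]) simp
  have "\<exists>d>0. \<forall>y. norm (y - x) < d \<longrightarrow>
      norm (mollify u y - mollify u x - mollify g x \<bullet> (y - x)) \<le> e * norm (y - x)" if e: "e > 0" for e
  proof -
    obtain d where d: "d > 0" "\<And>y. norm (y - x) < d \<Longrightarrow> norm (mollify g y - mollify g x) < e"
      using cont[OF e] by blast
    have "norm (mollify u y - mollify u x - mollify g x \<bullet> (y - x)) \<le> e * norm (y - x)" if y: "norm (y - x) < d" for y
    proof -
      define h where "h = y - x"
      have c: "continuous_on {0..1} (\<lambda>t. mollify g (x + t *\<^sub>R h) \<bullet> h)"
        by (intro continuous_intros continuous_on_compose2[OF mg]) auto
      then have i: "integrable lborel (\<lambda>t. indicator {0..1} t * (mollify g (x + t *\<^sub>R h) \<bullet> h))"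
        using borel_integrable_compact[OF compact_Icc c] by simp
      have i2: "integrable lborel (\<lambda>t::real. indicator {0..1} t * (mollify g x \<bullet> h))"
        by (intro integrable_mult_left integrable_real_indicator) auto
      have "mollify u y - mollify u x - mollify g x \<bullet> h =
         (LINT t|lborel. indicator {0..1} t * (mollify g (x + t *\<^sub>R h) \<bullet> h)) - (LINT t|lborel. indicator {0..1::real} t * (mollify g x \<bullet> h))"
        using mollify_difference[OF wg, of x h] by (simp add: h_def content_real)
      also have "\<dots> = (LINT t|lborel. indicator {0..1} t * (mollify g (x + t *\<^sub>R h) \<bullet> h) - indicator {0..1} t * (mollify g x \<bullet> h))"
        by (rule Bochner_Integration.integral_diff[OF i i2, symmetric])
      finally have "norm (mollify u y - mollify u x - mollify g x \<bullet> h) \<le>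
         (LINT t|lborel. norm (indicator {0..1} t * (mollify g (x + t *\<^sub>R h) \<bullet> h) - indicator {0..1} t * (mollify g x \<bullet> h)))"
        by (simp only: integral_norm_bound)
      also have "\<dots> \<le> (LINT t|lborel. indicator {0..1::real} t * (e * norm h))"
      proof (rule integral_mono)
        show "integrable lborel (\<lambda>t::real. indicator {0..1} t * (e * norm h))"
          by (intro integrable_mult_left integrable_real_indicator) auto
        show "integrable lborel (\<lambda>t. norm (indicator {0..1} t * (mollify g (x + t *\<^sub>R h) \<bullet> h) - indicator {0..1} t * (mollify g x \<bullet> h)))"
          by (intro integrable_norm Bochner_Integration.integrable_diff i i2)
        fix t :: real
        show "norm (indicator {0..1} t * (mollify g (x + t *\<^sub>R h) \<bullet> h) - indicator {0..1} t * (mollify g x \<bullet> h)) \<le> indicator {0..1} t * (e * norm h)"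
        proof (cases "t \<in> {0..1}")
          case True
          have "norm (t *\<^sub>R h) \<le> norm h" using True by (simp add: mult_left_le_one_le)
          then have "norm (mollify g (x + t *\<^sub>R h) - mollify g x) < e"
            using y unfolding h_def by (intro d(2)) auto
          then have "norm (mollify g (x + t *\<^sub>R h) - mollify g x) * norm h \<le> e * norm h"
            by (intro mult_right_mono) auto
          moreover have "\<bar>(mollify g (x + t *\<^sub>R h) - mollify g x) \<bullet> h\<bar> \<le> norm (mollify g (x + t *\<^sub>R h) - mollify g x) * norm h"
            by (rule Cauchy_Schwarz_ineq2)
          ultimately show ?thesis using True by (simp add: inner_diff_left)
        qed simp
      qed
      finally show ?thesis by (simp add: h_def content_real)
    qed
    with d(1) show ?thesis by blast
  qed
  then show ?thesis
    unfolding has_derivative_at_alt by (auto intro: bounded_linear_inner_right)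
qed

lemma mollify_norm_le:
  fixes v :: "'a \<Rightarrow> 'b::euclidean_space"
  assumes [measurable]: "v \<in> borel_measurable borel" and p: "p \<ge> 1"
  shows "(\<integral>\<^sup>+x. ennreal (norm (mollify v x) ^ p) \<partial>lborel) \<le> (\<integral>\<^sup>+x. ennreal (norm (v x) ^ p) \<partial>lborel)"
proof -
  have "(\<integral>\<^sup>+x. ennreal (norm (mollify v x) ^ p) \<partial>lborel) \<le> (\<integral>\<^sup>+x. (\<integral>\<^sup>+z. ennreal (\<rho> z * norm (v (x + z)) ^ p) \<partial>lborel) \<partial>lborel)"
    unfolding mollify_def
    by (intro nn_integral_mono jensen_power \<rho>_nonneg \<rho>_integrable \<rho>_integral p) auto
  also have "\<dots> = (\<integral>\<^sup>+z. (\<integral>\<^sup>+x. ennreal (\<rho> z * norm (v (x + z)) ^ p) \<partial>lborel) \<partial>lborel)"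
    by (rule lborel_pair.Fubini') measurable
  also have "\<dots> = (\<integral>\<^sup>+z. ennreal (\<rho> z) * (\<integral>\<^sup>+x. ennreal (norm (v x) ^ p) \<partial>lborel) \<partial>lborel)"
  proof (rule nn_integral_cong)
    fix z
    show "(\<integral>\<^sup>+x. ennreal (\<rho> z * norm (v (x + z)) ^ p) \<partial>lborel) = ennreal (\<rho> z) * (\<integral>\<^sup>+x. ennreal (norm (v x) ^ p) \<partial>lborel)"
      using nn_integral_lborel_shift[of "\<lambda>x. ennreal (norm (v x) ^ p)" z]
      by (simp add: ennreal_mult \<rho>_nonneg nn_integral_cmult)
  qed
  also have "\<dots> = (\<integral>\<^sup>+z. ennreal (\<rho> z) \<partial>lborel) * (\<integral>\<^sup>+x. ennreal (norm (v x) ^ p) \<partial>lborel)"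
    by (rule nn_integral_multc) simp
  also have "(\<integral>\<^sup>+z. ennreal (\<rho> z) \<partial>lborel) = 1"
    using nn_integral_eq_integral[OF \<rho>_integrable] \<rho>_nonneg \<rho>_integral by simp
  finally show ?thesis by simp
qed

text \<open>As \<open>\<rho>\<close> has mass one, \<open>mollify u - u\<close> is an average of the
  differences \<open>u (x + z) - u x\<close> with \<open>norm z \<le> \<epsilon>\<close>. The
  translation estimate then gives a rate in \<open>\<epsilon>\<close>, not merely
  convergence.\<close>

lemma mollify_distance:
  assumes wg: "borel_weak_gradient u g" and p: "p \<ge> 1"
  shows "(\<integral>\<^sup>+x. ennreal (\<bar>mollify u x - u x\<bar> ^ p) \<partial>lborel) \<le> ennreal (\<epsilon> ^ p) * (\<integral>\<^sup>+x. ennreal (norm (g x) ^ p) \<partial>lborel)"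
proof -
  have [measurable]: "u \<in> borel_measurable borel" and ui: "\<And>r. set_integrable lborel (cball 0 r) u"
    using wg by (auto simp: borel_weak_gradient_def)
  have eq: "mollify u x - u x = (LINT z|lborel. \<rho> z *\<^sub>R (u (x + z) - u x))" for x
  proof -
    have "(LINT z|lborel. \<rho> z *\<^sub>R (u (x + z) - u x)) = (LINT z|lborel. \<rho> z * u (x + z) - \<rho> z * u x)"
      by (simp add: right_diff_distrib)
    also have "\<dots> = (LINT z|lborel. \<rho> z * u (x + z)) - (LINT z|lborel. \<rho> z * u x)"
      using integrable_mollify(2)[OF _ ui, of x] \<rho>_integrable by (intro Bochner_Integration.integral_diff) auto
    finally show ?thesis by (simp add: mollify_def \<rho>_integral)
  qed
  have "(\<integral>\<^sup>+x. ennreal (\<bar>mollify u x - u x\<bar> ^ p) \<partial>lborel) \<le> (\<integral>\<^sup>+x. (\<integral>\<^sup>+z. ennreal (\<rho> z * \<bar>u (x + z) - u x\<bar> ^ p) \<partial>lborel) \<partial>lborel)"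
  proof (rule nn_integral_mono)
    fix x
    show "ennreal (\<bar>mollify u x - u x\<bar> ^ p) \<le> (\<integral>\<^sup>+z. ennreal (\<rho> z * \<bar>u (x + z) - u x\<bar> ^ p) \<partial>lborel)"
      using jensen_power[of \<rho> "\<lambda>z. u (x + z) - u x" p] \<rho>_nonneg \<rho>_integrable \<rho>_integral p
      unfolding eq by simp
  qed
  also have "\<dots> = (\<integral>\<^sup>+z. (\<integral>\<^sup>+x. ennreal (\<rho> z * \<bar>u (x + z) - u x\<bar> ^ p) \<partial>lborel) \<partial>lborel)"
    by (rule lborel_pair.Fubini') measurable
  also have "\<dots> \<le> (\<integral>\<^sup>+z. ennreal (\<rho> z) * (ennreal (\<epsilon> ^ p) * (\<integral>\<^sup>+x. ennreal (norm (g x) ^ p) \<partial>lborel)) \<partial>lborel)"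
  proof (rule nn_integral_mono)
    fix z
    have "(\<integral>\<^sup>+x. ennreal (\<rho> z * \<bar>u (x + z) - u x\<bar> ^ p) \<partial>lborel) = ennreal (\<rho> z) * (\<integral>\<^sup>+x. ennreal (\<bar>u (x + z) - u x\<bar> ^ p) \<partial>lborel)"
      by (simp add: ennreal_mult \<rho>_nonneg nn_integral_cmult)
    also have "\<dots> \<le> ennreal (\<rho> z) * (ennreal (\<epsilon> ^ p) * (\<integral>\<^sup>+x. ennreal (norm (g x) ^ p) \<partial>lborel))"
    proof (cases "norm z \<le> \<epsilon>")
      case True
      have "(\<integral>\<^sup>+x. ennreal (\<bar>u (x + z) - u x\<bar> ^ p) \<partial>lborel) \<le> ennreal (norm z ^ p) * (\<integral>\<^sup>+x. ennreal (norm (g x) ^ p) \<partial>lborel)"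
        by (rule translation_estimate[OF wg p])
      also have "\<dots> \<le> ennreal (\<epsilon> ^ p) * (\<integral>\<^sup>+x. ennreal (norm (g x) ^ p) \<partial>lborel)"
        using True by (intro mult_right_mono ennreal_leI power_mono) auto
      finally show ?thesis by (intro mult_left_mono) auto
    qed (simp add: \<rho>_support)
    finally show "(\<integral>\<^sup>+x. ennreal (\<rho> z * \<bar>u (x + z) - u x\<bar> ^ p) \<partial>lborel) \<le>
        ennreal (\<rho> z) * (ennreal (\<epsilon> ^ p) * (\<integral>\<^sup>+x. ennreal (norm (g x) ^ p) \<partial>lborel))" .
  qed
  also have "\<dots> = (\<integral>\<^sup>+z. ennreal (\<rho> z) \<partial>lborel) * (ennreal (\<epsilon> ^ p) * (\<integral>\<^sup>+x. ennreal (norm (g x) ^ p) \<partial>lborel))"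
    by (rule nn_integral_multc) simp
  also have "(\<integral>\<^sup>+z. ennreal (\<rho> z) \<partial>lborel) = 1"
    using nn_integral_eq_integral[OF \<rho>_integrable] \<rho>_nonneg \<rho>_integral by simp
  finally show ?thesis by simp
qed

end

lemma mollifier_exists:
  assumes "\<epsilon> > 0"
  obtains \<rho> :: "'a::euclidean_space \<Rightarrow> real" and K B where "mollifier \<rho> \<epsilon> K B"
proof -
  define f :: "'a \<Rightarrow> real" where "f x = max 0 (\<epsilon> - norm x)" for x
  have [measurable]: "f \<in> borel_measurable borel" unfolding f_def by measurable
  have i: "integrable lborel f"
  proof (rule Bochner_Integration.integrable_bound)
    show "integrable lborel (\<lambda>x::'a. indicator (cball 0 \<epsilon>) x * \<epsilon>)"
      by (intro integrable_mult_left integrable_real_indicator) (use assms in \<open>auto simp: emeasure_cball\<close>)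
    show "AE x in lborel. norm (f x) \<le> norm (indicator (cball 0 \<epsilon>) x * \<epsilon>)"
      using assms by (intro AE_I2) (auto simp: f_def indicator_def)
  qed simp
  define c where "c = (LINT x|lborel. f x)"
  \<comment> \<open>The cone has at least half its height on the ball of half the radius, so its
    mass is positive and it can be normalised.\<close>
  have "c \<ge> (LINT x|lborel. indicator (cball (0::'a) (\<epsilon> / 2)) x * (\<epsilon> / 2))"
    unfolding c_def
    by (intro integral_mono i integrable_mult_left integrable_real_indicator)
      (use assms in \<open>auto simp: f_def indicator_def emeasure_cball\<close>)
  moreover have "(LINT x|lborel. indicator (cball (0::'a) (\<epsilon> / 2)) x * (\<epsilon> / 2)) > 0"
    using assms by (simp add: content_cball)
  ultimately have c: "c > 0" by linarith
  have "mollifier (\<lambda>x. f x / c) \<epsilon> (1 / c) (\<epsilon> / c)"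
  proof
    fix x y :: 'a
    show "0 \<le> f x / c" "f x / c \<le> \<epsilon> / c" "\<epsilon> < norm x \<Longrightarrow> f x / c = 0"
      using c assms by (auto simp: f_def divide_right_mono)
    have "\<bar>f x - f y\<bar> \<le> norm (x - y)"
      using norm_triangle_ineq3[of x y] unfolding f_def by linarith
    then show "\<bar>f x / c - f y / c\<bar> \<le> 1 / c * norm (x - y)"
      using c by (simp add: diff_divide_distrib[symmetric] divide_right_mono)
    show "(LINT x|lborel. f x / c) = 1" using c by (simp add: c_def)
  qed (use c assms i in auto)
  then show ?thesis by (rule that)
qed

section \<open>The divergence theorem for radial Lipschitz fields\<close>

text \<open>Each difference quotient of \<open>h\<close> has integral 0 by translation invariance.
  The Lipschitz constant and the bounded support dominate the quotients, so the value 0 survives in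
  the limit \<open>D\<close>.\<close>

lemma integral_derivative_eq_0:
  fixes h :: "'a::euclidean_space \<Rightarrow> real"
  assumes lip: "K-lipschitz_on UNIV h" and supp: "\<And>x. norm x > R \<Longrightarrow> h x = 0"
    and [measurable]: "D \<in> borel_measurable borel"
    and D: "AE x in lborel. ((\<lambda>t. h (x + t *\<^sub>R e)) has_real_derivative D x) (at 0)"
  shows "integrable lborel D" and "(LINT x|lborel. D x) = 0"
proof -
  have ch: "continuous_on UNIV h" by (rule lipschitz_on_continuous_on[OF lip])
  then have [measurable]: "h \<in> borel_measurable borel"
    by (rule borel_measurable_continuous_onI)
  have "bounded (h ` cball 0 R)"
    using ch by (intro compact_imp_bounded compact_continuous_image) (auto intro: continuous_on_subset)
  then obtain M where M: "\<And>x. norm x \<le> R \<Longrightarrow> \<bar>h x\<bar> \<le> M"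
    unfolding bounded_iff by (auto simp del: mem_cball) (meson mem_cball_0)
  have hi: "integrable lborel h"
  proof (rule Bochner_Integration.integrable_bound)
    show "integrable lborel (\<lambda>x::'a. indicator (cball 0 R) x * M)"
      by (intro integrable_mult_left integrable_real_indicator) (use emeasure_bounded_finite[OF bounded_cball[of "0::'a"]] in auto)
    show "AE x in lborel. norm (h x) \<le> norm (indicator (cball 0 R) x * M)"
      using M supp by (intro AE_I2) (auto simp: indicator_def intro!: order_trans[OF M abs_ge_self])
  qed simp
  define s where "s n x = real (Suc n) * (h (x + (1 / real (Suc n)) *\<^sub>R e) - h x)" for n x
  have [measurable]: "s n \<in> borel_measurable borel" for n
    unfolding s_def by measurable
  have conv: "AE x in lborel. (\<lambda>n. s n x) \<longlonglongrightarrow> D x"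
    using D
  proof eventually_elim
    case (elim x)
    have "((\<lambda>t. (h (x + t *\<^sub>R e) - h x) / t) \<longlongrightarrow> D x) (at 0)"
      using elim unfolding has_field_derivative_iff by simp
    moreover have "filterlim (\<lambda>n. 1 / real (Suc n)) (at 0) sequentially"
      unfolding filterlim_at using lim_1_over_real_power[of 1] LIMSEQ_inverse_real_of_nat
      by (auto simp: inverse_eq_divide)
    ultimately have "(\<lambda>n. (h (x + (1 / real (Suc n)) *\<^sub>R e) - h x) / (1 / real (Suc n))) \<longlonglongrightarrow> D x"
      by (rule filterlim_compose)
    then show ?case by (simp add: s_def mult.commute)
  qed
  have bd: "\<bar>s n x\<bar> \<le> indicator (cball 0 (R + norm e)) x * (K * norm e)" for n x
  proof (cases "norm x \<le> R + norm e")
    case True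
    have "\<bar>h (x + (1 / real (Suc n)) *\<^sub>R e) - h x\<bar> \<le> K * norm ((1 / real (Suc n)) *\<^sub>R e)"
      using lipschitz_onD[OF lip, of "x + (1 / real (Suc n)) *\<^sub>R e" x] by (simp add: dist_norm)
    then have "real (Suc n) * \<bar>h (x + (1 / real (Suc n)) *\<^sub>R e) - h x\<bar> \<le> real (Suc n) * (K * norm ((1 / real (Suc n)) *\<^sub>R e))"
      by (intro mult_left_mono) auto
    also have "\<dots> = K * norm e" by simp
    finally show ?thesis using True unfolding s_def by (simp add: abs_mult)
  next
    case False
    have "norm ((1 / real (Suc n)) *\<^sub>R e) \<le> norm e"
      by (simp add: divide_le_eq mult_le_cancel_left1)
    then have "norm (x + (1 / real (Suc n)) *\<^sub>R e) > R"
      using False norm_diff_ineq[of x "(1 / real (Suc n)) *\<^sub>R e"] by linarith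
    moreover have "norm x > R" using False norm_ge_zero[of e] by linarith
    ultimately show ?thesis using False by (simp add: s_def supp)
  qed
  have bi: "integrable lborel (\<lambda>x::'a. indicator (cball 0 (R + norm e)) x * (K * norm e))"
    by (intro integrable_mult_left integrable_real_indicator) (use emeasure_bounded_finite[OF bounded_cball[of "0::'a"]] in auto)
  have dom: "AE x in lborel. norm (s n x) \<le> indicator (cball 0 (R + norm e)) x * (K * norm e)" for n
    using bd by simp
  show "integrable lborel D"
    by (rule integrable_dominated_convergence[OF _ _ bi conv dom]) auto
  have "(\<lambda>n. LINT x|lborel. s n x) \<longlonglongrightarrow> (LINT x|lborel. D x)"
    by (rule integral_dominated_convergence[OF _ _ bi conv dom]) auto
  moreover have "(LINT x|lborel. s n x) = 0" for n
    unfolding s_def using hi integrable_lborel_shift[OF hi, of "(1 / real (Suc n)) *\<^sub>R e"]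
    by (simp add: integral_lborel_shift)
  ultimately show "(LINT x|lborel. D x) = 0"
    by (simp add: LIMSEQ_const_iff)
qed

text \<open>A Lipschitz bound for \<open>w\<close> is available only on the ball of radius
  \<open>R\<close>. When one of two points lies outside, \<open>a\<close> vanishes there, and the
  Lipschitz bound on \<open>a\<close> already controls the remaining term.\<close>

lemma lipschitz_on_mult_C1:
  fixes a w :: "'a::euclidean_space \<Rightarrow> real"
  assumes a: "K-lipschitz_on UNIV a" "\<And>x. norm x > R \<Longrightarrow> a x = 0"
    and w: "\<And>x. (w has_derivative (\<lambda>h. G x \<bullet> h)) (at x)" "continuous_on UNIV G"
  obtains K' where "K'-lipschitz_on UNIV (\<lambda>x. a x * w x)"
proof -
  have bdd: "\<exists>M\<ge>0. \<forall>x\<in>cball 0 R. norm (v x) \<le> M" if "continuous_on UNIV v" for v :: "'a \<Rightarrow> 'b::euclidean_space"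
  proof -
    have "bounded (v ` cball 0 R)"
      using that by (intro compact_imp_bounded compact_continuous_image) (auto intro: continuous_on_subset)
    then obtain b where "b > 0" "\<forall>y\<in>v ` cball 0 R. norm y \<le> b"
      unfolding bounded_pos by blast
    then show ?thesis by (intro exI[of _ b]) auto
  qed
  obtain A where A: "A \<ge> 0" "\<And>x. norm x \<le> R \<Longrightarrow> \<bar>a x\<bar> \<le> A"
    using bdd[OF lipschitz_on_continuous_on[OF a(1)]] by auto
  have cw: "continuous_on UNIV w"
    using w(1) by (intro has_derivative_continuous_on) (auto intro: has_derivative_at_withinI)
  obtain M where M: "M \<ge> 0" "\<And>x. norm x \<le> R \<Longrightarrow> \<bar>w x\<bar> \<le> M"
    using bdd[OF cw] by auto
  obtain N where N: "N \<ge> 0" "\<And>x. norm x \<le> R \<Longrightarrow> norm (G x) \<le> N"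
    using bdd[OF w(2)] by auto
  have wl: "\<bar>w x - w y\<bar> \<le> N * norm (x - y)" if "norm x \<le> R" "norm y \<le> R" for x y
  proof -
    have "norm (w x - w y) \<le> N * norm (x - y)"
    proof (rule differentiable_bound[of "cball 0 R" w "\<lambda>x h. G x \<bullet> h"])
      show "\<And>x. x \<in> cball 0 R \<Longrightarrow> (w has_derivative (\<lambda>h. G x \<bullet> h)) (at x within cball 0 R)"
        using w(1) by (auto intro: has_derivative_at_withinI)
      fix x :: 'a assume "x \<in> cball 0 R"
      then have "norm (G x) \<le> N" using N(2) by auto
      show "onorm (\<lambda>h. G x \<bullet> h) \<le> N"
      proof (rule onorm_le)
        fix h
        have "\<bar>G x \<bullet> h\<bar> \<le> norm (G x) * norm h" by (rule Cauchy_Schwarz_ineq2)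
        also have "\<dots> \<le> N * norm h" using \<open>norm (G x) \<le> N\<close> by (intro mult_right_mono) auto
        finally show "norm (G x \<bullet> h) \<le> N * norm h" by simp
      qed
    qed (use that in auto)
    then show ?thesis by simp
  qed
  have K: "K \<ge> 0" using lipschitz_on_nonneg[OF a(1)] .
  have al: "\<bar>a x - a y\<bar> \<le> K * norm (x - y)" for x y
    using lipschitz_onD[OF a(1), of x y] by (simp add: dist_norm)
  have one: "\<bar>a x * w x\<bar> \<le> K * M * norm (x - y)" if "norm x \<le> R" "norm y > R" for x y
  proof -
    have "\<bar>a x\<bar> \<le> K * norm (x - y)" using al[of x y] a(2)[OF that(2)] by simp
    then have "\<bar>a x\<bar> * \<bar>w x\<bar> \<le> (K * norm (x - y)) * M"
      using M(2)[OF that(1)] K by (intro mult_mono) auto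
    then show ?thesis by (simp add: abs_mult mult_ac)
  qed
  have "(A * N + K * M)-lipschitz_on UNIV (\<lambda>x. a x * w x)"
  proof (rule lipschitz_onI)
    show "0 \<le> A * N + K * M" using A N K M by simp
    fix x y :: 'a
    have ANn: "0 \<le> A * N * norm (x - y)" using A N by simp
    have "\<bar>a x * w x - a y * w y\<bar> \<le> (A * N + K * M) * norm (x - y)"
    proof (cases "norm x \<le> R"; cases "norm y \<le> R")
      assume xy: "norm x \<le> R" "norm y \<le> R"
      have "a x * w x - a y * w y = a x * (w x - w y) + (a x - a y) * w y"
        by (simp add: algebra_simps)
      also have "\<bar>\<dots>\<bar> \<le> \<bar>a x\<bar> * \<bar>w x - w y\<bar> + \<bar>a x - a y\<bar> * \<bar>w y\<bar>"
        by (rule order_trans[OF abs_triangle_ineq]) (simp add: abs_mult)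
      also have "\<dots> \<le> A * (N * norm (x - y)) + (K * norm (x - y)) * M"
        using A(2)[OF xy(1)] wl[OF xy] al[of x y] M(2)[OF xy(2)] A N K M
        by (intro add_mono mult_mono) auto
      finally show ?thesis by (simp add: algebra_simps)
    next
      assume xy: "norm x \<le> R" "\<not> norm y \<le> R"
      then show ?thesis using one[of x y] a(2)[of y] ANn by (simp add: distrib_right)
    next
      assume xy: "\<not> norm x \<le> R" "norm y \<le> R"
      then show ?thesis using one[of y x] a(2)[of x] ANn by (simp add: distrib_right norm_minus_commute)
    next
      assume xy: "\<not> norm x \<le> R" "\<not> norm y \<le> R"
      then show ?thesis using a(2)[of x] a(2)[of y] A N K M by simp
    qed
    then show "dist (a x * w x) (a y * w y) \<le> (A * N + K * M) * dist x y"
      by (simp add: dist_norm)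
  qed
  then show ?thesis by (rule that)
qed

text \<open>Lets radial profiles have kinks at finitely many radii, since spheres are null
  sets.\<close>

lemma AE_norm_notin_finite:
  assumes "finite S"
  shows "AE x::'a::euclidean_space in lborel. norm x \<notin> S"
proof -
  have "AE x::'a in lborel. norm x \<noteq> s" for s
  proof -
    have "sphere (0::'a) s \<in> null_sets lebesgue"
      using negligible_sphere[of "0::'a" s] by (simp add: negligible_iff_null_sets)
    then have "AE x in lebesgue. x \<notin> sphere (0::'a) s"
      by (rule AE_not_in)
    then show ?thesis by (simp add: AE_completion_iff)
  qed
  then have "AE x::'a in lborel. \<forall>s\<in>S. norm x \<noteq> s"
    using assms by (intro AE_finite_allI) auto
  then show ?thesis by eventually_elim auto
qed

lemma lipschitz_on_comp_norm:
  fixes f :: "real \<Rightarrow> real"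
  assumes "K-lipschitz_on UNIV f"
  shows "K-lipschitz_on UNIV (\<lambda>x::'a::real_normed_vector. f (norm x))"
proof (rule lipschitz_onI)
  fix x y :: 'a
  have "dist (f (norm x)) (f (norm y)) \<le> K * dist (norm x) (norm y)"
    by (rule lipschitz_onD[OF assms]) auto
  also have "\<dots> \<le> K * dist x y"
    using norm_triangle_ineq3[of x y] lipschitz_on_nonneg[OF assms]
    by (intro mult_left_mono) (auto simp: dist_norm)
  finally show "dist (f (norm x)) (f (norm y)) \<le> K * dist x y" .
qed (use lipschitz_on_nonneg[OF assms] in auto)

lemma norm_ray_derivative:
  fixes x e :: "'a::euclidean_space"
  assumes "x \<noteq> 0"
  shows "((\<lambda>t. norm (x + t *\<^sub>R e)) has_real_derivative (x \<bullet> e) / norm x) (at 0)"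
proof -
  have "((\<lambda>t. sqrt ((x + t *\<^sub>R e) \<bullet> (x + t *\<^sub>R e))) has_real_derivative (x \<bullet> e) / norm x) (at 0)"
    using assms inner_ge_zero[of x]
    by (auto intro!: derivative_eq_intros simp del: inner_ge_zero simp: inner_add_left inner_add_right inner_commute norm_eq_sqrt_inner divide_simps)
  then show ?thesis by (simp add: norm_eq_sqrt_inner)
qed

text \<open>\<open>D\<close> is the divergence of the vector field \<open>w x * f (norm x)\<close>
  times \<open>x\<close>. Its components are Lipschitz with bounded support and differentiable off
  the origin and finitely many spheres, so each partial derivative integrates to 0.\<close>

lemma radial_divergence:
  fixes w :: "'a::euclidean_space \<Rightarrow> real"
  assumes f: "K-lipschitz_on UNIV f" "\<And>r. r > R \<Longrightarrow> f r = 0"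
    and f': "\<And>r. r > 0 \<Longrightarrow> r \<notin> S \<Longrightarrow> (f has_real_derivative f' r) (at r)" "finite S"
      "f' \<in> borel_measurable borel"
    and w: "\<And>x. (w has_derivative (\<lambda>h. G x \<bullet> h)) (at x)" "continuous_on UNIV G"
  defines "D \<equiv> \<lambda>x. w x * (real DIM('a) * f (norm x) + norm x * f' (norm x)) + f (norm x) * (G x \<bullet> x)"
  shows "integrable lborel D" and "(LINT x|lborel. D x) = 0"
proof -
  note [measurable] = f'(3)
  have cw: "continuous_on UNIV w"
    using w(1) by (intro has_derivative_continuous_on) (auto intro: has_derivative_at_withinI)
  have [measurable]: "w \<in> borel_measurable borel" "G \<in> borel_measurable borel" "f \<in> borel_measurable borel"
    using cw w(2) lipschitz_on_continuous_on[OF f(1)] by (auto intro: borel_measurable_continuous_onI)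
  define Di where "Di i x = f' (norm x) * ((x \<bullet> i) / norm x) * (x \<bullet> i) * w x + f (norm x) * (i \<bullet> i) * w x
     + f (norm x) * (x \<bullet> i) * (G x \<bullet> i)" for i x
  have [measurable]: "Di i \<in> borel_measurable borel" for i
    unfolding Di_def by measurable
  have Di: "integrable lborel (Di i) \<and> (LINT x|lborel. Di i x) = 0" for i
  proof -
    have a1: "\<And>x::'a. norm x > R \<Longrightarrow> f (norm x) = 0" using f(2) by auto
    obtain K1 where K1: "K1-lipschitz_on UNIV (\<lambda>x::'a. f (norm x) * (x \<bullet> i))"
    proof (rule lipschitz_on_mult_C1[OF lipschitz_on_comp_norm[OF f(1)] a1, where w="\<lambda>x. x \<bullet> i" and G="\<lambda>x. i"])
      show "((\<lambda>x. x \<bullet> i) has_derivative (\<lambda>h. i \<bullet> h)) (at x)" for x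
        by (auto intro!: derivative_eq_intros simp: inner_commute)
    qed auto
    obtain K2 where K2: "K2-lipschitz_on UNIV (\<lambda>x::'a. f (norm x) * (x \<bullet> i) * w x)"
      by (rule lipschitz_on_mult_C1[OF K1 _ w, of R]) (use a1 in auto)
    have ae: "AE x in lborel. ((\<lambda>t. f (norm (x + t *\<^sub>R i)) * ((x + t *\<^sub>R i) \<bullet> i) * w (x + t *\<^sub>R i)) has_real_derivative Di i x) (at 0)"
      using AE_norm_notin_finite[OF finite.insertI[OF f'(2), of 0]]
    proof eventually_elim
      case (elim x)
      then have x: "x \<noteq> 0" "norm x \<notin> S" by auto
      have 1: "((\<lambda>t. f (norm (x + t *\<^sub>R i))) has_real_derivative f' (norm x) * ((x \<bullet> i) / norm x)) (at 0)"
        by (rule DERIV_chain2[where f=f]) (use f'(1)[of "norm x"] x norm_ray_derivative[OF x(1)] in auto)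
      have 2: "((\<lambda>t. (x + t *\<^sub>R i) \<bullet> i) has_real_derivative i \<bullet> i) (at 0)"
        by (auto intro!: derivative_eq_intros simp: inner_add_left)
      have 3: "((\<lambda>t. w (x + t *\<^sub>R i)) has_real_derivative G x \<bullet> i) (at 0)"
      proof -
        have "((\<lambda>t. x + t *\<^sub>R i) has_derivative (\<lambda>t. t *\<^sub>R i)) (at 0)"
          by (auto intro!: derivative_eq_intros)
        from has_derivative_compose[OF this, of w "\<lambda>h. G x \<bullet> h"] w(1)[of x]
        have "((\<lambda>t. w (x + t *\<^sub>R i)) has_derivative (\<lambda>t. G x \<bullet> (t *\<^sub>R i))) (at 0)" by simp
        then show ?thesis by (simp add: has_field_derivative_def mult.commute[of _ "G x \<bullet> i"])
      qed
      show "((\<lambda>t. f (norm (x + t *\<^sub>R i)) * ((x + t *\<^sub>R i) \<bullet> i) * w (x + t *\<^sub>R i)) has_real_derivative Di i x) (at 0)"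
        using DERIV_mult[OF DERIV_mult[OF 1 2] 3] by (simp add: Di_def mult_ac add_ac distrib_left distrib_right)
    qed
    show ?thesis
      using integral_derivative_eq_0[OF K2 _ _ ae, of R] a1 by auto
  qed
  have eq: "D x = (\<Sum>i\<in>Basis. Di i x)" for x
  proof -
    have 1: "(\<Sum>i\<in>Basis. (x \<bullet> i) * (x \<bullet> i)) = norm x * norm x"
      by (simp add: euclidean_inner[symmetric] power2_norm_eq_inner[symmetric] power2_eq_square)
    have "(\<Sum>i\<in>Basis. Di i x) = (f' (norm x) / norm x * w x) * (\<Sum>i\<in>Basis. (x \<bullet> i) * (x \<bullet> i))
       + (f (norm x) * w x) * (\<Sum>i\<in>(Basis::'a set). i \<bullet> i) + f (norm x) * (\<Sum>i\<in>Basis. (G x \<bullet> i) * (x \<bullet> i))"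
      unfolding Di_def by (simp add: sum.distrib sum_distrib_left mult_ac)
    also have "(\<Sum>i\<in>(Basis::'a set). i \<bullet> i) = real DIM('a)" by simp
    also have "(\<Sum>i\<in>Basis. (G x \<bullet> i) * (x \<bullet> i)) = G x \<bullet> x" by (rule euclidean_inner[symmetric])
    \<comment> \<open>At the origin both sides lose their \<open>f'\<close> term: one by the factor
      \<open>norm x\<close>, the other because division by 0 gives 0.\<close>
    finally show ?thesis unfolding 1 D_def by (cases "x = 0") (auto simp: algebra_simps)
  qed
  show "integrable lborel D" "(LINT x|lborel. D x) = 0"
    unfolding eq using Di by (auto simp: Bochner_Integration.integral_sum)
qed

section \<open>A Riccati-type inequality\<close>

text \<open>For \<open>n \<ge> 2\<close> the function is continuously differentiable across 0. The
  form \<open>s * \<bar>s\<bar> ^ (n - 2)\<close> keeps the sign that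
  \<open>\<bar>s\<bar> ^ (n - 1)\<close> would lose.\<close>

lemma abs_power_has_derivative:
  fixes s :: real
  assumes "n \<ge> 2"
  shows "((\<lambda>s. \<bar>s\<bar> ^ n) has_real_derivative real n * (s * \<bar>s\<bar> ^ (n - 2))) (at s)"
proof -
  obtain m where n: "n = Suc (Suc m)"
    using assms by (metis Suc_diff_le add_2_eq_Suc le_add_diff_inverse)
  consider "s > 0" | "s < 0" | "s = 0" by linarith
  then show ?thesis
  proof cases
    case 1
    have "((\<lambda>s. s ^ n) has_real_derivative real n * (s * \<bar>s\<bar> ^ (n - 2))) (at s)"
      using 1 DERIV_pow[of n s] by (simp add: n)
    then show ?thesis
      by (rule has_field_derivative_transform_within_open[where S="{0<..}"]) (use 1 in auto)
  next
    case 2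
    have "((\<lambda>s. (- s) ^ n) has_real_derivative real n * (s * \<bar>s\<bar> ^ (n - 2))) (at s)"
      using 2 DERIV_chain2[OF DERIV_pow[of n "- s"] DERIV_minus[OF DERIV_ident]] by (simp add: n)
    then show ?thesis
      by (rule has_field_derivative_transform_within_open[where S="{..<0}"]) (use 2 in auto)
  next
    case 3
    have "isCont (\<lambda>h::real. h * \<bar>h\<bar> ^ m) 0" by (intro continuous_intros)
    then have "((\<lambda>h::real. h * \<bar>h\<bar> ^ m) \<longlongrightarrow> 0) (at 0)"
      unfolding isCont_def by simp
    then have "((\<lambda>h::real. \<bar>h\<bar> ^ n / h) \<longlongrightarrow> 0) (at 0)"
      by (rule Lim_transform_eventually)
        (auto simp: eventually_at n abs_mult_self_eq mult.assoc[symmetric] intro!: exI[of _ 1])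
    with 3 show ?thesis by (simp add: has_field_derivative_iff n)
  qed
qed

text \<open>The field \<open>f (norm x)\<close> times \<open>x\<close> is tested against the power
  of \<open>\<bar>U\<bar>\<close> whose exponent is the dimension d. Here \<open>s\<close> bounds
  the length of the field to the power \<open>1 / (d - 1)\<close>, and \<open>k\<close> is at most
  its divergence minus \<open>(d - 1) * s ^ d\<close>; this second part is exactly what Young's
  inequality takes away in the gradient term. Inequalities in place of the differential equation
  leave room for a cut-off.\<close>

lemma riccati_inequality_C1:
  fixes U :: "'a::euclidean_space \<Rightarrow> real" and G :: "'a \<Rightarrow> 'a"
  assumes d: "DIM('a) \<ge> 2"
    and f: "K-lipschitz_on UNIV f" "\<And>r. r > R \<Longrightarrow> f r = 0" "\<And>r. f r \<ge> 0"
    and f': "\<And>r. r > 0 \<Longrightarrow> r \<notin> S \<Longrightarrow> (f has_real_derivative f' r) (at r)" "finite S"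
      "f' \<in> borel_measurable borel"
    and s: "\<And>r. s r \<ge> 0" "\<And>r. r > 0 \<Longrightarrow> r \<notin> S \<Longrightarrow> f r * r \<le> s r ^ (DIM('a) - 1)"
    and k: "\<And>r. r > 0 \<Longrightarrow> r \<notin> S \<Longrightarrow>
        k r \<le> real DIM('a) * f r + r * f' r - (real DIM('a) - 1) * s r ^ DIM('a)"
      "\<And>r. \<bar>k r\<bar> \<le> M" "k \<in> borel_measurable borel"
    and U: "\<And>x. (U has_derivative (\<lambda>h. G x \<bullet> h)) (at x)" "continuous_on UNIV G"
    and i: "integrable lborel (\<lambda>x. \<bar>U x\<bar> ^ DIM('a))" "integrable lborel (\<lambda>x. norm (G x) ^ DIM('a))"
  shows "(LINT x|lborel. k (norm x) * \<bar>U x\<bar> ^ DIM('a)) \<le> (LINT x|lborel. norm (G x) ^ DIM('a))"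
proof -
  let ?d = "DIM('a)"
  note [measurable] = f'(3) k(3)
  have cU: "continuous_on UNIV U"
    using U(1) by (intro has_derivative_continuous_on) (auto intro: has_derivative_at_withinI)
  have [measurable]: "U \<in> borel_measurable borel"
    using cU by (rule borel_measurable_continuous_onI)
  define w where "w x = \<bar>U x\<bar> ^ ?d" for x
  define H where "H x = (real ?d * (U x * \<bar>U x\<bar> ^ (?d - 2))) *\<^sub>R G x" for x
  have w: "(w has_derivative (\<lambda>h. H x \<bullet> h)) (at x)" for x
    using has_derivative_compose[OF U(1)[of x] abs_power_has_derivative[OF d, unfolded has_field_derivative_def]]
    by (simp add: w_def[abs_def] H_def mult_ac)
  have H: "continuous_on UNIV H"
    unfolding H_def by (intro continuous_intros cU U(2))
  define D where "D x = w x * (real ?d * f (norm x) + norm x * f' (norm x)) + f (norm x) * (H x \<bullet> x)" for x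
  have D: "integrable lborel D" "(LINT x|lborel. D x) = 0"
    using radial_divergence[OF f(1,2) f' w H] by (simp_all add: D_def[abs_def])
  have ki: "integrable lborel (\<lambda>x. k (norm x) * \<bar>U x\<bar> ^ ?d)"
  proof (rule Bochner_Integration.integrable_bound)
    show "integrable lborel (\<lambda>x. M * \<bar>U x\<bar> ^ ?d)" using i(1) by (rule integrable_mult_right)
    show "AE x in lborel. norm (k (norm x) * \<bar>U x\<bar> ^ ?d) \<le> norm (M * \<bar>U x\<bar> ^ ?d)"
      using k(2) by (intro AE_I2) (auto simp: abs_mult power_abs intro!: mult_right_mono order_trans[OF k(2) abs_ge_self])
  qed measurable
  have "(LINT x|lborel. k (norm x) * \<bar>U x\<bar> ^ ?d) - (LINT x|lborel. norm (G x) ^ ?d)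
      = (LINT x|lborel. k (norm x) * \<bar>U x\<bar> ^ ?d - norm (G x) ^ ?d)"
    by (rule Bochner_Integration.integral_diff[OF ki i(2), symmetric])
  also have "\<dots> \<le> (LINT x|lborel. D x)"
  proof (rule integral_mono_AE[OF Bochner_Integration.integrable_diff[OF ki i(2)] D(1)])
    show "AE x in lborel. k (norm x) * \<bar>U x\<bar> ^ ?d - norm (G x) ^ ?d \<le> D x"
      using AE_norm_notin_finite[OF finite.insertI[OF f'(2), of 0]]
    proof eventually_elim
      case (elim x)
      then have x: "norm x > 0" "norm x \<notin> S" by auto
      define b where "b = s (norm x) * \<bar>U x\<bar>"
      have b0: "b \<ge> 0" unfolding b_def using s(1) by simp
      have "\<bar>f (norm x) * (H x \<bullet> x)\<bar> \<le> f (norm x) * (norm (H x) * norm x)"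
        using f(3)[of "norm x"] Cauchy_Schwarz_ineq2[of "H x" x] by (simp add: abs_mult mult_left_mono)
      also have "norm (H x) = real ?d * \<bar>U x\<bar> ^ (?d - 1) * norm (G x)"
      proof -
        obtain m where m: "?d = Suc (Suc m)"
          using d by (metis Suc_diff_le add_2_eq_Suc le_add_diff_inverse)
        show ?thesis unfolding H_def m by (simp add: abs_mult power_abs)
      qed
      also have "f (norm x) * (real ?d * \<bar>U x\<bar> ^ (?d - 1) * norm (G x) * norm x)
         = (f (norm x) * norm x) * (real ?d * \<bar>U x\<bar> ^ (?d - 1) * norm (G x))" by (simp add: mult_ac)
      also have "\<dots> \<le> s (norm x) ^ (?d - 1) * (real ?d * \<bar>U x\<bar> ^ (?d - 1) * norm (G x))"
        using s(2)[OF x] by (intro mult_right_mono) auto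
      also have "\<dots> = real ?d * b ^ (?d - 1) * norm (G x)"
        by (simp add: b_def power_mult_distrib mult_ac)
      \<comment> \<open>Young's inequality, as the tangent of the power at
        \<open>b = s (norm x) * \<bar>U x\<bar>\<close>.\<close>
      also have "\<dots> \<le> norm (G x) ^ ?d + (real ?d - 1) * b ^ ?d"
      proof -
        have "b ^ (?d - 1) * b = b ^ ?d" by (rule power_minus_mult) (rule DIM_positive)
        then show ?thesis
          using power_tangent_le[OF b0 norm_ge_zero[of "G x"], of ?d] by (simp add: algebra_simps)
      qed
      also have "b ^ ?d = s (norm x) ^ ?d * w x"
        by (simp add: b_def w_def power_mult_distrib)
      finally have 1: "f (norm x) * (H x \<bullet> x) \<ge> - (norm (G x) ^ ?d + (real ?d - 1) * (s (norm x) ^ ?d * w x))"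
        by linarith
      have "k (norm x) * w x \<le> (real ?d * f (norm x) + norm x * f' (norm x) - (real ?d - 1) * s (norm x) ^ ?d) * w x"
        using k(1)[OF x] by (intro mult_right_mono) (auto simp: w_def)
      with 1 show ?case unfolding D_def by (simp add: w_def[symmetric] algebra_simps)
    qed
  qed
  finally show ?thesis using D(2) by simp
qed

text \<open>Either \<open>\<bar>b - a\<bar>\<close> is at most \<open>\<eta> * a\<close>, and
  \<open>b ^ n\<close> exceeds \<open>a ^ n\<close> at most by a factor below
  \<open>1 + \<delta>\<close>, or \<open>a\<close> and \<open>b\<close> are both bounded by
  multiples of \<open>\<bar>b - a\<bar>\<close>.\<close>

lemma power_le_perturbed:
  fixes \<delta> :: real
  assumes "\<delta> > 0"
  obtains C where "C > 0" "\<And>a b::real. a \<ge> 0 \<Longrightarrow> b \<ge> 0 \<Longrightarrow> b ^ n \<le> (1 + \<delta>) * a ^ n + C * \<bar>b - a\<bar> ^ n"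
proof -
  have "isCont (\<lambda>\<eta>::real. (1 + \<eta>) ^ n) 0" by (intro continuous_intros)
  then have "((\<lambda>\<eta>::real. (1 + \<eta>) ^ n) \<longlongrightarrow> 1) (at_right 0)"
    unfolding isCont_def by (auto intro: tendsto_mono[OF at_le])
  then have "\<forall>\<^sub>F \<eta> in at_right 0. (1 + \<eta>::real) ^ n < 1 + \<delta>"
    using assms by (intro order_tendstoD(2)) auto
  then have "\<forall>\<^sub>F \<eta> in at_right 0. (1 + \<eta>::real) ^ n < 1 + \<delta> \<and> \<eta> > 0"
    using eventually_at_right_less[of "0::real"] by eventually_elim auto
  then obtain \<eta> :: real where \<eta>: "\<eta> > 0" "(1 + \<eta>) ^ n < 1 + \<delta>"
    using eventually_happens'[OF trivial_limit_at_right_real] by blast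
  have "b ^ n \<le> (1 + \<delta>) * a ^ n + (1 + 1 / \<eta>) ^ n * \<bar>b - a\<bar> ^ n" if ab: "a \<ge> 0" "b \<ge> 0" for a b :: real
  proof (cases "\<bar>b - a\<bar> \<le> \<eta> * a")
    case True
    have "b \<le> (1 + \<eta>) * a" using True by (simp add: algebra_simps)
    then have "b ^ n \<le> ((1 + \<eta>) * a) ^ n" using ab by (intro power_mono)
    also have "\<dots> \<le> (1 + \<delta>) * a ^ n"
      using \<eta> ab by (simp add: power_mult_distrib mult_right_mono)
    also have "\<dots> \<le> (1 + \<delta>) * a ^ n + (1 + 1 / \<eta>) ^ n * \<bar>b - a\<bar> ^ n"
      using \<eta> by simp
    finally show ?thesis .
  next
    case False
    then have "a \<le> \<bar>b - a\<bar> / \<eta>" using \<eta> by (simp add: field_simps)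
    then have "b \<le> (1 + 1 / \<eta>) * \<bar>b - a\<bar>" by (simp add: algebra_simps)
    then have "b ^ n \<le> ((1 + 1 / \<eta>) * \<bar>b - a\<bar>) ^ n" using ab by (intro power_mono)
    also have "\<dots> \<le> (1 + \<delta>) * a ^ n + (1 + 1 / \<eta>) ^ n * \<bar>b - a\<bar> ^ n"
      using assms ab by (simp add: power_mult_distrib)
    finally show ?thesis .
  qed
  moreover have "(1 + 1 / \<eta>) ^ n > 0" using \<eta> by (simp add: add_pos_pos)
  ultimately show ?thesis using that by blast
qed

text \<open>The bound is two-sided, yet the relative error always refers to \<open>a\<close>: if
  \<open>\<bar>b\<bar> ^ n\<close> is the smaller power, \<open>\<delta>\<close> times it is at most
  \<open>\<delta> * \<bar>a\<bar> ^ n\<close>.\<close>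

lemma power_diff_le_perturbed:
  fixes \<delta> :: real
  assumes "\<delta> > 0"
  obtains C where "C > 0" "\<And>a b::real. \<bar>\<bar>b\<bar> ^ n - \<bar>a\<bar> ^ n\<bar> \<le> \<delta> * \<bar>a\<bar> ^ n + C * \<bar>b - a\<bar> ^ n"
proof -
  obtain C where C: "C > 0" "\<And>a b::real. a \<ge> 0 \<Longrightarrow> b \<ge> 0 \<Longrightarrow> b ^ n \<le> (1 + \<delta>) * a ^ n + C * \<bar>b - a\<bar> ^ n"
    using power_le_perturbed[OF assms] by metis
  have le: "\<bar>b\<bar> ^ n \<le> (1 + \<delta>) * \<bar>a\<bar> ^ n + C * \<bar>b - a\<bar> ^ n" for a b :: real
  proof -
    have "\<bar>\<bar>b\<bar> - \<bar>a\<bar>\<bar> ^ n \<le> \<bar>b - a\<bar> ^ n" by (intro power_mono) auto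
    then have "C * \<bar>\<bar>b\<bar> - \<bar>a\<bar>\<bar> ^ n \<le> C * \<bar>b - a\<bar> ^ n" using C(1) by simp
    then show ?thesis using C(2)[of "\<bar>a\<bar>" "\<bar>b\<bar>"] by simp
  qed
  have "\<bar>\<bar>b\<bar> ^ n - \<bar>a\<bar> ^ n\<bar> \<le> \<delta> * \<bar>a\<bar> ^ n + C * \<bar>b - a\<bar> ^ n" for a b :: real
  proof -
    define x y z where "x = \<bar>a\<bar> ^ n" and "y = \<bar>b\<bar> ^ n" and "z = C * \<bar>b - a\<bar> ^ n"
    have nn: "x \<ge> 0" "y \<ge> 0" "z \<ge> 0" using C(1) by (auto simp: x_def y_def z_def)
    have 1: "y \<le> x + \<delta> * x + z"
      using le[where b=b and a=a] unfolding x_def y_def z_def by (simp only: distrib_right mult_1)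
    have 2: "x \<le> y + \<delta> * y + z"
      using le[where b=a and a=b] unfolding x_def y_def z_def abs_minus_commute[of b a] by (simp only: distrib_right mult_1)
    have "x - y \<le> \<delta> * x + z"
    proof (cases "x \<le> y")
      case True
      moreover have "0 \<le> \<delta> * x" using nn assms by simp
      ultimately show ?thesis using nn by linarith
    next
      case False
      then have "\<delta> * y \<le> \<delta> * x" using assms by simp
      then show ?thesis using 2 by linarith
    qed
    then have "\<bar>y - x\<bar> \<le> \<delta> * x + z" using 1 by linarith
    then show ?thesis by (simp only: x_def y_def z_def)
  qed
  with C(1) show ?thesis using that by blast
qed

text \<open>Mollification yields a function with continuous gradient and does not increase the
  gradient energy, so only the weighted mass has to be approximated. Boundedness of \<open>k\<close>
  reduces this to the distance of \<open>mollify u\<close> from \<open>u\<close>.\<close>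

theorem riccati_inequality:
  fixes u :: "'a::euclidean_space \<Rightarrow> real"
  assumes d: "DIM('a) \<ge> 2"
    and f: "K-lipschitz_on UNIV f" "\<And>r. r > R \<Longrightarrow> f r = 0" "\<And>r. f r \<ge> 0"
    and f': "\<And>r. r > 0 \<Longrightarrow> r \<notin> S \<Longrightarrow> (f has_real_derivative f' r) (at r)" "finite S"
      "f' \<in> borel_measurable borel"
    and s: "\<And>r. s r \<ge> 0" "\<And>r. r > 0 \<Longrightarrow> r \<notin> S \<Longrightarrow> f r * r \<le> s r ^ (DIM('a) - 1)"
    and k: "\<And>r. r > 0 \<Longrightarrow> r \<notin> S \<Longrightarrow>
        k r \<le> real DIM('a) * f r + r * f' r - (real DIM('a) - 1) * s r ^ DIM('a)"
      "\<And>r. \<bar>k r\<bar> \<le> M" "k \<in> borel_measurable borel"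
    and u: "sobolev_pair DIM('a) u g"
  shows "(LINT x|lborel. k (norm x) * \<bar>u x\<bar> ^ DIM('a)) \<le> (LINT x|lborel. norm (g x) ^ DIM('a))"
proof (rule field_le_epsilon)
  let ?d = "DIM('a)"
  fix e :: real assume e: "e > 0"
  note [measurable] = k(3)
  have wg: "borel_weak_gradient u g" and ui: "integrable lborel (\<lambda>x. \<bar>u x\<bar> ^ ?d)"
    and gi: "integrable lborel (\<lambda>x. norm (g x) ^ ?d)"
    using u by (auto simp: sobolev_pair_def)
  have [measurable]: "u \<in> borel_measurable borel" "g \<in> borel_measurable borel"
    and gl: "\<And>r. set_integrable lborel (cball 0 r) g"
    using wg by (auto simp: borel_weak_gradient_def)
  define A where "A = (LINT x|lborel. \<bar>u x\<bar> ^ ?d)"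
  define E where "E = (LINT x|lborel. norm (g x) ^ ?d)"
  have A0: "A \<ge> 0" and E0: "E \<ge> 0" unfolding A_def E_def by (auto intro!: Bochner_Integration.integral_nonneg)
  have M0: "M \<ge> 0" using k(2)[of 0] by linarith
  define P where "P = (M + 1) * (A + 1)"
  have P: "P > 0" unfolding P_def using M0 A0 by simp
  \<comment> \<open>\<open>\<delta>\<close> makes the relative error of the powers cost at most
    \<open>e / 2\<close>; \<open>c\<close> below does the same for the distance term.\<close>
  define \<delta> where "\<delta> = e / (2 * P)"
  have \<delta>: "\<delta> > 0" unfolding \<delta>_def using e P by simp
  obtain C where C: "C > 0" "\<And>a b::real. \<bar>\<bar>b\<bar> ^ ?d - \<bar>a\<bar> ^ ?d\<bar> \<le> \<delta> * \<bar>a\<bar> ^ ?d + C * \<bar>b - a\<bar> ^ ?d"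
    using power_diff_le_perturbed[OF \<delta>] by metis
  define P' where "P' = (M + 1) * C * (E + 1)"
  have P': "P' > 0" unfolding P'_def using M0 C E0 by simp
  define c where "c = e / (2 * P')"
  have c: "c > 0" unfolding c_def using e P' by simp
  \<comment> \<open>The minimum with 1 gives
    \<open>\<epsilon> ^ ?d \<le> \<epsilon> \<le> c\<close>.\<close>
  define \<epsilon> where "\<epsilon> = min 1 c"
  have \<epsilon>: "\<epsilon> > 0" "\<epsilon> ^ ?d \<le> c"
  proof -
    show "\<epsilon> > 0" unfolding \<epsilon>_def using c by simp
    then have "\<epsilon> ^ ?d \<le> \<epsilon> ^ 1" unfolding \<epsilon>_def by (intro power_decreasing) auto
    then show "\<epsilon> ^ ?d \<le> c" unfolding \<epsilon>_def by simp
  qed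
  obtain \<rho> :: "'a \<Rightarrow> real" and K' B where "mollifier \<rho> \<epsilon> K' B"
    using mollifier_exists[OF \<epsilon>(1)] by metis
  then interpret mollifier \<rho> \<epsilon> K' B .
  have d1: "?d \<ge> 1" using d by simp
  have nn: "(\<integral>\<^sup>+x. ennreal (\<bar>u x\<bar> ^ ?d) \<partial>lborel) = ennreal A" "(\<integral>\<^sup>+x. ennreal (norm (g x) ^ ?d) \<partial>lborel) = ennreal E"
    unfolding A_def E_def using ui gi by (auto intro!: nn_integral_eq_integral)
  have *: "integrable lborel v \<and> (LINT x|lborel. v x) \<le> b"
    if "v \<in> borel_measurable borel" "\<And>x. v x \<ge> 0" "(\<integral>\<^sup>+x. ennreal (v x) \<partial>lborel) \<le> ennreal b" "b \<ge> 0" for v :: "'a \<Rightarrow> real" and b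
  proof -
    have i: "integrable lborel v"
      using that by (intro integrableI_nonneg) (auto simp: le_less_trans)
    then have "ennreal (LINT x|lborel. v x) \<le> ennreal b"
      using that nn_integral_eq_integral[OF i] by simp
    with i that(4) show ?thesis by simp
  qed
  have U: "integrable lborel (\<lambda>x. \<bar>mollify u x\<bar> ^ ?d)" "(LINT x|lborel. \<bar>mollify u x\<bar> ^ ?d) \<le> A"
    using *[of "\<lambda>x. \<bar>mollify u x\<bar> ^ ?d" A] mollify_norm_le[of u ?d] A0 d1 by (simp_all add: nn)
  have G: "integrable lborel (\<lambda>x. norm (mollify g x) ^ ?d)" "(LINT x|lborel. norm (mollify g x) ^ ?d) \<le> E"
    using *[of "\<lambda>x. norm (mollify g x) ^ ?d" E] mollify_norm_le[of g ?d] E0 d1 by (simp_all add: nn)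
  have Di: "integrable lborel (\<lambda>x. \<bar>mollify u x - u x\<bar> ^ ?d)" "(LINT x|lborel. \<bar>mollify u x - u x\<bar> ^ ?d) \<le> \<epsilon> ^ ?d * E"
    using *[of "\<lambda>x. \<bar>mollify u x - u x\<bar> ^ ?d" "\<epsilon> ^ ?d * E"] mollify_distance[OF wg, of ?d] E0 \<epsilon>(1) d1
    by (simp_all add: nn ennreal_mult)
  have ki: "integrable lborel (\<lambda>x. k (norm x) * \<bar>v x\<bar> ^ ?d)"
    if "integrable lborel (\<lambda>x. \<bar>v x\<bar> ^ ?d)" for v :: "'a \<Rightarrow> real"
  proof (rule Bochner_Integration.integrable_bound)
    show "integrable lborel (\<lambda>x. M * \<bar>v x\<bar> ^ ?d)" using that by (rule integrable_mult_right)
    show "AE x in lborel. norm (k (norm x) * \<bar>v x\<bar> ^ ?d) \<le> norm (M * \<bar>v x\<bar> ^ ?d)"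
      using k(2) by (intro AE_I2) (auto simp: abs_mult power_abs intro!: mult_right_mono order_trans[OF k(2) abs_ge_self])
    show "(\<lambda>x. k (norm x) * \<bar>v x\<bar> ^ ?d) \<in> borel_measurable lborel"
      using borel_measurable_integrable[OF that] by measurable
  qed
  have "(LINT x|lborel. k (norm x) * \<bar>u x\<bar> ^ ?d) - (LINT x|lborel. k (norm x) * \<bar>mollify u x\<bar> ^ ?d)
     = (LINT x|lborel. k (norm x) * \<bar>u x\<bar> ^ ?d - k (norm x) * \<bar>mollify u x\<bar> ^ ?d)"
    by (rule Bochner_Integration.integral_diff[OF ki[OF ui] ki[OF U(1)], symmetric])
  also have "\<dots> \<le> (LINT x|lborel. M * (\<delta> * \<bar>u x\<bar> ^ ?d + C * \<bar>mollify u x - u x\<bar> ^ ?d))"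
  proof (rule integral_mono[OF Bochner_Integration.integrable_diff[OF ki[OF ui] ki[OF U(1)]]])
    show "integrable lborel (\<lambda>x. M * (\<delta> * \<bar>u x\<bar> ^ ?d + C * \<bar>mollify u x - u x\<bar> ^ ?d))"
      using ui U Di by (intro integrable_mult_right Bochner_Integration.integrable_add) auto
    fix x
    have "k (norm x) * \<bar>u x\<bar> ^ ?d - k (norm x) * \<bar>mollify u x\<bar> ^ ?d = k (norm x) * (\<bar>u x\<bar> ^ ?d - \<bar>mollify u x\<bar> ^ ?d)"
      by (simp add: right_diff_distrib)
    also have "\<dots> \<le> \<bar>k (norm x)\<bar> * \<bar>\<bar>mollify u x\<bar> ^ ?d - \<bar>u x\<bar> ^ ?d\<bar>"
      using abs_ge_self[of "k (norm x) * (\<bar>u x\<bar> ^ ?d - \<bar>mollify u x\<bar> ^ ?d)"] by (simp add: abs_mult abs_minus_commute)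
    also have "\<dots> \<le> M * (\<delta> * \<bar>u x\<bar> ^ ?d + C * \<bar>mollify u x - u x\<bar> ^ ?d)"
      using k(2)[of "norm x"] C(2)[of "mollify u x" "u x"] M0 by (intro mult_mono) auto
    finally show "k (norm x) * \<bar>u x\<bar> ^ ?d - k (norm x) * \<bar>mollify u x\<bar> ^ ?d \<le> M * (\<delta> * \<bar>u x\<bar> ^ ?d + C * \<bar>mollify u x - u x\<bar> ^ ?d)" .
  qed
  also have "\<dots> = M * (\<delta> * A + C * (LINT x|lborel. \<bar>mollify u x - u x\<bar> ^ ?d))"
    unfolding A_def using ui U Di by simp
  also have "\<dots> \<le> M * (\<delta> * A + C * (c * E))"
  proof -
    have "\<epsilon> ^ ?d * E \<le> c * E" using \<epsilon>(2) E0 by (rule mult_right_mono)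
    then show ?thesis using M0 \<delta> C(1) U(2) Di(2) by (intro mult_left_mono add_mono) auto
  qed
  also have "\<dots> \<le> e"
  proof -
    have "M * (\<delta> * A) \<le> e / 2"
    proof -
      have "2 * P * \<delta> = e"
        unfolding \<delta>_def using P by simp
      moreover have "M * A * \<delta> \<le> P * \<delta>"
        unfolding P_def using M0 A0 \<delta> by (intro mult_right_mono mult_mono) auto
      ultimately show ?thesis by (simp add: algebra_simps)
    qed
    moreover have "M * (C * (c * E)) \<le> e / 2"
    proof -
      have "2 * P' * c = e"
        unfolding c_def using P' by simp
      moreover have "M * C * E * c \<le> P' * c"
        unfolding P'_def using M0 E0 C(1) c by (intro mult_right_mono mult_mono) auto
      ultimately show ?thesis by (simp add: algebra_simps)
    qed
    ultimately show ?thesis by (simp add: distrib_left)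
  qed
  finally have 1: "(LINT x|lborel. k (norm x) * \<bar>u x\<bar> ^ ?d) \<le> (LINT x|lborel. k (norm x) * \<bar>mollify u x\<bar> ^ ?d) + e"
    by simp
  have "(LINT x|lborel. k (norm x) * \<bar>mollify u x\<bar> ^ ?d) \<le> (LINT x|lborel. norm (mollify g x) ^ ?d)"
    by (rule riccati_inequality_C1[OF d f f' s k mollify_has_derivative[OF wg] mollify_continuous[OF _ gl] U(1) G(1)]) auto
  with 1 G(2) show "(LINT x|lborel. k (norm x) * \<bar>u x\<bar> ^ ?d) \<le> (LINT x|lborel. norm (g x) ^ ?d) + e"
    unfolding E_def by linarith
qed

section \<open>The logarithmic capacity bound for ball averages\<close>

lemma lipschitz_on_mult_bounded:
  fixes f g :: "'a::metric_space \<Rightarrow> real"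
  assumes f: "K-lipschitz_on X f" "\<And>x. x \<in> X \<Longrightarrow> \<bar>f x\<bar> \<le> A"
    and g: "L-lipschitz_on X g" "\<And>x. x \<in> X \<Longrightarrow> \<bar>g x\<bar> \<le> B"
    and AB: "A \<ge> 0" "B \<ge> 0"
  shows "(A * L + B * K)-lipschitz_on X (\<lambda>x. f x * g x)"
proof (rule lipschitz_onI)
  have KL: "K \<ge> 0" "L \<ge> 0" using lipschitz_on_nonneg f(1) g(1) by auto
  then show "0 \<le> A * L + B * K" using AB by simp
  fix x y assume xy: "x \<in> X" "y \<in> X"
  have "f x * g x - f y * g y = f x * (g x - g y) + (f x - f y) * g y"
    by (simp add: algebra_simps)
  also have "\<bar>\<dots>\<bar> \<le> \<bar>f x\<bar> * \<bar>g x - g y\<bar> + \<bar>f x - f y\<bar> * \<bar>g y\<bar>"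
    by (rule order_trans[OF abs_triangle_ineq]) (simp add: abs_mult)
  also have "\<dots> \<le> A * (L * dist x y) + (K * dist x y) * B"
    using f(2)[OF xy(1)] g(2)[OF xy(2)] lipschitz_onD[OF f(1) xy] lipschitz_onD[OF g(1) xy] AB KL
    by (intro add_mono mult_mono) (auto simp: dist_real_def)
  finally show "dist (f x * g x) (f y * g y) \<le> (A * L + B * K) * dist x y"
    by (simp add: dist_real_def algebra_simps)
qed

lemma lipschitz_on_clamp: "1-lipschitz_on UNIV (\<lambda>r::real. max a (min b r))"
  by (rule lipschitz_onI) (auto simp: dist_real_def)

text \<open>Clamping the argument extends \<open>f\<close> by constants beyond
  \<open>[a, b]\<close>, so a derivative bound on the interval gives a global Lipschitz
  constant.\<close>

lemma lipschitz_on_comp_clamp: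
  fixes f f' :: "real \<Rightarrow> real"
  assumes ab: "a \<le> b" and f: "\<And>r. a \<le> r \<Longrightarrow> r \<le> b \<Longrightarrow> (f has_real_derivative f' r) (at r)"
    and f': "continuous_on {a..b} f'"
  obtains K A where "K-lipschitz_on UNIV (\<lambda>r. f (max a (min b r)))"
    "A \<ge> 0" "\<And>r. \<bar>f (max a (min b r))\<bar> \<le> A"
proof -
  have "bounded (f' ` {a..b})"
    by (intro compact_imp_bounded compact_continuous_image f') auto
  then obtain K where K: "K > 0" "\<And>r. r \<in> {a..b} \<Longrightarrow> \<bar>f' r\<bar> \<le> K"
    unfolding bounded_pos by auto
  have fl: "K-lipschitz_on {a..b} f"
  proof (rule bounded_derivative_imp_lipschitz)
    show "(f has_derivative (\<lambda>h. f' x * h)) (at x within {a..b})" if "x \<in> {a..b}" for x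
      using f[of x] that by (auto simp: has_field_derivative_def intro: has_derivative_at_withinI)
    show "onorm (\<lambda>h. f' x * h) \<le> K" if "x \<in> {a..b}" for x
      using K(2)[OF that] by (intro onorm_le) (simp add: abs_mult mult_right_mono)
  qed (use K in auto)
  have "(K * 1)-lipschitz_on UNIV (\<lambda>r. f (max a (min b r)))"
    by (rule lipschitz_on_compose2[OF lipschitz_on_clamp]) (rule lipschitz_on_subset[OF fl], use ab in auto)
  moreover have "bounded (f ` {a..b})"
    by (intro compact_imp_bounded compact_continuous_image lipschitz_on_continuous_on[OF fl]) auto
  then obtain A where A: "A > 0" "\<And>r. r \<in> {a..b} \<Longrightarrow> \<bar>f r\<bar> \<le> A"
    unfolding bounded_pos by auto
  moreover have "\<bar>f (max a (min b r))\<bar> \<le> A" for r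
    using ab by (intro A(2)) auto
  ultimately show ?thesis using that[of "K * 1" A] by simp
qed

context
  fixes n :: nat and r0 \<rho> :: real
  assumes n: "n \<ge> 2" and r0: "0 < r0" and \<rho>: "r0 < \<rho>"
begin

text \<open>Between \<open>r0\<close> and \<open>\<rho>\<close> the field \<open>gm |x| x\<close> solves the Riccati equation exactly. It is made linear in \<open>x\<close>
  inside \<open>r0\<close>, which produces the positive part of \<open>kl\<close>, and cut off between \<open>\<rho>\<close> and \<open>2 * \<rho>\<close>, which
  costs the term \<open>(n + 1) / \<rho>^n\<close>. The function \<open>sl\<close> bounds the length of the
  field to the power \<open>1 / (n - 1)\<close>.\<close>

private definition "lg r = 1 + ln \<rho> - ln r"
private definition "gm r = 1 / (r ^ n * lg r ^ (n - 1))"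
private definition "gm' r = gm r * ((real n - 1) / (r * lg r) - real n / r)"
private definition "fl r = gm (max r0 (min \<rho> r)) * max 0 (min 1 (2 - r / \<rho>))"
private definition "fl' r = (if r < r0 then 0 else if r < \<rho> then gm' r
   else if r < 2 * \<rho> then - (1 / \<rho> ^ n) / \<rho> else 0)"
private definition "sl r = (if r < r0 then 1 / (r0 * lg r0) else if r < \<rho> then 1 / (r * lg r)
   else if r < 2 * \<rho> then 1 / \<rho> else 0)"
private definition "kl r = (if r \<le> r0 then real n * (1 - 1 / lg r0) / (r0 ^ n * lg r0 ^ (n - 1)) else 0)
   - (real n + 1) / \<rho> ^ n"

section \<open>Verification of the Riccati inequality for the explicit field\<close>

private lemma lg_ge_1: "0 < r \<Longrightarrow> r \<le> \<rho> \<Longrightarrow> lg r \<ge> 1"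
  by (simp add: lg_def)

private lemma gm_pos: "0 < r \<Longrightarrow> r \<le> \<rho> \<Longrightarrow> gm r > 0"
  using lg_ge_1[of r] unfolding gm_def by simp

private lemma gm_derivative:
  assumes "0 < r" "r \<le> \<rho>"
  shows "(gm has_real_derivative gm' r) (at r)"
proof -
  define m where "m = n - 2"
  have m: "real n = 2 + real m" "n - 1 = Suc m" "\<And>x::real. x ^ n = x * (x * x ^ m)"
  proof -
    have nm: "n = Suc (Suc m)" using n by (simp add: m_def)
    then show "real n = 2 + real m" "n - 1 = Suc m" by linarith+
    show "x ^ n = x * (x * x ^ m)" for x :: real by (subst nm) simp
  qed
  have l: "lg r \<noteq> 0" using lg_ge_1[OF assms] by simp
  have "(lg has_real_derivative - (1 / r)) (at r)"
    unfolding lg_def[abs_def] using assms by (auto intro!: derivative_eq_intros)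
  then have "((\<lambda>r. lg r ^ Suc m) has_real_derivative (1 + real m) * (- (1 / r) * lg r ^ m)) (at r)"
    by (rule DERIV_power_Suc)
  from DERIV_mult[OF DERIV_pow[of n r] this]
  have "((\<lambda>r. r ^ n * lg r ^ Suc m) has_real_derivative
     real n * r ^ Suc m * lg r ^ Suc m - (1 + real m) * (1 / r * lg r ^ m) * r ^ n) (at r)"
    by (rule DERIV_cong) (simp add: m[simplified] mult_ac)
  from DERIV_inverse_fun[OF this] l assms
  have "((\<lambda>r. inverse (r ^ n * lg r ^ Suc m)) has_real_derivative
    - ((real n * r ^ Suc m * lg r ^ Suc m - (1 + real m) * (1 / r * lg r ^ m) * r ^ n) / (r ^ n * lg r ^ Suc m)\<^sup>2)) (at r)"
    by (simp add: inverse_eq_divide power2_eq_square)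
  also have "- ((real n * r ^ Suc m * lg r ^ Suc m - (1 + real m) * (1 / r * lg r ^ m) * r ^ n) / (r ^ n * lg r ^ Suc m)\<^sup>2) = gm' r"
    using l assms unfolding gm'_def gm_def m by (simp add: divide_simps power2_eq_square) (simp add: algebra_simps)
  finally show ?thesis
    by (simp add: gm_def[abs_def] m(2)[simplified] inverse_eq_divide)
qed

private lemma gm'_continuous: "continuous_on {r0..\<rho>} gm'"
proof -
  have "r \<noteq> 0 \<and> 1 + ln \<rho> - ln r \<noteq> 0" if "r \<in> {r0..\<rho>}" for r
  proof -
    have "1 \<le> 1 + ln \<rho> - ln r" using that r0 by (intro lg_ge_1[unfolded lg_def]) auto
    then have "1 + ln \<rho> - ln r \<noteq> 0" by linarith
    then show ?thesis using that r0 by auto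
  qed
  then show ?thesis
    unfolding gm'_def gm_def lg_def by (intro continuous_intros) auto
qed

private lemma fl_lipschitz: "\<exists>K. K-lipschitz_on UNIV fl"
proof -
  obtain K A where K: "K-lipschitz_on UNIV (\<lambda>r. gm (max r0 (min \<rho> r)))"
    "A \<ge> 0" "\<And>r. \<bar>gm (max r0 (min \<rho> r))\<bar> \<le> A"
  proof (rule lipschitz_on_comp_clamp[of r0 \<rho> gm gm'])
    show "r0 \<le> \<rho>" using \<rho> by simp
    show "(gm has_real_derivative gm' r) (at r)" if "r0 \<le> r" "r \<le> \<rho>" for r
      using gm_derivative that r0 by auto
  qed (use gm'_continuous in blast)+
  have 1: "(1 / \<rho>)-lipschitz_on UNIV (\<lambda>r. 2 - r / \<rho>)"
    using r0 \<rho> by (intro lipschitz_onI) (auto simp: dist_real_def diff_divide_distrib[symmetric] abs_minus_commute)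
  have "(1 * (1 / \<rho>))-lipschitz_on UNIV (\<lambda>r. max 0 (min 1 (2 - r / \<rho>)))"
    by (rule lipschitz_on_compose2[OF 1 lipschitz_on_subset[OF lipschitz_on_clamp]]) auto
  from lipschitz_on_mult_bounded[OF K(1,3) this, of 1] K(2)
  show ?thesis unfolding fl_def[abs_def] by auto
qed

private lemma fl_derivative:
  assumes "r > 0" "r \<notin> {r0, \<rho>, 2 * \<rho>}"
  shows "(fl has_real_derivative fl' r) (at r)"
proof -
  have \<rho>0: "\<rho> > 0" using r0 \<rho> by simp
  consider "r < r0" | "r0 < r" "r < \<rho>" | "\<rho> < r" "r < 2 * \<rho>" | "r > 2 * \<rho>"
    using assms by force
  then show ?thesis
  proof cases
    case 1
    have "((\<lambda>r. gm r0) has_real_derivative 0) (at r)" by simp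
    then have "(fl has_real_derivative 0) (at r)"
      by (rule has_field_derivative_transform_within_open[where S="{..<r0}"])
        (use 1 r0 \<rho> \<rho>0 in \<open>auto simp: fl_def min_def max_def field_simps\<close>)
    then show ?thesis using 1 by (simp add: fl'_def)
  next
    case 2
    have "(gm has_real_derivative gm' r) (at r)"
      using gm_derivative 2 assms by simp
    then have "(fl has_real_derivative gm' r) (at r)"
      by (rule has_field_derivative_transform_within_open[where S="{r0<..<\<rho>}"])
        (use 2 r0 \<rho> \<rho>0 in \<open>auto simp: fl_def min_def max_def field_simps\<close>)
    then show ?thesis using 2 by (simp add: fl'_def)
  next
    case 3
    have "((\<lambda>r. 1 / \<rho> ^ n * (2 - r / \<rho>)) has_real_derivative - (1 / \<rho> ^ n) / \<rho>) (at r)"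
      using \<rho>0 by (auto intro!: derivative_eq_intros)
    then have "(fl has_real_derivative - (1 / \<rho> ^ n) / \<rho>) (at r)"
      by (rule has_field_derivative_transform_within_open[where S="{\<rho><..<2 * \<rho>}"])
        (use 3 r0 \<rho> \<rho>0 in \<open>auto simp: fl_def gm_def lg_def min_def max_def field_simps\<close>)
    then show ?thesis using 3 r0 \<rho> by (simp add: fl'_def)
  next
    case 4
    have "((\<lambda>r. 0) has_real_derivative 0) (at r)" by simp
    then have "(fl has_real_derivative 0) (at r)"
      by (rule has_field_derivative_transform_within_open[where S="{2 * \<rho><..}"])
        (use 4 r0 \<rho> \<rho>0 in \<open>auto simp: fl_def min_def max_def field_simps\<close>)
    then show ?thesis using 4 r0 \<rho> by (simp add: fl'_def)
  qed
qed

private lemma fl_values: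
  "r < r0 \<Longrightarrow> fl r = gm r0" "r0 < r \<Longrightarrow> r < \<rho> \<Longrightarrow> fl r = gm r"
  "\<rho> < r \<Longrightarrow> r < 2 * \<rho> \<Longrightarrow> fl r = 1 / \<rho> ^ n * (2 - r / \<rho>)" "r > 2 * \<rho> \<Longrightarrow> fl r = 0"
  using r0 \<rho> by (auto simp: fl_def gm_def lg_def min_def max_def field_simps)

private lemma fl_nonneg: "fl r \<ge> 0"
  using gm_pos[of "max r0 (min \<rho> r)"] r0 \<rho> unfolding fl_def by (intro mult_nonneg_nonneg) (auto intro: less_imp_le)

private lemma sl_nonneg: "sl r \<ge> 0"
  using lg_ge_1[of r] lg_ge_1[of r0] r0 \<rho> by (auto simp: sl_def)

text \<open>\<open>1 / (r * lg r)\<close> is the absolute logarithmic derivative of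
  \<open>lg\<close>. The length of the field and the Riccati term are its powers of order
  \<open>n - 1\<close> and \<open>n\<close>.\<close>

private lemma gm_eq:
  assumes "0 < r" "r \<le> \<rho>"
  shows "gm r * r = (1 / (r * lg r)) ^ (n - 1)" "gm r / lg r = (1 / (r * lg r)) ^ n"
proof -
  have m: "x ^ n = x * x ^ (n - 1)" for x :: real
    using n by (intro power_eq_if[THEN trans]) auto
  show "gm r * r = (1 / (r * lg r)) ^ (n - 1)" "gm r / lg r = (1 / (r * lg r)) ^ n"
    using assms lg_ge_1[OF assms] by (auto simp: gm_def m[simplified] power_divide power_mult_distrib)
qed

private lemma fl_le_sl:
  assumes "r > 0" "r \<notin> {r0, \<rho>, 2 * \<rho>}"
  shows "fl r * r \<le> sl r ^ (n - 1)"
proof -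
  have \<rho>0: "\<rho> > 0" using r0 \<rho> by simp
  consider "r < r0" | "r0 < r" "r < \<rho>" | "\<rho> < r" "r < 2 * \<rho>" | "r > 2 * \<rho>"
    using assms by force
  then show ?thesis
  proof cases
    case 1
    have "gm r0 * r \<le> gm r0 * r0" using 1 gm_pos[of r0] r0 \<rho> by simp
    then show ?thesis using 1 gm_eq(1)[of r0] r0 \<rho> by (simp add: fl_values sl_def)
  next
    case 2
    then show ?thesis using gm_eq(1)[of r] r0 by (simp add: fl_values sl_def)
  next
    case 3
    have m: "\<rho> ^ n = \<rho> * \<rho> ^ (n - 1)"
      using n by (intro power_eq_if[THEN trans]) auto
    \<comment> \<open>With \<open>t = r / \<rho>\<close> this is \<open>0 \<le> (1 - t) ^ 2\<close>:
      beyond \<open>\<rho>\<close> the linear cut-off keeps \<open>fl r * r\<close> below its value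
      at \<open>\<rho>\<close>.\<close>
    have "(2 - r / \<rho>) * (r / \<rho>) \<le> 1"
      using zero_le_power2[of "1 - r / \<rho>"] by (simp add: power2_eq_square algebra_simps)
    then have "(1 / \<rho> ^ (n - 1)) * ((2 - r / \<rho>) * (r / \<rho>)) \<le> (1 / \<rho> ^ (n - 1)) * 1"
      using \<rho>0 by (intro mult_left_mono) auto
    then show ?thesis using 3 r0 \<rho> by (simp add: fl_values sl_def m[simplified] power_divide mult_ac)
  next
    case 4
    then show ?thesis by (simp add: fl_values sl_nonneg)
  qed
qed

private lemma kl_le:
  assumes "r > 0" "r \<notin> {r0, \<rho>, 2 * \<rho>}"
  shows "kl r \<le> real n * fl r + r * fl' r - (real n - 1) * sl r ^ n"
proof -
  have \<rho>0: "\<rho> > 0" using r0 \<rho> by simp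
  have E: "(real n + 1) / \<rho> ^ n \<ge> 0" using \<rho>0 by simp
  consider "r < r0" | "r0 < r" "r < \<rho>" | "\<rho> < r" "r < 2 * \<rho>" | "r > 2 * \<rho>"
    using assms by force
  then show ?thesis
  proof cases
    case 1
    \<comment> \<open>Inside \<open>r0\<close> the field is \<open>gm r0\<close> times
      \<open>x\<close>, with divergence \<open>n * gm r0\<close>. Weakening \<open>n - 1\<close> to
      \<open>n\<close> in the Riccati term produces the factor \<open>1 - 1 / lg r0\<close> of
      \<open>kl\<close>.\<close>
    have "real n * (1 - 1 / lg r0) / (r0 ^ n * lg r0 ^ (n - 1)) = real n * gm r0 - real n * (gm r0 / lg r0)"
      by (simp add: gm_def diff_divide_distrib right_diff_distrib)
    also have "\<dots> \<le> real n * gm r0 - (real n - 1) * (gm r0 / lg r0)"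
      using gm_pos[of r0] lg_ge_1[of r0] r0 \<rho> by (intro diff_left_mono mult_right_mono) auto
    finally have le: "real n * (1 - 1 / lg r0) / (r0 ^ n * lg r0 ^ (n - 1)) \<le> real n * gm r0 - (real n - 1) * (gm r0 / lg r0)" .
    show ?thesis
    proof -
      have "kl r = real n * (1 - 1 / lg r0) / (r0 ^ n * lg r0 ^ (n - 1)) - (real n + 1) / \<rho> ^ n"
        using 1 by (simp add: kl_def)
      moreover have "real n * fl r + r * fl' r - (real n - 1) * sl r ^ n = real n * gm r0 - (real n - 1) * (gm r0 / lg r0)"
        using 1 gm_eq(2)[of r0] r0 \<rho> by (simp add: fl_values fl'_def sl_def)
      ultimately show ?thesis using le E by linarith
    qed
  next
    case 2
    \<comment> \<open>In the annulus the divergence and the Riccati term cancel exactly, so only the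
      negative constant of \<open>kl\<close> has to be accommodated.\<close>
    have "r * gm' r = (real n - 1) * (gm r / lg r) - real n * gm r"
    proof -
      have "r * ((real n - 1) / (r * lg r) - real n / r) = (real n - 1) / lg r - real n"
        using 2 r0 mult_divide_mult_cancel_left[of r "real n - 1" "lg r"]
        by (simp add: right_diff_distrib del: mult_divide_mult_cancel_left)
      then have "r * gm' r = gm r * ((real n - 1) / lg r - real n)"
        unfolding gm'_def by (metis mult.left_commute)
      then show ?thesis by (simp add: algebra_simps)
    qed
    then show ?thesis
      using 2 E gm_eq(2)[of r] r0 by (simp add: kl_def fl_values fl'_def sl_def)
  next
    case 3
    \<comment> \<open>Origin of the constant \<open>n + 1\<close>: in units of
      \<open>1 / \<rho> ^ n\<close> the cut-off loses at most 2 in \<open>r * fl' r\<close>, and the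
      Riccati term is \<open>n - 1\<close>.\<close>
    have le2: "r / \<rho> \<le> 2" using 3 \<rho>0 by (simp add: field_simps)
    then have le: "(r / \<rho>) / \<rho> ^ n \<le> 2 / \<rho> ^ n" using \<rho>0 by (intro divide_right_mono) auto
    have "real n * (1 / \<rho> ^ n * (2 - r / \<rho>)) \<ge> 0"
      using le2 \<rho>0 by (intro mult_nonneg_nonneg) auto
    then have "real n * fl r \<ge> 0" using 3 by (simp only: fl_values)
    moreover have "r * fl' r = - ((r / \<rho>) / \<rho> ^ n)"
      using 3 r0 \<rho> by (simp add: fl'_def mult.commute)
    moreover have "(real n - 1) * sl r ^ n = real n / \<rho> ^ n - 1 / \<rho> ^ n"
      using 3 r0 \<rho> by (simp add: sl_def power_divide diff_divide_distrib)
    moreover have "kl r = - (real n / \<rho> ^ n) - 1 / \<rho> ^ n"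
      using 3 r0 \<rho> by (simp add: kl_def add_divide_distrib)
    moreover have "2 / \<rho> ^ n = 1 / \<rho> ^ n + 1 / \<rho> ^ n" by (simp add: add_divide_distrib[symmetric])
    ultimately show ?thesis using le by linarith
  next
    case 4
    then show ?thesis using n r0 \<rho> by (simp add: kl_def fl_values fl'_def sl_def power_0_left)
  qed
qed

lemma logarithmic_capacity_centered:
  fixes u :: "'a::euclidean_space \<Rightarrow> real"
  assumes u: "sobolev_pair DIM('a) u g" and dim: "DIM('a) = n" and l: "l = 1 + ln (\<rho> / r0)"
  shows "real n * (1 - 1 / l) / (r0 ^ n * l ^ (n - 1)) * (LINT x|lborel. indicator (cball 0 r0) x * \<bar>u x\<bar> ^ n)
    \<le> (LINT x|lborel. norm (g x) ^ n) + (real n + 1) / \<rho> ^ n * (LINT x|lborel. \<bar>u x\<bar> ^ n)"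
proof -
  obtain K where K: "K-lipschitz_on UNIV fl" using fl_lipschitz by blast
  define c where "c = real n * (1 - 1 / lg r0) / (r0 ^ n * lg r0 ^ (n - 1))"
  define E where "E = (real n + 1) / \<rho> ^ n"
  have lg: "lg r0 = l" unfolding l lg_def using r0 \<rho> by (simp add: ln_div)
  have fm[measurable]: "fl' \<in> borel_measurable borel" "kl \<in> borel_measurable borel"
    unfolding fl'_def[abs_def] gm'_def[abs_def] gm_def[abs_def] lg_def[abs_def] kl_def[abs_def] by measurable
  have ui: "integrable lborel (\<lambda>x. \<bar>u x\<bar> ^ n)" and [measurable]: "u \<in> borel_measurable borel"
    using u dim by (auto simp: sobolev_pair_def borel_weak_gradient_def)
  have bd: "\<bar>kl r\<bar> \<le> \<bar>c\<bar> + \<bar>E\<bar>" for r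
    unfolding kl_def c_def[symmetric] E_def[symmetric] by auto
  have "(LINT x|lborel. kl (norm x) * \<bar>u x\<bar> ^ DIM('a)) \<le> (LINT x|lborel. norm (g x) ^ DIM('a))"
  proof (rule riccati_inequality[where S="{r0, \<rho>, 2 * \<rho>}" and s=sl, OF _ K _ fl_nonneg fl_derivative _ fm(1) sl_nonneg _ _ bd fm(2) u])
    show "r > 2 * \<rho> \<Longrightarrow> fl r = 0" for r by (rule fl_values)
    show "fl r * r \<le> sl r ^ (DIM('a) - 1)" if "r > 0" "r \<notin> {r0, \<rho>, 2 * \<rho>}" for r
      using fl_le_sl[OF that] by (simp only: dim)
    show "kl r \<le> real DIM('a) * fl r + r * fl' r - (real DIM('a) - 1) * sl r ^ DIM('a)" if "r > 0" "r \<notin> {r0, \<rho>, 2 * \<rho>}" for r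
      using kl_le[OF that] by (simp only: dim)
    show "2 \<le> DIM('a)" using n by (simp only: dim)
  qed auto
  also have "(LINT x|lborel. kl (norm x) * \<bar>u x\<bar> ^ DIM('a))
     = (LINT x|lborel. c * (indicator (cball 0 r0) x * \<bar>u x\<bar> ^ n) - E * \<bar>u x\<bar> ^ n)"
    unfolding dim by (intro Bochner_Integration.integral_cong) (auto simp: kl_def c_def E_def algebra_simps)
  also have "\<dots> = c * (LINT x|lborel. indicator (cball 0 r0) x * \<bar>u x\<bar> ^ n) - E * (LINT x|lborel. \<bar>u x\<bar> ^ n)"
    using ui integrable_mult_indicator[of "cball 0 r0" lborel "\<lambda>x. \<bar>u x\<bar> ^ n"] by simp
  finally show ?thesis unfolding dim c_def E_def lg by simp
qed

end

section \<open>Balls with arbitrary centre\<close>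

lemma sobolev_pair_shift:
  assumes "sobolev_pair p u g"
  shows "sobolev_pair p (\<lambda>x. u (x + y)) (\<lambda>x. g (x + y))"
proof -
  have wg: "borel_weak_gradient u g" and ui: "integrable lborel (\<lambda>x. \<bar>u x\<bar> ^ p)"
    and gi: "integrable lborel (\<lambda>x. norm (g x) ^ p)"
    using assms by (auto simp: sobolev_pair_def)
  have [measurable]: "u \<in> borel_measurable borel" "g \<in> borel_measurable borel"
    and ul: "\<And>r. set_integrable lborel (cball 0 r) u" and gl: "\<And>r. set_integrable lborel (cball 0 r) g"
    using wg by (auto simp: borel_weak_gradient_def)
  have si: "set_integrable lborel (cball 0 r) (\<lambda>x. v (x + y))"
    if [measurable]: "v \<in> borel_measurable borel" and "\<And>r. set_integrable lborel (cball 0 r) v" for v :: "'a \<Rightarrow> 'b::euclidean_space" and r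
  proof -
    have "norm (x - y) \<le> r \<Longrightarrow> norm x \<le> r + norm y" for x
      using norm_triangle_ineq2[of x y] by linarith
    then have "set_integrable lborel (cball y r) v"
      by (intro set_integrable_subset[OF that(2)[of "r + norm y"]]) (auto simp: dist_norm norm_minus_commute)
    then have "integrable lborel (\<lambda>x. indicator (cball y r) (x + y) *\<^sub>R v (x + y))"
      unfolding set_integrable_def by (rule integrable_lborel_shift)
    moreover have "indicator (cball y r) (x + y) = (indicator (cball 0 r) x :: real)" for x
      by (auto simp: indicator_def dist_norm)
    ultimately show ?thesis by (simp add: set_integrable_def)
  qed
  have "(LINT x|lborel. u (x + y) * frechet_derivative \<phi> (at x) h) = - (LINT x|lborel. (g (x + y) \<bullet> h) * \<phi> x)"
    if t: "test_function \<phi>" for \<phi> h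
  proof -
    have [measurable]: "\<phi> \<in> borel_measurable borel" "(\<lambda>x. frechet_derivative \<phi> (at x) h) \<in> borel_measurable borel"
      by (intro borel_measurable_continuous_onI continuous_on_test_function test_function_derivative_continuous t)+
    have "(LINT x|lborel. u (x + y) * frechet_derivative \<phi> (at x) h) = (LINT x|lborel. u x * frechet_derivative (\<lambda>x. \<phi> (x + - y)) (at x) h)"
      using integral_lborel_shift[of "\<lambda>x. u x * frechet_derivative \<phi> (at (x - y)) h" y] test_function_shift(2)[OF t, of "- y"]
      by simp
    also have "\<dots> = - (LINT x|lborel. (g x \<bullet> h) * \<phi> (x + - y))"
      using wg test_function_shift(1)[OF t, of "- y"] unfolding borel_weak_gradient_def by blast
    also have "(LINT x|lborel. (g x \<bullet> h) * \<phi> (x + - y)) = (LINT x|lborel. (g (x + y) \<bullet> h) * \<phi> x)"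
      using integral_lborel_shift[of "\<lambda>x. (g x \<bullet> h) * \<phi> (x - y)" y] by simp
    finally show ?thesis .
  qed
  then show ?thesis
    unfolding sobolev_pair_def borel_weak_gradient_def
    using si[OF _ ul] si[OF _ gl] integrable_lborel_shift[OF ui, of y] integrable_lborel_shift[OF gi, of y] by simp
qed

text \<open>The mass coefficient is the price of the cut-off beyond \<open>\<rho>\<close>. With the
  sign reversed it becomes the lower bound for the Rayleigh quotient.\<close>

definition sobolev_energy :: "nat \<Rightarrow> real \<Rightarrow> ('a::euclidean_space \<Rightarrow> real) \<Rightarrow> ('a \<Rightarrow> 'a) \<Rightarrow> real" where
  "sobolev_energy p \<rho> u g = (LINT x|lborel. norm (g x) ^ p) + (real p + 1) / \<rho> ^ p * (LINT x|lborel. \<bar>u x\<bar> ^ p)"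

text \<open>The constant is best read through the mean over the ball:
  \<open>DIM('a) * unit_ball_vol (real DIM('a))\<close> is the area of the unit sphere, so the mean
  is at most \<open>l ^ (DIM('a) - 1) / (1 - 1 / l)\<close> times the energy divided by this area.
  Translation invariance makes the bound uniform in the centre \<open>y\<close>.\<close>

theorem logarithmic_capacity:
  fixes u :: "'a::euclidean_space \<Rightarrow> real"
  assumes d: "DIM('a) \<ge> 2" and u: "sobolev_pair DIM('a) u g" and r: "0 < r0" "r0 < \<rho>" and l: "l = 1 + ln (\<rho> / r0)"
  shows "real DIM('a) * (1 - 1 / l) * (LINT x|lborel. indicator (cball y r0) x * \<bar>u x\<bar> ^ DIM('a))
    \<le> r0 ^ DIM('a) * l ^ (DIM('a) - 1) * sobolev_energy DIM('a) \<rho> u g"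
proof -
  have [measurable]: "u \<in> borel_measurable borel" "g \<in> borel_measurable borel"
    using u by (auto simp: sobolev_pair_def borel_weak_gradient_def)
  have ind: "indicator (cball y r0) (x + y) = (indicator (cball 0 r0) x :: real)" for x
    by (auto simp: indicator_def dist_norm)
  have [measurable]: "(\<lambda>x. indicator (cball y r0) x * \<bar>u x\<bar> ^ DIM('a)) \<in> borel_measurable borel"
    by (intro borel_measurable_times borel_measurable_indicator) auto
  have "ln (\<rho> / r0) > 0" using r by simp
  then have "l > 0" unfolding l by simp
  then have "r0 ^ DIM('a) * l ^ (DIM('a) - 1) > 0" using r by simp
  moreover have "real DIM('a) * (1 - 1 / l) / (r0 ^ DIM('a) * l ^ (DIM('a) - 1)) * (LINT x|lborel. indicator (cball y r0) x * \<bar>u x\<bar> ^ DIM('a))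
     \<le> sobolev_energy DIM('a) \<rho> u g"
    using logarithmic_capacity_centered[OF d r sobolev_pair_shift[OF u, of y] refl l]
      integral_lborel_shift[of "\<lambda>x. indicator (cball y r0) x * \<bar>u x\<bar> ^ DIM('a)" y]
      integral_lborel_shift[of "\<lambda>x. \<bar>u x\<bar> ^ DIM('a)" y] integral_lborel_shift[of "\<lambda>x. norm (g x) ^ DIM('a)" y]
    by (simp add: sobolev_energy_def ind)
  ultimately show ?thesis by (simp add: divide_le_eq mult_ac)
qed

section \<open>Weighted inequalities\<close>

text \<open>Since \<open>x = y - (y - x)\<close>, the larger of \<open>\<bar>y\<bar>\<close> and
  \<open>\<bar>y - x\<bar>\<close> is at least half of \<open>\<bar>x\<bar>\<close>.\<close>

lemma abs_power_le_double:
  fixes x y :: real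
  shows "\<bar>x\<bar> ^ n \<le> 2 ^ n * (\<bar>y - x\<bar> ^ n + \<bar>y\<bar> ^ n)"
proof (cases "\<bar>y - x\<bar> \<le> \<bar>y\<bar>")
  case True
  then have "\<bar>x\<bar> ^ n \<le> (2 * \<bar>y\<bar>) ^ n"
    using abs_triangle_ineq4[of y "y - x"] by (intro power_mono) auto
  then show ?thesis by (simp add: power_mult_distrib distrib_left add_increasing)
next
  case False
  then have "\<bar>x\<bar> ^ n \<le> (2 * \<bar>y - x\<bar>) ^ n"
    using abs_triangle_ineq4[of y "y - x"] by (intro power_mono) auto
  then show ?thesis by (simp add: power_mult_distrib distrib_left add_increasing2)
qed

text \<open>The point value \<open>u x\<close> is compared with the average of \<open>u\<close> over a ball around \<open>x\<close> whose
  radius \<open>exp (- j x)\<close> shrinks as the weight grows.\<close>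

lemma unbounded_weight_bound:
  fixes u T :: "'a::euclidean_space \<Rightarrow> real" and j :: "'a \<Rightarrow> nat"
  assumes d: "DIM('a) \<ge> 2" and u: "sobolev_pair DIM('a) u g"
    and [measurable]: "T \<in> borel_measurable borel" "j \<in> borel \<rightarrow>\<^sub>M count_space UNIV"
    and T: "\<And>x. 0 \<le> T x" "\<And>x. T x \<le> exp (real (j x))" and \<rho>: "\<rho> \<ge> exp 1"
  defines "N \<equiv> sobolev_energy DIM('a) \<rho> u g" and "\<beta> \<equiv> unit_ball_vol (real DIM('a))"
  shows "(\<integral>\<^sup>+x. ennreal (T x * \<bar>u x\<bar> ^ DIM('a)) \<partial>lborel) \<le>
    ennreal (2 ^ (DIM('a) + 1) * (LINT x|lborel. norm (g x) ^ DIM('a)))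
    + ennreal (2 ^ (DIM('a) + 1) / (real DIM('a) * \<beta>) * N) *
      (\<integral>\<^sup>+x. ennreal (T x * (1 + ln \<rho> + real (j x)) ^ (DIM('a) - 1)) \<partial>lborel)"
proof -
  let ?d = "DIM('a)"
  have wg: "borel_weak_gradient u g" and ui: "integrable lborel (\<lambda>x. \<bar>u x\<bar> ^ ?d)"
    and gi: "integrable lborel (\<lambda>x. norm (g x) ^ ?d)"
    using u by (auto simp: sobolev_pair_def)
  have [measurable]: "u \<in> borel_measurable borel" "g \<in> borel_measurable borel"
    using wg by (auto simp: borel_weak_gradient_def)
  define G where "G = (LINT x|lborel. norm (g x) ^ ?d)"
  have G: "G \<ge> 0" "(\<integral>\<^sup>+x. ennreal (norm (g x) ^ ?d) \<partial>lborel) = ennreal G"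
    unfolding G_def using gi by (auto intro!: nn_integral_eq_integral Bochner_Integration.integral_nonneg)
  have \<beta>: "\<beta> > 0" unfolding \<beta>_def by simp
  have \<rho>0: "\<rho> > 1" using \<rho> exp_gt_one[of "1::real"] by linarith
  have N: "N \<ge> 0" unfolding N_def sobolev_energy_def using \<rho>0
    by (intro add_nonneg_nonneg mult_nonneg_nonneg Bochner_Integration.integral_nonneg) auto
  define r where "r x = exp (- real (j x))" for x
  have r: "r x > 0" "r x \<le> 1" for x by (auto simp: r_def)
  have [measurable]: "r \<in> borel_measurable borel" unfolding r_def by measurable
  \<comment> \<open>The factor \<open>2 ^ ?d\<close> comes from splitting \<open>u x\<close> into
    the difference \<open>u (x + z) - u x\<close> and the value \<open>u (x + z)\<close>; the
    denominator is the volume of the ball of radius \<open>r x\<close>.\<close>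
  define c where "c x = 2 ^ ?d * T x / (\<beta> * r x ^ ?d)" for x
  have [measurable]: "c \<in> borel_measurable borel" unfolding c_def by measurable
  have c: "c x \<ge> 0" for x unfolding c_def using T(1)[of x] \<beta> r[of x] by simp
  \<comment> \<open>\<open>A1\<close> collects the oscillation of \<open>u\<close> around
    \<open>x\<close>, \<open>A2\<close> its average over the ball.\<close>
  define A1 where "A1 x = (\<integral>\<^sup>+z. ennreal (c x * (if norm z \<le> r x then \<bar>u (x + z) - u x\<bar> ^ ?d else 0)) \<partial>lborel)" for x
  define A2 where "A2 x = (\<integral>\<^sup>+z. ennreal (c x * (if norm z \<le> r x then \<bar>u (x + z)\<bar> ^ ?d else 0)) \<partial>lborel)" for x
  have step1: "ennreal (T x * \<bar>u x\<bar> ^ ?d) \<le> A1 x + A2 x" for x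
  proof -
    have "ennreal (T x * \<bar>u x\<bar> ^ ?d) = ennreal (T x * \<bar>u x\<bar> ^ ?d / (\<beta> * r x ^ ?d)) * ennreal (\<beta> * r x ^ ?d)"
      using T(1)[of x] \<beta> r[of x] by (simp add: ennreal_mult[symmetric])
    also have "\<dots> = (\<integral>\<^sup>+z. ennreal (T x * \<bar>u x\<bar> ^ ?d / (\<beta> * r x ^ ?d)) * indicator (cball 0 (r x)) z \<partial>(lborel::'a measure))"
      using r[of x] by (simp add: nn_integral_cmult_indicator emeasure_cball \<beta>_def)
    also have "\<dots> \<le> (\<integral>\<^sup>+z. ennreal (c x * (if norm z \<le> r x then \<bar>u (x + z) - u x\<bar> ^ ?d else 0))
        + ennreal (c x * (if norm z \<le> r x then \<bar>u (x + z)\<bar> ^ ?d else 0)) \<partial>lborel)"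
    proof (rule nn_integral_mono)
      fix z
      have "\<bar>u x\<bar> ^ ?d \<le> 2 ^ ?d * (\<bar>u (x + z) - u x\<bar> ^ ?d + \<bar>u (x + z)\<bar> ^ ?d)"
        by (rule abs_power_le_double)
      then have "T x / (\<beta> * r x ^ ?d) * \<bar>u x\<bar> ^ ?d \<le> T x / (\<beta> * r x ^ ?d) * (2 ^ ?d * (\<bar>u (x + z) - u x\<bar> ^ ?d + \<bar>u (x + z)\<bar> ^ ?d))"
        using T(1)[of x] \<beta> r[of x] by (intro mult_left_mono) auto
      then have "T x * \<bar>u x\<bar> ^ ?d / (\<beta> * r x ^ ?d) \<le> c x * \<bar>u (x + z) - u x\<bar> ^ ?d + c x * \<bar>u (x + z)\<bar> ^ ?d"
        by (simp add: c_def distrib_left mult_ac)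
      then show "ennreal (T x * \<bar>u x\<bar> ^ ?d / (\<beta> * r x ^ ?d)) * indicator (cball 0 (r x)) z \<le>
         ennreal (c x * (if norm z \<le> r x then \<bar>u (x + z) - u x\<bar> ^ ?d else 0)) + ennreal (c x * (if norm z \<le> r x then \<bar>u (x + z)\<bar> ^ ?d else 0))"
        using c[of x] by (auto simp: indicator_def ennreal_plus[symmetric] simp del: ennreal_plus intro!: ennreal_leI)
    qed
    also have "\<dots> = A1 x + A2 x"
      unfolding A1_def A2_def by (rule nn_integral_add) measurable
    finally show ?thesis .
  qed
  have step2: "A2 x \<le> ennreal (2 ^ (?d + 1) / (real ?d * \<beta>) * N) * ennreal (T x * (1 + ln \<rho> + real (j x)) ^ (?d - 1))" for x
  proof -
    define l where "l = 1 + ln \<rho> + real (j x)"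
    have "ln (\<rho> / r x) = ln \<rho> + real (j x)"
      using \<rho>0 by (simp add: r_def ln_div)
    then have l: "l = 1 + ln (\<rho> / r x)" by (simp add: l_def)
    \<comment> \<open>\<open>\<rho> \<ge> exp 1\<close> gives \<open>l \<ge> 2\<close>, hence
      \<open>1 - 1 / l \<ge> 1 / 2\<close>. In this part it is the extra factor 2 in
      \<open>2 ^ (?d + 1)\<close>.\<close>
    have "1 \<le> ln \<rho>" using \<rho> \<rho>0 by (subst ln_ge_iff) auto
    then have l2: "l \<ge> 2" by (simp add: l_def)
    define I where "I = (LINT y|lborel. indicator (cball x (r x)) y * \<bar>u y\<bar> ^ ?d)"
    have Ii: "integrable lborel (\<lambda>y. indicator (cball x (r x)) y * \<bar>u y\<bar> ^ ?d)"
      using integrable_mult_indicator[OF _ ui, of "cball x (r x)"] by simp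
    have I0: "I \<ge> 0" unfolding I_def by (intro Bochner_Integration.integral_nonneg) auto
    have Im[measurable]: "(\<lambda>y. indicator (cball x (r x)) y * \<bar>u y\<bar> ^ ?d) \<in> borel_measurable borel"
      using borel_measurable_integrable[OF Ii] by simp
    have "A2 x = (\<integral>\<^sup>+z. ennreal (c x) * ennreal (indicator (cball x (r x)) (z + x) * \<bar>u (z + x)\<bar> ^ ?d) \<partial>lborel)"
      unfolding A2_def using c[of x]
      by (intro nn_integral_cong) (auto simp: ennreal_mult indicator_def dist_norm add.commute)
    also have "\<dots> = ennreal (c x) * (\<integral>\<^sup>+z. ennreal (indicator (cball x (r x)) (z + x) * \<bar>u (z + x)\<bar> ^ ?d) \<partial>lborel)"
      by (rule nn_integral_cmult) (use measurable_compose[OF _ Im, of "\<lambda>z. z + x" lborel] in simp)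
    also have "(\<integral>\<^sup>+z. ennreal (indicator (cball x (r x)) (z + x) * \<bar>u (z + x)\<bar> ^ ?d) \<partial>lborel)
        = (\<integral>\<^sup>+y. ennreal (indicator (cball x (r x)) y * \<bar>u y\<bar> ^ ?d) \<partial>lborel)"
      by (rule nn_integral_lborel_shift) measurable
    also have "\<dots> = ennreal I"
      unfolding I_def by (rule nn_integral_eq_integral[OF Ii]) auto
    finally have A2: "A2 x = ennreal (c x * I)" using c[of x] I0 by (simp add: ennreal_mult)
    have "real ?d * (1 - 1 / l) * I \<le> r x ^ ?d * l ^ (?d - 1) * N"
      unfolding I_def N_def using r[of x] \<rho>0 by (intro logarithmic_capacity[OF d u _ _ l]) auto
    moreover have "real ?d * (1 / 2) * I \<le> real ?d * (1 - 1 / l) * I"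
      using l2 I0 by (intro mult_right_mono mult_left_mono) (auto simp: field_simps)
    ultimately have "real ?d * (1 / 2) * I \<le> r x ^ ?d * l ^ (?d - 1) * N" by (rule order_trans[rotated])
    then have I1: "I \<le> 2 * r x ^ ?d * l ^ (?d - 1) * N / real ?d"
      by (simp add: pos_le_divide_eq mult_ac)
    have "c x * I \<le> c x * (2 * r x ^ ?d * l ^ (?d - 1) * N / real ?d)"
      using I1 c[of x] by (rule mult_left_mono)
    also have "\<dots> = 2 ^ (?d + 1) / (real ?d * \<beta>) * N * (T x * l ^ (?d - 1))"
      using r[of x] \<beta> by (simp add: c_def mult_ac)
    finally show ?thesis
      unfolding A2 l_def[symmetric] using N \<beta> T(1)[of x] l2 by (simp add: ennreal_mult[symmetric] ennreal_leI)
  qed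
  have step3: "(\<integral>\<^sup>+x. A1 x \<partial>lborel) \<le> ennreal (2 ^ (?d + 1) * G)"
  proof -
    \<comment> \<open>The radius depends on \<open>x\<close>, so the translation estimate does not
      apply for a fixed \<open>z\<close>. \<open>b i\<close> dominates the kernel where
      \<open>j x = i\<close>, and summing over all \<open>i\<close> removes \<open>x\<close> from
      the radius.\<close>
    define b where "b i z = 2 ^ ?d / \<beta> * (exp (real i) * exp (real i) ^ ?d) * (if norm z \<le> exp (- real i) then 1 else 0)" for i :: nat and z :: 'a
    have [measurable]: "b i \<in> borel_measurable borel" for i unfolding b_def by measurable
    have b: "b i z \<ge> 0" for i z unfolding b_def using \<beta> by simp
    have "A1 x \<le> (\<integral>\<^sup>+z. (\<Sum>i. ennreal (b i z * \<bar>u (x + z) - u x\<bar> ^ ?d)) \<partial>lborel)" for x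
      unfolding A1_def
    proof (rule nn_integral_mono)
      fix z
      have "c x * (if norm z \<le> r x then \<bar>u (x + z) - u x\<bar> ^ ?d else 0) \<le> b (j x) z * \<bar>u (x + z) - u x\<bar> ^ ?d"
      proof -
        have e: "1 / r x ^ ?d = exp (real (j x)) ^ ?d" by (simp add: r_def exp_minus power_inverse divide_inverse)
        have "c x = 2 ^ ?d / \<beta> * (T x * (1 / r x ^ ?d))" by (simp add: c_def)
        also have "\<dots> \<le> 2 ^ ?d / \<beta> * (exp (real (j x)) * exp (real (j x)) ^ ?d)"
          unfolding e using T(2)[of x] \<beta> by (intro mult_left_mono mult_right_mono) auto
        finally have "c x * \<bar>u (x + z) - u x\<bar> ^ ?d \<le> 2 ^ ?d / \<beta> * (exp (real (j x)) * exp (real (j x)) ^ ?d) * \<bar>u (x + z) - u x\<bar> ^ ?d"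
          by (rule mult_right_mono) simp
        then show ?thesis by (simp add: b_def r_def)
      qed
      then have "ennreal (c x * (if norm z \<le> r x then \<bar>u (x + z) - u x\<bar> ^ ?d else 0)) \<le> ennreal (b (j x) z * \<bar>u (x + z) - u x\<bar> ^ ?d)"
        by (rule ennreal_leI)
      also have "\<dots> = (\<Sum>i\<in>{j x}. ennreal (b i z * \<bar>u (x + z) - u x\<bar> ^ ?d))" by simp
      also have "\<dots> \<le> (\<Sum>i. ennreal (b i z * \<bar>u (x + z) - u x\<bar> ^ ?d))"
        by (rule sum_le_suminf) auto
      finally show "ennreal (c x * (if norm z \<le> r x then \<bar>u (x + z) - u x\<bar> ^ ?d else 0)) \<le> (\<Sum>i. ennreal (b i z * \<bar>u (x + z) - u x\<bar> ^ ?d))" .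
    qed
    then have "(\<integral>\<^sup>+x. A1 x \<partial>lborel) \<le> (\<integral>\<^sup>+x. (\<integral>\<^sup>+z. (\<Sum>i. ennreal (b i z * \<bar>u (x + z) - u x\<bar> ^ ?d)) \<partial>lborel) \<partial>lborel)"
      by (intro nn_integral_mono)
    also have "\<dots> = (\<Sum>i. \<integral>\<^sup>+x. (\<integral>\<^sup>+z. ennreal (b i z * \<bar>u (x + z) - u x\<bar> ^ ?d) \<partial>lborel) \<partial>lborel)"
      by (simp add: nn_integral_suminf)
    also have "\<dots> \<le> (\<Sum>i. ennreal (2 ^ ?d * G * (1 / 2) ^ i))"
    proof (intro suminf_le allI)
      fix i :: nat
      have "(\<integral>\<^sup>+x. (\<integral>\<^sup>+z. ennreal (b i z * \<bar>u (x + z) - u x\<bar> ^ ?d) \<partial>lborel) \<partial>lborel) =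
         (\<integral>\<^sup>+z. (\<integral>\<^sup>+x. ennreal (b i z * \<bar>u (x + z) - u x\<bar> ^ ?d) \<partial>lborel) \<partial>lborel)"
        by (rule lborel_pair.Fubini'[symmetric]) measurable
      also have "\<dots> \<le> (\<integral>\<^sup>+z. ennreal (2 ^ ?d / \<beta> * (exp (real i) * G)) * indicator (cball 0 (exp (- real i))) z \<partial>(lborel::'a measure))"
      proof (rule nn_integral_mono)
        fix z :: 'a
        have "(\<integral>\<^sup>+x. ennreal (b i z * \<bar>u (x + z) - u x\<bar> ^ ?d) \<partial>lborel) = ennreal (b i z) * (\<integral>\<^sup>+x. ennreal (\<bar>u (x + z) - u x\<bar> ^ ?d) \<partial>lborel)"
          using b[of i z] by (simp add: ennreal_mult nn_integral_cmult)
        also have "\<dots> \<le> ennreal (b i z) * (ennreal (norm z ^ ?d) * ennreal G)"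
          using translation_estimate[OF wg, of ?d z] d by (intro mult_left_mono) (auto simp: G(2))
        also have "\<dots> = ennreal (b i z * norm z ^ ?d * G)"
          using b[of i z] G(1) by (simp add: ennreal_mult mult.assoc)
        also have "\<dots> \<le> ennreal (2 ^ ?d / \<beta> * (exp (real i) * G)) * indicator (cball 0 (exp (- real i))) z"
        proof (cases "norm z \<le> exp (- real i)")
          case True
          have "exp (real i) ^ ?d * norm z ^ ?d \<le> exp (real i) ^ ?d * exp (- real i) ^ ?d"
            using True by (intro mult_left_mono power_mono) auto
          also have "\<dots> = 1" by (simp add: power_mult_distrib[symmetric] exp_minus)
          finally have "2 ^ ?d / \<beta> * exp (real i) * G * (exp (real i) ^ ?d * norm z ^ ?d) \<le> 2 ^ ?d / \<beta> * exp (real i) * G * 1"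
            using \<beta> G(1) by (intro mult_left_mono) auto
          then show ?thesis using True by (simp add: b_def mult_ac ennreal_leI)
        qed (simp add: b_def)
        finally show "(\<integral>\<^sup>+x. ennreal (b i z * \<bar>u (x + z) - u x\<bar> ^ ?d) \<partial>lborel)
          \<le> ennreal (2 ^ ?d / \<beta> * (exp (real i) * G)) * indicator (cball 0 (exp (- real i))) z" .
      qed
      also have "\<dots> = ennreal (2 ^ ?d / \<beta> * (exp (real i) * G)) * ennreal (\<beta> * exp (- real i) ^ ?d)"
        by (simp add: nn_integral_cmult_indicator emeasure_cball \<beta>_def)
      also have "\<dots> = ennreal (2 ^ ?d * G * (exp (real i) * exp (- real i) ^ ?d))"
        using \<beta> G(1) by (simp add: ennreal_mult[symmetric] mult_ac)
      also have "\<dots> \<le> ennreal (2 ^ ?d * G * (1 / 2) ^ i)"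
      proof -
        \<comment> \<open>The powers of \<open>norm z\<close> have cancelled the normalisation of
          the average. What remains is \<open>exp i\<close> from the weight and
          \<open>exp (- i)\<close> to the power \<open>?d\<close> from the volume; as the dimension
          is at least 2, the product is at most \<open>exp (- i)\<close> and the series over
          \<open>i\<close> is geometric.\<close>
        have "exp (- real i) ^ ?d \<le> exp (- real i) ^ 2"
          using d by (intro power_decreasing) auto
        then have "exp (real i) * exp (- real i) ^ ?d \<le> exp (real i) * exp (- real i) ^ 2"
          by (intro mult_left_mono) auto
        also have "\<dots> = exp (- real i)"
          by (simp add: power2_eq_square mult.assoc[symmetric] exp_add[symmetric])
        also have "\<dots> = exp (- 1) ^ i"
          using exp_of_nat_mult[of i "- 1 :: real"] by simp
        also have "\<dots> \<le> (1 / 2) ^ i"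
        proof (rule power_mono)
          have "exp (1::real) \<ge> 2" using exp_ge_add_one_self[of "1::real"] by simp
          then show "exp (- 1) \<le> (1 / 2 :: real)" by (simp add: exp_minus field_simps)
        qed simp
        finally show ?thesis using G(1) by (intro ennreal_leI mult_left_mono) auto
      qed
      finally show "(\<integral>\<^sup>+x. (\<integral>\<^sup>+z. ennreal (b i z * \<bar>u (x + z) - u x\<bar> ^ ?d) \<partial>lborel) \<partial>lborel) \<le> ennreal (2 ^ ?d * G * (1 / 2) ^ i)" .
    qed auto
    also have "\<dots> = ennreal (2 ^ ?d * G * 2)"
    proof (rule suminf_ennreal_eq)
      have "(\<lambda>i. (1 / 2 :: real) ^ i) sums (1 / (1 - 1 / 2))" by (rule geometric_sums) simp
      then show "(\<lambda>i. 2 ^ ?d * G * (1 / 2) ^ i) sums (2 ^ ?d * G * 2)" by (intro sums_mult) simp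
    qed (use G(1) in auto)
    finally show ?thesis by (simp add: mult_ac)
  qed
  have A1m: "A1 \<in> borel_measurable lborel" unfolding A1_def by measurable
  have A2m: "A2 \<in> borel_measurable lborel" unfolding A2_def by measurable
  have "(\<integral>\<^sup>+x. ennreal (T x * \<bar>u x\<bar> ^ ?d) \<partial>lborel) \<le> (\<integral>\<^sup>+x. A1 x + A2 x \<partial>lborel)"
    by (intro nn_integral_mono step1)
  also have "\<dots> = (\<integral>\<^sup>+x. A1 x \<partial>lborel) + (\<integral>\<^sup>+x. A2 x \<partial>lborel)"
    by (rule nn_integral_add[OF A1m A2m])
  also have "\<dots> \<le> ennreal (2 ^ (?d + 1) * G) + (\<integral>\<^sup>+x. ennreal (2 ^ (?d + 1) / (real ?d * \<beta>) * N) * ennreal (T x * (1 + ln \<rho> + real (j x)) ^ (?d - 1)) \<partial>lborel)"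
    by (intro add_mono step3 nn_integral_mono step2)
  also have "(\<integral>\<^sup>+x. ennreal (2 ^ (?d + 1) / (real ?d * \<beta>) * N) * ennreal (T x * (1 + ln \<rho> + real (j x)) ^ (?d - 1)) \<partial>lborel)
     = ennreal (2 ^ (?d + 1) / (real ?d * \<beta>) * N) * (\<integral>\<^sup>+x. ennreal (T x * (1 + ln \<rho> + real (j x)) ^ (?d - 1)) \<partial>lborel)"
    by (rule nn_integral_cmult) measurable
  finally show ?thesis unfolding G_def .
qed

text \<open>The value of \<open>\<bar>u\<bar> ^ DIM('a)\<close> at \<open>x\<close> is replaced by
  its mean over the ball of radius \<open>P\<close>. This costs a relative error
  \<open>\<delta>\<close> and a multiple of the same power of \<open>\<bar>u x - u z\<bar>\<close>,
  whose double integral over the ball is controlled by the gradient through the translation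
  estimate. \<open>C\<close> does not depend on \<open>u\<close>.\<close>

lemma bounded_weight_bound:
  fixes V :: "'a::euclidean_space \<Rightarrow> real"
  assumes d: "DIM('a) \<ge> 2" and [measurable]: "V \<in> borel_measurable borel"
    and V: "\<And>x. \<bar>V x\<bar> \<le> M" "\<And>x. norm x > P \<Longrightarrow> V x = 0" and P: "P > 0" and \<delta>: "\<delta> > 0"
  obtains C where "C \<ge> 0"
    "\<And>u g. sobolev_pair DIM('a) u g \<Longrightarrow> integrable lborel (\<lambda>x. V x * \<bar>u x\<bar> ^ DIM('a))"
    "\<And>u g. sobolev_pair DIM('a) u g \<Longrightarrow>
      (LINT x|lborel. V x * \<bar>u x\<bar> ^ DIM('a)) \<le>
      ((LINT x|lborel. V x) + \<delta> * (LINT x|lborel. \<bar>V x\<bar>)) * (LINT x|lborel. indicator (cball 0 P) x * \<bar>u x\<bar> ^ DIM('a))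
         / (unit_ball_vol (real DIM('a)) * P ^ DIM('a))
      + C * (LINT x|lborel. norm (g x) ^ DIM('a))"
proof -
  let ?d = "DIM('a)"
  obtain C where C: "C > 0" "\<And>a b::real. \<bar>\<bar>b\<bar> ^ ?d - \<bar>a\<bar> ^ ?d\<bar> \<le> \<delta> * \<bar>a\<bar> ^ ?d + C * \<bar>b - a\<bar> ^ ?d"
    using power_diff_le_perturbed[OF \<delta>] by metis
  define \<beta> where "\<beta> = unit_ball_vol (real ?d)"
  have \<beta>: "\<beta> > 0" by (simp add: \<beta>_def)
  have M: "M \<ge> 0" using V(1)[of 0] by linarith
  define vol where "vol = \<beta> * P ^ ?d"
  have vol: "vol > 0" using \<beta> P by (simp add: vol_def)
  define B where "B = cball (0::'a) P"
  have [measurable]: "B \<in> sets borel" by (simp add: B_def)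
  have Bi: "integrable lborel (indicator B :: 'a \<Rightarrow> real)" "(LINT x|lborel. indicator B x) = vol"
    using P emeasure_cball[OF less_imp_le[OF P], of "0::'a"] content_cball[of P "0::'a"]
    by (auto simp: B_def vol_def \<beta>_def intro!: integrable_real_indicator)
  \<comment> \<open>One factor \<open>(2 * P) ^ ?d\<close> belongs to the volume of the ball of
    possible differences \<open>h = z - x\<close>, the other bounds the factor
    \<open>norm h ^ ?d\<close> of the translation estimate.\<close>
  define D where "D = C * M * (\<beta> * (2 * P) ^ ?d * (2 * P) ^ ?d) / vol"
  have D: "D \<ge> 0" unfolding D_def using C(1) M \<beta> P vol by simp
  have Vi: "integrable lborel V"
  proof (rule Bochner_Integration.integrable_bound)
    show "integrable lborel (\<lambda>x. indicator B x * M)" using Bi(1) by (rule integrable_mult_left)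
    show "AE x in lborel. norm (V x) \<le> norm (indicator B x * M)"
      using V M by (intro AE_I2) (auto simp: B_def indicator_def)
  qed simp
  have main: "integrable lborel (\<lambda>x. V x * \<bar>u x\<bar> ^ ?d) \<and> (LINT x|lborel. V x * \<bar>u x\<bar> ^ ?d) \<le>
      ((LINT x|lborel. V x) + \<delta> * (LINT x|lborel. \<bar>V x\<bar>)) * (LINT x|lborel. indicator (cball 0 P) x * \<bar>u x\<bar> ^ ?d) / vol
      + D * (LINT x|lborel. norm (g x) ^ ?d)" if u: "sobolev_pair ?d u g" for u g
  proof -
    have wg: "borel_weak_gradient u g" and ui: "integrable lborel (\<lambda>x. \<bar>u x\<bar> ^ ?d)"
      and gi: "integrable lborel (\<lambda>x. norm (g x) ^ ?d)"
      using u by (auto simp: sobolev_pair_def)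
    have [measurable]: "u \<in> borel_measurable borel" "g \<in> borel_measurable borel"
      using wg by (auto simp: borel_weak_gradient_def)
    define G where "G = (LINT x|lborel. norm (g x) ^ ?d)"
    have G: "G \<ge> 0" "(\<integral>\<^sup>+x. ennreal (norm (g x) ^ ?d) \<partial>lborel) = ennreal G"
      unfolding G_def using gi by (auto intro!: nn_integral_eq_integral Bochner_Integration.integral_nonneg)
    have Vui: "integrable lborel (\<lambda>x. V x * \<bar>u x\<bar> ^ ?d)"
    proof (rule Bochner_Integration.integrable_bound)
      show "integrable lborel (\<lambda>x. M * \<bar>u x\<bar> ^ ?d)" using ui by (rule integrable_mult_right)
      show "AE x in lborel. norm (V x * \<bar>u x\<bar> ^ ?d) \<le> norm (M * \<bar>u x\<bar> ^ ?d)"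
        using V(1) M by (intro AE_I2) (auto simp: abs_mult power_abs intro!: mult_right_mono)
    qed measurable
    define I where "I = (LINT z|lborel. indicator B z * \<bar>u z\<bar> ^ ?d)"
    have Ii: "integrable lborel (\<lambda>z. indicator B z * \<bar>u z\<bar> ^ ?d)"
      using integrable_mult_indicator[OF _ ui, of B] by simp
    define rm where "rm x = (LINT z|lborel. indicator B z * \<bar>u x - u z\<bar> ^ ?d)" for x
    have rmi: "integrable lborel (\<lambda>z. indicator B z * \<bar>u x - u z\<bar> ^ ?d)" for x
    proof (rule Bochner_Integration.integrable_bound)
      show "integrable lborel (\<lambda>z. 2 ^ ?d * (indicator B z * \<bar>u x\<bar> ^ ?d + indicator B z * \<bar>u z\<bar> ^ ?d))"
        using Ii Bi(1) by (intro integrable_mult_right Bochner_Integration.integrable_add integrable_mult_left)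
      show "AE z in lborel. norm (indicator B z * \<bar>u x - u z\<bar> ^ ?d) \<le> norm (2 ^ ?d * (indicator B z * \<bar>u x\<bar> ^ ?d + indicator B z * \<bar>u z\<bar> ^ ?d))"
      proof (rule AE_I2)
        fix z
        have "\<bar>u x - u z\<bar> ^ ?d \<le> 2 ^ ?d * (\<bar>u x\<bar> ^ ?d + \<bar>u z\<bar> ^ ?d)"
          using abs_power_le_double[of "u x - u z" ?d "- u z"] by simp
        then show "norm (indicator B z * \<bar>u x - u z\<bar> ^ ?d) \<le> norm (2 ^ ?d * (indicator B z * \<bar>u x\<bar> ^ ?d + indicator B z * \<bar>u z\<bar> ^ ?d))"
          by (auto simp: indicator_def)
      qed
    qed measurable
    have rm0: "rm x \<ge> 0" for x unfolding rm_def by (intro Bochner_Integration.integral_nonneg) auto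
    have [measurable]: "rm \<in> borel_measurable borel" unfolding rm_def by measurable
    \<comment> \<open>The comparison of \<open>u x\<close> with \<open>u z\<close> is integrated
      over \<open>z\<close> in the ball; the factor \<open>vol\<close> on the left comes from the
      term that does not involve \<open>z\<close>.\<close>
    have pw: "vol * (V x * \<bar>u x\<bar> ^ ?d) \<le> I * V x + \<delta> * I * \<bar>V x\<bar> + C * (\<bar>V x\<bar> * rm x)" for x
    proof -
      have "vol * (V x * \<bar>u x\<bar> ^ ?d) - I * V x = (LINT z|lborel. V x * \<bar>u x\<bar> ^ ?d * indicator B z - V x * (indicator B z * \<bar>u z\<bar> ^ ?d))"
        using Bi Ii by (simp add: I_def mult_ac)
      also have "\<dots> \<le> (LINT z|lborel. \<bar>V x\<bar> * (\<delta> * (indicator B z * \<bar>u z\<bar> ^ ?d) + C * (indicator B z * \<bar>u x - u z\<bar> ^ ?d)))"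
      proof (rule integral_mono)
        show "integrable lborel (\<lambda>z. V x * \<bar>u x\<bar> ^ ?d * indicator B z - V x * (indicator B z * \<bar>u z\<bar> ^ ?d))"
          using Bi Ii by auto
        show "integrable lborel (\<lambda>z. \<bar>V x\<bar> * (\<delta> * (indicator B z * \<bar>u z\<bar> ^ ?d) + C * (indicator B z * \<bar>u x - u z\<bar> ^ ?d)))"
          using Ii rmi[of x] by auto
        fix z
        have "V x * (\<bar>u x\<bar> ^ ?d - \<bar>u z\<bar> ^ ?d) \<le> \<bar>V x\<bar> * \<bar>\<bar>u x\<bar> ^ ?d - \<bar>u z\<bar> ^ ?d\<bar>"
          by (simp add: abs_mult[symmetric])
        also have "\<dots> \<le> \<bar>V x\<bar> * (\<delta> * \<bar>u z\<bar> ^ ?d + C * \<bar>u x - u z\<bar> ^ ?d)"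
          by (intro mult_left_mono C(2)) auto
        finally have "V x * (\<bar>u x\<bar> ^ ?d - \<bar>u z\<bar> ^ ?d) \<le> \<bar>V x\<bar> * (\<delta> * \<bar>u z\<bar> ^ ?d + C * \<bar>u x - u z\<bar> ^ ?d)" .
        then show "V x * \<bar>u x\<bar> ^ ?d * indicator B z - V x * (indicator B z * \<bar>u z\<bar> ^ ?d)
           \<le> \<bar>V x\<bar> * (\<delta> * (indicator B z * \<bar>u z\<bar> ^ ?d) + C * (indicator B z * \<bar>u x - u z\<bar> ^ ?d))"
          by (auto simp: indicator_def right_diff_distrib)
      qed
      also have "\<dots> = \<bar>V x\<bar> * (\<delta> * I + C * rm x)"
        using Ii rmi[of x] by (simp add: I_def rm_def)
      finally show ?thesis by (simp add: algebra_simps)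
    qed
    define K where "K = \<beta> * (2 * P) ^ ?d * (2 * P) ^ ?d * G"
    have K0: "K \<ge> 0" unfolding K_def using \<beta> P G by simp
    have nn: "(\<integral>\<^sup>+x. ennreal (\<bar>V x\<bar> * rm x) \<partial>lborel) \<le> ennreal (M * K)"
    proof -
      have "ennreal (\<bar>V x\<bar> * rm x) \<le> (\<integral>\<^sup>+h. ennreal (M * ((if norm h \<le> 2 * P then 1 else 0) * \<bar>u (x + h) - u x\<bar> ^ ?d)) \<partial>lborel)" for x
      proof (cases "norm x \<le> P")
        case True
        have "ennreal (\<bar>V x\<bar> * rm x) \<le> ennreal (M * rm x)"
          using V(1)[of x] rm0[of x] by (intro ennreal_leI mult_right_mono)
        also have "\<dots> = ennreal M * (\<integral>\<^sup>+z. ennreal (indicator B z * \<bar>u x - u z\<bar> ^ ?d) \<partial>lborel)"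
          unfolding rm_def using M rm0[of x] by (subst nn_integral_eq_integral[OF rmi]) (auto simp: ennreal_mult rm_def)
        also have "\<dots> = (\<integral>\<^sup>+z. ennreal (M * (indicator B z * \<bar>u x - u z\<bar> ^ ?d)) \<partial>lborel)"
          using M by (simp add: nn_integral_cmult[symmetric] ennreal_mult)
        also have "\<dots> = (\<integral>\<^sup>+h. ennreal (M * (indicator B (h + x) * \<bar>u x - u (h + x)\<bar> ^ ?d)) \<partial>lborel)"
          by (rule nn_integral_lborel_shift[symmetric]) measurable
        also have "\<dots> \<le> (\<integral>\<^sup>+h. ennreal (M * ((if norm h \<le> 2 * P then 1 else 0) * \<bar>u (x + h) - u x\<bar> ^ ?d)) \<partial>lborel)"
        proof (intro nn_integral_mono ennreal_leI mult_left_mono M)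
          fix h
          have "norm h \<le> 2 * P" if "norm (h + x) \<le> P"
            using that True norm_triangle_ineq4[of "h + x" x] by simp
          then show "indicator B (h + x) * \<bar>u x - u (h + x)\<bar> ^ ?d \<le> (if norm h \<le> 2 * P then 1 else 0) * \<bar>u (x + h) - u x\<bar> ^ ?d"
            by (auto simp: B_def indicator_def add.commute abs_minus_commute)
        qed
        finally show ?thesis .
      qed (simp add: V(2))
      then have "(\<integral>\<^sup>+x. ennreal (\<bar>V x\<bar> * rm x) \<partial>lborel) \<le>
        (\<integral>\<^sup>+x. (\<integral>\<^sup>+h. ennreal (M * ((if norm h \<le> 2 * P then 1 else 0) * \<bar>u (x + h) - u x\<bar> ^ ?d)) \<partial>lborel) \<partial>lborel)"
        by (intro nn_integral_mono)
      also have "\<dots> = (\<integral>\<^sup>+h. (\<integral>\<^sup>+x. ennreal (M * ((if norm h \<le> 2 * P then 1 else 0) * \<bar>u (x + h) - u x\<bar> ^ ?d)) \<partial>lborel) \<partial>lborel)"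
        by (rule lborel_pair.Fubini'[symmetric]) measurable
      also have "\<dots> \<le> (\<integral>\<^sup>+h. ennreal (M * ((2 * P) ^ ?d * G)) * indicator (cball 0 (2 * P)) h \<partial>(lborel::'a measure))"
      proof (rule nn_integral_mono)
        fix h :: 'a
        show "(\<integral>\<^sup>+x. ennreal (M * ((if norm h \<le> 2 * P then 1 else 0) * \<bar>u (x + h) - u x\<bar> ^ ?d)) \<partial>lborel) \<le> ennreal (M * ((2 * P) ^ ?d * G)) * indicator (cball 0 (2 * P)) h"
        proof (cases "norm h \<le> 2 * P")
          case True
          have "(\<integral>\<^sup>+x. ennreal (M * ((if norm h \<le> 2 * P then 1 else 0) * \<bar>u (x + h) - u x\<bar> ^ ?d)) \<partial>lborel)
             = ennreal M * (\<integral>\<^sup>+x. ennreal (\<bar>u (x + h) - u x\<bar> ^ ?d) \<partial>lborel)"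
            using True M by (simp add: ennreal_mult nn_integral_cmult)
          also have "\<dots> \<le> ennreal M * (ennreal (norm h ^ ?d) * ennreal G)"
            using translation_estimate[OF wg, of ?d h] d by (intro mult_left_mono) (auto simp: G(2))
          also have "\<dots> \<le> ennreal M * (ennreal ((2 * P) ^ ?d) * ennreal G)"
            using True by (intro mult_left_mono mult_right_mono ennreal_leI power_mono) auto
          finally show ?thesis using True M G(1) P by (simp add: ennreal_mult[symmetric])
        qed simp
      qed
      also have "\<dots> = ennreal (M * ((2 * P) ^ ?d * G)) * ennreal (\<beta> * (2 * P) ^ ?d)"
        using P by (simp add: nn_integral_cmult_indicator emeasure_cball \<beta>_def)
      also have "\<dots> = ennreal (M * K)"
        using M G(1) P \<beta> by (simp add: K_def ennreal_mult[symmetric] mult_ac)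
      finally show ?thesis .
    qed
    have Vri: "integrable lborel (\<lambda>x. \<bar>V x\<bar> * rm x)"
      using nn rm0 by (intro integrableI_nonneg) (auto simp: le_less_trans)
    have "ennreal (LINT x|lborel. \<bar>V x\<bar> * rm x) \<le> ennreal (M * K)"
      using nn nn_integral_eq_integral[OF Vri] rm0 by simp
    then have Vr: "(LINT x|lborel. \<bar>V x\<bar> * rm x) \<le> M * K"
      using M K0 by simp
    have "vol * (LINT x|lborel. V x * \<bar>u x\<bar> ^ ?d) = (LINT x|lborel. vol * (V x * \<bar>u x\<bar> ^ ?d))" by simp
    also have "\<dots> \<le> (LINT x|lborel. I * V x + \<delta> * I * \<bar>V x\<bar> + C * (\<bar>V x\<bar> * rm x))"
      using Vui Vi Vri by (intro integral_mono pw) auto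
    also have "\<dots> = I * (LINT x|lborel. V x) + \<delta> * I * (LINT x|lborel. \<bar>V x\<bar>) + C * (LINT x|lborel. \<bar>V x\<bar> * rm x)"
      using Vi Vri by simp
    also have "\<dots> \<le> I * (LINT x|lborel. V x) + \<delta> * I * (LINT x|lborel. \<bar>V x\<bar>) + C * (M * K)"
      using Vr C(1) by simp
    finally have "(LINT x|lborel. V x * \<bar>u x\<bar> ^ ?d) \<le> (I * (LINT x|lborel. V x) + \<delta> * I * (LINT x|lborel. \<bar>V x\<bar>) + C * (M * K)) / vol"
      using vol by (simp add: field_simps)
    also have "\<dots> = ((LINT x|lborel. V x) + \<delta> * (LINT x|lborel. \<bar>V x\<bar>)) * I / vol + D * G"
      by (simp add: D_def K_def add_divide_distrib algebra_simps)
    finally show ?thesis using Vui by (simp add: I_def B_def G_def)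
  qed
  show ?thesis
    by (rule that[of D]) (use D main in \<open>auto simp: vol_def \<beta>_def\<close>)
qed

section \<open>The lower bound for the ground state energy\<close>

lemma sobolev_energy_nonneg: "\<rho> > 0 \<Longrightarrow> 0 \<le> sobolev_energy p \<rho> u g"
  unfolding sobolev_energy_def
  by (intro add_nonneg_nonneg mult_nonneg_nonneg Bochner_Integration.integral_nonneg) auto

text \<open>Here \<open>q > 1\<close> is spent: a logarithm is bounded by any small power, so with
  \<open>t = max 1 \<bar>V x\<bar>\<close> the weight \<open>(1 + real (j x)) ^ n\<close> is at most
  a constant times \<open>t powr (q - 1)\<close>.\<close>

lemma log_weight_integrable:
  fixes V :: "'a::euclidean_space \<Rightarrow> real"
  assumes [measurable]: "V \<in> borel_measurable borel" and V: "integrable lborel V"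
    and Vq: "integrable lborel (\<lambda>x. \<bar>V x\<bar> powr q)" and q: "q > 1"
  obtains j :: "'a \<Rightarrow> nat" where "j \<in> borel \<rightarrow>\<^sub>M count_space UNIV" "\<And>x. \<bar>V x\<bar> \<le> exp (real (j x))"
    "integrable lborel (\<lambda>x. \<bar>V x\<bar> * (1 + real (j x)) ^ n)"
proof -
  define j where "j x = nat \<lceil>ln (max 1 \<bar>V x\<bar>)\<rceil>" for x
  have [measurable]: "j \<in> borel \<rightarrow>\<^sub>M count_space UNIV" unfolding j_def by measurable
  \<comment> \<open>\<open>Suc n\<close> copies of the exponent \<open>a\<close> add up to
    \<open>q - 1\<close>; the successor keeps the denominator positive for
    \<open>n = 0\<close>.\<close>
  define a where "a = (q - 1) / real (Suc n)"
  have a: "a > 0" unfolding a_def using q by simp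
  define C where "C = (2 + 1 / a) ^ Suc n"
  have C: "C \<ge> 0" unfolding C_def using a by (intro zero_le_power) simp
  have bd: "\<bar>V x\<bar> * (1 + real (j x)) ^ n \<le> C * (\<bar>V x\<bar> + \<bar>V x\<bar> powr q)" for x
  proof -
    define t where "t = max 1 \<bar>V x\<bar>"
    have t: "t \<ge> 1" by (simp add: t_def)
    then have "0 \<le> ln t" by simp
    then have "real (j x) = real_of_int \<lceil>ln t\<rceil>"
      unfolding j_def t_def[symmetric] by simp
    then have "real (j x) \<le> ln t + 1"
      using of_int_ceiling_le_add_one[of "ln t"] by simp
    moreover have "ln t \<le> t powr a / a" by (rule ln_powr_bound[OF t a])
    moreover have "1 \<le> t powr a" using t a by (simp add: ge_one_powr_ge_zero)
    ultimately have le: "1 + real (j x) \<le> (2 + 1 / a) * t powr a"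
      by (simp add: distrib_right)
    have "(1 + real (j x)) ^ n \<le> (1 + real (j x)) ^ Suc n" by (intro power_increasing) auto
    also have "\<dots> \<le> ((2 + 1 / a) * t powr a) ^ Suc n" using le by (intro power_mono) auto
    also have "\<dots> = C * (t powr a) ^ Suc n"
      unfolding C_def by (rule power_mult_distrib)
    also have "(t powr a) ^ Suc n = t powr (q - 1)"
      using t by (simp only: powr_power[of t a "Suc n"]) (simp add: a_def)
    finally have "\<bar>V x\<bar> * (1 + real (j x)) ^ n \<le> \<bar>V x\<bar> * (C * t powr (q - 1))"
      by (rule mult_left_mono) simp
    also have "\<bar>V x\<bar> * (C * t powr (q - 1)) = C * (\<bar>V x\<bar> * t powr (q - 1))" by simp
    also have "\<bar>V x\<bar> * t powr (q - 1) \<le> \<bar>V x\<bar> + \<bar>V x\<bar> powr q"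
    proof (cases "\<bar>V x\<bar> \<le> 1")
      case True
      then show ?thesis by (simp add: t_def)
    next
      case False
      then have "\<bar>V x\<bar> * t powr (q - 1) = \<bar>V x\<bar> powr 1 * \<bar>V x\<bar> powr (q - 1)" by (simp add: t_def max_def)
      also have "\<dots> = \<bar>V x\<bar> powr q" by (subst powr_add[symmetric]) simp
      finally show ?thesis by simp
    qed
    finally show ?thesis using C by (simp add: mult_left_mono)
  qed
  show ?thesis
  proof (rule that[of j])
    fix x
    have "\<bar>V x\<bar> \<le> exp (ln (max 1 \<bar>V x\<bar>))" by (subst exp_ln) auto
    also have "\<dots> \<le> exp (real (j x))" unfolding j_def by (simp only: exp_le_cancel_iff real_nat_ceiling_ge)
    finally show "\<bar>V x\<bar> \<le> exp (real (j x))" .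
  next
    show "integrable lborel (\<lambda>x. \<bar>V x\<bar> * (1 + real (j x)) ^ n)"
    proof (rule Bochner_Integration.integrable_bound)
      show "integrable lborel (\<lambda>x. C * (\<bar>V x\<bar> + \<bar>V x\<bar> powr q))"
        using V Vq by auto
      show "AE x in lborel. norm (\<bar>V x\<bar> * (1 + real (j x)) ^ n) \<le> norm (C * (\<bar>V x\<bar> + \<bar>V x\<bar> powr q))"
        using bd by (intro AE_I2) (auto simp: abs_mult intro!: order_trans[OF bd] mult_right_mono)
    qed measurable
  qed measurable
qed

text \<open>The slack \<open>\<kappa>\<close> is spent in four quarters: on the integral of the
  truncated weight, on the relative error \<open>\<delta>\<close>, on the factor
  \<open>1 - 1 / l\<close> of the capacity bound, and on the unbounded or distant part of
  \<open>V\<close>. The term with \<open>C\<close> carries no logarithm and becomes negligible after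
  multiplication by \<open>\<alpha>\<close>.\<close>

lemma weighted_bound:
  fixes V :: "'a::euclidean_space \<Rightarrow> real"
  assumes d: "DIM('a) \<ge> 2" and [measurable]: "V \<in> borel_measurable borel" and V: "integrable lborel V"
    and Vq: "integrable lborel (\<lambda>x. \<bar>V x\<bar> powr q)" and q: "q > 1"
    and m: "m = (LINT x|lborel. V x)" "m > 0" and \<kappa>: "\<kappa> > 0"
  defines "\<omega> \<equiv> real DIM('a) * unit_ball_vol (real DIM('a))"
  obtains C \<rho>0 where "C \<ge> 0" "\<rho>0 > 1"
    "\<And>\<rho> u g. \<rho> \<ge> \<rho>0 \<Longrightarrow> sobolev_pair DIM('a) u g \<Longrightarrow> integrable lborel (\<lambda>x. V x * \<bar>u x\<bar> ^ DIM('a))"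
    "\<And>\<rho> u g. \<rho> \<ge> \<rho>0 \<Longrightarrow> sobolev_pair DIM('a) u g \<Longrightarrow>
      (LINT x|lborel. V x * \<bar>u x\<bar> ^ DIM('a)) \<le> C * (LINT x|lborel. norm (g x) ^ DIM('a))
        + (m + \<kappa>) / \<omega> * (1 + ln \<rho>) ^ (DIM('a) - 1) * sobolev_energy DIM('a) \<rho> u g"
proof -
  let ?d = "DIM('a)"
  define \<beta> where "\<beta> = unit_ball_vol (real ?d)"
  have \<beta>: "\<beta> > 0" by (simp add: \<beta>_def)
  have \<omega>: "\<omega> = real ?d * \<beta>" "\<omega> > 0" unfolding \<omega>_def using \<beta> by (auto simp: \<beta>_def)
  obtain j :: "'a \<Rightarrow> nat" where j[measurable]: "j \<in> borel \<rightarrow>\<^sub>M count_space UNIV" and jV: "\<And>x. \<bar>V x\<bar> \<le> exp (real (j x))"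
    and Wi: "integrable lborel (\<lambda>x. \<bar>V x\<bar> * (1 + real (j x)) ^ (?d - 1))"
    using log_weight_integrable[OF assms(2) V Vq q, of "?d - 1"] by metis
  define W where "W x = \<bar>V x\<bar> * (1 + real (j x)) ^ (?d - 1)" for x
  have W: "\<bar>V x\<bar> \<le> W x" "W x \<ge> 0" for x
    using mult_left_mono[of 1 "(1 + real (j x)) ^ (?d - 1)" "\<bar>V x\<bar>"] by (auto simp: W_def)
  have [measurable]: "W \<in> borel_measurable borel" unfolding W_def by measurable
  have Wi: "integrable lborel W" using Wi by (simp add: W_def[abs_def])
  \<comment> \<open>\<open>2 ^ (?d + 1)\<close> is the constant of
    \<open>unbounded_weight_bound\<close>; with this \<open>\<eta>\<close> the logarithmic term
    there costs a quarter of \<open>\<kappa>\<close>.\<close>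
  define \<eta> where "\<eta> = \<kappa> / (4 * 2 ^ (?d + 1))"
  have \<eta>: "\<eta> > 0" "2 ^ (?d + 1) * \<eta> = \<kappa> / 4" "\<eta> \<le> \<kappa> / 4"
  proof -
    show "\<eta> > 0" "2 ^ (?d + 1) * \<eta> = \<kappa> / 4" unfolding \<eta>_def using \<kappa> by auto
    then have "1 * \<eta> \<le> 2 ^ (?d + 1) * \<eta>" by (intro mult_right_mono one_le_power) auto
    then show "\<eta> \<le> \<kappa> / 4" using \<open>2 ^ (?d + 1) * \<eta> = \<kappa> / 4\<close> by linarith
  qed
  \<comment> \<open>Indicator of the points where \<open>V\<close> is cut away: far out, or where
    \<open>\<bar>V\<bar>\<close> is large.\<close>
  define out where "out n x = (if norm x \<le> real n \<and> \<bar>V x\<bar> \<le> real n then 0 else 1 :: real)" for n :: nat and x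
  have [measurable]: "out n \<in> borel_measurable borel" for n unfolding out_def by measurable
  have out: "0 \<le> out n x" "out n x \<le> 1" for n x by (auto simp: out_def)
  have "(\<lambda>n. LINT x|lborel. W x * out n x) \<longlonglongrightarrow> integral\<^sup>L (lborel :: 'a measure) (\<lambda>x. 0)"
  proof (rule integral_dominated_convergence[where w=W])
    show "AE x in lborel. (\<lambda>n. W x * out n x) \<longlonglongrightarrow> 0"
    proof (rule AE_I2)
      fix x
      obtain K where K: "max (norm x) \<bar>V x\<bar> \<le> real K" using real_arch_simple by blast
      show "(\<lambda>n. W x * out n x) \<longlonglongrightarrow> 0"
      proof (rule tendsto_eventually, rule eventually_sequentiallyI[of K])
        fix n assume "K \<le> n"
        then have "real K \<le> real n" by simp
        then show "W x * out n x = 0" using K by (auto simp: out_def)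
      qed
    qed
    show "AE x in lborel. norm (W x * out n x) \<le> W x" for n
      using W(2) out by (intro AE_I2) (simp add: abs_mult mult_left_le)
  qed (use Wi in auto)
  then have "\<forall>\<^sub>F n in sequentially. (LINT x|lborel. W x * out n x) < \<eta>"
    using \<eta>(1) by (intro order_tendstoD(2)) auto
  then have "\<forall>\<^sub>F n in sequentially. (LINT x|lborel. W x * out n x) < \<eta> \<and> n \<ge> 1"
    using eventually_ge_at_top[of "1::nat"] by eventually_elim auto
  then obtain n where n: "(LINT x|lborel. W x * out n x) < \<eta>" "n \<ge> 1"
    using eventually_happens'[OF sequentially_bot] by blast
  define P where "P = real n"
  have P: "P \<ge> 1" using n by (simp add: P_def)
  define T where "T x = \<bar>V x\<bar> * out n x" for x
  define Vb where "Vb x = V x * (1 - out n x)" for x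
  have [measurable]: "T \<in> borel_measurable borel" "Vb \<in> borel_measurable borel" unfolding T_def Vb_def by measurable
  have T: "0 \<le> T x" "T x \<le> exp (real (j x))" "T x \<le> W x * out n x" for x
    using out[of n x] jV[of x] W[of x]
    by (auto simp: T_def intro: mult_right_mono order_trans[OF mult_left_le])
  have Woi: "integrable lborel (\<lambda>x. W x * out n x)"
    by (rule Bochner_Integration.integrable_bound[OF Wi])
      (use W(2) out in \<open>auto simp: abs_mult mult_left_le intro!: AE_I2\<close>)
  have Ti: "integrable lborel T"
    by (rule Bochner_Integration.integrable_bound[OF Woi])
      (use T out W in \<open>auto simp: abs_mult intro!: AE_I2\<close>)
  have T\<eta>: "(LINT x|lborel. T x) \<le> \<eta>"
    using integral_mono[OF Ti Woi T(3)] n(1) by linarith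
  have Vbi: "integrable lborel Vb"
    by (rule Bochner_Integration.integrable_bound[OF V])
      (auto simp: Vb_def out_def intro!: AE_I2)
  \<comment> \<open>Only an upper bound for the integral of \<open>Vb\<close> is wanted, and
    \<open>Vb - V \<le> T\<close> pointwise.\<close>
  have "(LINT x|lborel. Vb x) - m = (LINT x|lborel. Vb x - V x)"
    unfolding m using Vbi V by simp
  also have "\<dots> \<le> (LINT x|lborel. T x)"
    by (intro integral_mono Bochner_Integration.integrable_diff Vbi V Ti) (auto simp: Vb_def T_def out_def)
  finally have Vbm: "(LINT x|lborel. Vb x) \<le> m + \<kappa> / 4" using T\<eta> \<eta>(3) by linarith
  define v1 where "v1 = (LINT x|lborel. \<bar>Vb x\<bar>)"
  have v1: "v1 \<ge> 0" unfolding v1_def by (intro Bochner_Integration.integral_nonneg) auto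
  define \<delta> where "\<delta> = (\<kappa> / 4) / (v1 + 1)"
  have \<delta>: "\<delta> > 0" "\<delta> * v1 \<le> \<kappa> / 4"
  proof -
    show "\<delta> > 0" unfolding \<delta>_def using \<kappa> v1 by simp
    then have "\<delta> * v1 \<le> \<delta> * (v1 + 1)" by simp
    also have "\<dots> = \<kappa> / 4" unfolding \<delta>_def using v1 by (intro nonzero_eq_divide_eq[THEN iffD1, OF _ refl]) linarith
    finally show "\<delta> * v1 \<le> \<kappa> / 4" .
  qed
  obtain C where C: "C \<ge> 0"
    "\<And>u g. sobolev_pair ?d u g \<Longrightarrow> integrable lborel (\<lambda>x. Vb x * \<bar>u x\<bar> ^ ?d)"
    "\<And>u g. sobolev_pair ?d u g \<Longrightarrow>
      (LINT x|lborel. Vb x * \<bar>u x\<bar> ^ ?d) \<le>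
      ((LINT x|lborel. Vb x) + \<delta> * (LINT x|lborel. \<bar>Vb x\<bar>)) * (LINT x|lborel. indicator (cball 0 P) x * \<bar>u x\<bar> ^ ?d)
         / (unit_ball_vol (real ?d) * P ^ ?d)
      + C * (LINT x|lborel. norm (g x) ^ ?d)"
  proof (rule bounded_weight_bound[OF d, of Vb P P \<delta>])
    show "\<bar>Vb x\<bar> \<le> P" for x by (simp add: Vb_def out_def P_def)
    show "P < norm x \<Longrightarrow> Vb x = 0" for x by (simp add: Vb_def out_def P_def)
  qed (use P \<delta>(1) in auto)
  \<comment> \<open>Solves \<open>(m + 3 * \<kappa> / 4) * (1 - \<tau>) = m + \<kappa> / 2\<close>,
    so that the loss in the capacity bound raises the weight by a quarter of
    \<open>\<kappa>\<close>.\<close>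
  define \<tau> where "\<tau> = (\<kappa> / 4) / (m + 3 * \<kappa> / 4)"
  have \<tau>: "\<tau> > 0" "\<tau> < 1" "(m + 3 * \<kappa> / 4) * (1 - \<tau>) = m + \<kappa> / 2"
    unfolding \<tau>_def using m(2) \<kappa> by (auto simp: field_simps)
  \<comment> \<open>\<open>exp 1\<close> is what \<open>unbounded_weight_bound\<close> asks for; the
    other entry forces \<open>l > 1 / \<tau>\<close>, that is
    \<open>1 - 1 / l > 1 - \<tau>\<close>.\<close>
  define \<rho>0 where "\<rho>0 = max (exp 1) (P * exp (1 / \<tau>))"
  have main: "integrable lborel (\<lambda>x. V x * \<bar>u x\<bar> ^ ?d) \<and>
      (LINT x|lborel. V x * \<bar>u x\<bar> ^ ?d) \<le> (C + 2 ^ (?d + 1)) * (LINT x|lborel. norm (g x) ^ ?d)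
        + (m + \<kappa>) / \<omega> * (1 + ln \<rho>) ^ (?d - 1) * sobolev_energy ?d \<rho> u g"
    if \<rho>: "\<rho> \<ge> \<rho>0" and u: "sobolev_pair ?d u g" for \<rho> u g
  proof -
    have ui: "integrable lborel (\<lambda>x. \<bar>u x\<bar> ^ ?d)" and [measurable]: "u \<in> borel_measurable borel"
      using u by (auto simp: sobolev_pair_def borel_weak_gradient_def)
    define G where "G = (LINT x|lborel. norm (g x) ^ ?d)"
    have G0: "G \<ge> 0" unfolding G_def by (intro Bochner_Integration.integral_nonneg) auto
    define N where "N = sobolev_energy ?d \<rho> u g"
    define L where "L = 1 + ln \<rho>"
    have \<rho>e: "\<rho> \<ge> exp 1" using \<rho> by (simp add: \<rho>0_def)
    have \<rho>1: "\<rho> > 1" using \<rho>e exp_gt_one[of "1::real"] by linarith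
    have N0: "N \<ge> 0" unfolding N_def using \<rho>1 by (intro sobolev_energy_nonneg) auto
    have L1: "L \<ge> 1" unfolding L_def using \<rho>1 by simp
    define l where "l = 1 + ln (\<rho> / P)"
    have "P * exp (1 / \<tau>) \<le> \<rho>" using \<rho> by (simp add: \<rho>0_def)
    then have e\<tau>: "exp (1 / \<tau>) \<le> \<rho> / P" using P by (simp add: field_simps)
    then have "1 / \<tau> \<le> ln (\<rho> / P)" using P \<rho>1 by (subst ln_ge_iff) auto
    then have l\<tau>: "l > 1 / \<tau>" by (simp add: l_def)
    have l1: "l > 1" "P < \<rho>"
    proof -
      have "exp (1 / \<tau>) > 1" using \<tau> by simp
      then have "1 < \<rho> / P" using e\<tau> by linarith
      then show "P < \<rho>" using P by (simp add: field_simps)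
      show "l > 1" unfolding l_def using \<open>1 < \<rho> / P\<close> by simp
    qed
    have lL: "l \<le> L" unfolding l_def L_def using P \<rho>1 by (simp add: ln_div)
    have l\<tau>': "1 - \<tau> \<le> 1 - 1 / l"
      using l\<tau> l1 \<tau> by (simp add: field_simps)
    define I where "I = (LINT x|lborel. indicator (cball 0 P) x * \<bar>u x\<bar> ^ ?d)"
    have I0: "I \<ge> 0" unfolding I_def by (intro Bochner_Integration.integral_nonneg) auto
    have cap: "real ?d * (1 - 1 / l) * I \<le> P ^ ?d * l ^ (?d - 1) * N"
      unfolding I_def N_def using logarithmic_capacity[OF d u _ l1(2) l_def] P by simp
    have I1: "(m + \<kappa> / 2) * I / (\<beta> * P ^ ?d) \<le> (m + 3 * \<kappa> / 4) / \<omega> * L ^ (?d - 1) * N"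
    proof -
      have "real ?d * (1 - \<tau>) * I \<le> real ?d * (1 - 1 / l) * I"
        using l\<tau>' I0 by (intro mult_right_mono mult_left_mono) auto
      also have "\<dots> \<le> P ^ ?d * l ^ (?d - 1) * N" by (rule cap)
      also have "\<dots> \<le> P ^ ?d * L ^ (?d - 1) * N"
        using lL l1 P N0 by (intro mult_right_mono mult_left_mono power_mono) auto
      finally have "(m + 3 * \<kappa> / 4) * (real ?d * (1 - \<tau>) * I) \<le> (m + 3 * \<kappa> / 4) * (P ^ ?d * L ^ (?d - 1) * N)"
        using m(2) \<kappa> by (intro mult_left_mono) auto
      then have "real ?d * (((m + 3 * \<kappa> / 4) * (1 - \<tau>)) * I) \<le> (m + 3 * \<kappa> / 4) * (P ^ ?d * L ^ (?d - 1) * N)"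
        by (simp add: mult_ac)
      then have *: "real ?d * ((m + \<kappa> / 2) * I) \<le> (m + 3 * \<kappa> / 4) * (P ^ ?d * L ^ (?d - 1) * N)"
        unfolding \<tau>(3) .
      have pos: "real ?d * (\<beta> * P ^ ?d) > 0" using \<beta> P by simp
      have "(m + \<kappa> / 2) * I / (\<beta> * P ^ ?d) = real ?d * ((m + \<kappa> / 2) * I) / (real ?d * (\<beta> * P ^ ?d))"
        by simp
      also have "\<dots> \<le> (m + 3 * \<kappa> / 4) * (P ^ ?d * L ^ (?d - 1) * N) / (real ?d * (\<beta> * P ^ ?d))"
        using * pos by (intro divide_right_mono) auto
      also have "\<dots> = (m + 3 * \<kappa> / 4) / \<omega> * L ^ (?d - 1) * N"
        unfolding \<omega>(1) using P by (simp add: mult_ac)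
      finally show ?thesis .
    qed
    have B1: "(LINT x|lborel. Vb x * \<bar>u x\<bar> ^ ?d) \<le> (m + 3 * \<kappa> / 4) / \<omega> * L ^ (?d - 1) * N + C * G"
    proof -
      have "((LINT x|lborel. Vb x) + \<delta> * v1) * I / (\<beta> * P ^ ?d) \<le> (m + \<kappa> / 2) * I / (\<beta> * P ^ ?d)"
        using Vbm \<delta>(2) I0 \<beta> P by (intro divide_right_mono mult_right_mono) auto
      then show ?thesis using C(3)[OF u] I1 by (simp add: v1_def I_def \<beta>_def G_def)
    qed
    have Tnn: "(\<integral>\<^sup>+x. ennreal (T x * \<bar>u x\<bar> ^ ?d) \<partial>lborel) \<le> ennreal (2 ^ (?d + 1) * G + (\<kappa> / 4) / \<omega> * L ^ (?d - 1) * N)"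
    proof -
      have "(\<integral>\<^sup>+x. ennreal (T x * (1 + ln \<rho> + real (j x)) ^ (?d - 1)) \<partial>lborel) \<le> (\<integral>\<^sup>+x. ennreal (L ^ (?d - 1) * (W x * out n x)) \<partial>lborel)"
      proof (intro nn_integral_mono ennreal_leI)
        fix x
        \<comment> \<open>Since \<open>L \<ge> 1\<close>, the logarithm of \<open>\<rho>\<close>
          factors out of the weight and leaves the integrable function \<open>W\<close>.\<close>
        have "1 + ln \<rho> + real (j x) \<le> L * (1 + real (j x))"
          using mult_right_mono[OF L1, of "real (j x)"] by (simp add: L_def[symmetric] distrib_left)
        then have "(1 + ln \<rho> + real (j x)) ^ (?d - 1) \<le> (L * (1 + real (j x))) ^ (?d - 1)"
          using \<rho>1 by (intro power_mono) auto
        then have "T x * (1 + ln \<rho> + real (j x)) ^ (?d - 1) \<le> T x * (L * (1 + real (j x))) ^ (?d - 1)"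
          using T(1) by (rule mult_left_mono)
        then show "T x * (1 + ln \<rho> + real (j x)) ^ (?d - 1) \<le> L ^ (?d - 1) * (W x * out n x)"
          by (simp add: T_def W_def power_mult_distrib mult_ac)
      qed
      also have "\<dots> = ennreal (L ^ (?d - 1) * (LINT x|lborel. W x * out n x))"
        using nn_integral_eq_integral[of lborel "\<lambda>x. L ^ (?d - 1) * (W x * out n x)"] Woi W out L1 by simp
      also have "\<dots> \<le> ennreal (L ^ (?d - 1) * \<eta>)"
        using n(1) L1 by (intro ennreal_leI mult_left_mono) auto
      finally have t: "(\<integral>\<^sup>+x. ennreal (T x * (1 + ln \<rho> + real (j x)) ^ (?d - 1)) \<partial>lborel) \<le> ennreal (L ^ (?d - 1) * \<eta>)" .
      have "(\<integral>\<^sup>+x. ennreal (T x * \<bar>u x\<bar> ^ ?d) \<partial>lborel) \<le> ennreal (2 ^ (?d + 1) * G) + ennreal (2 ^ (?d + 1) / \<omega> * N) * ennreal (L ^ (?d - 1) * \<eta>)"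
        unfolding G_def N_def \<omega>_def
        by (rule order_trans[OF unbounded_weight_bound[OF d u _ j T(1,2) \<rho>e]])
          (measurable, intro add_left_mono mult_left_mono t, auto)
      also have "\<dots> = ennreal (2 ^ (?d + 1) * G + 2 ^ (?d + 1) / \<omega> * N * (L ^ (?d - 1) * \<eta>))"
        using G0 N0 L1 \<eta>(1) \<omega>(2) by (simp add: ennreal_mult[symmetric] ennreal_plus[symmetric] del: ennreal_plus)
      also have "2 ^ (?d + 1) / \<omega> * N * (L ^ (?d - 1) * \<eta>) = (2 ^ (?d + 1) * \<eta>) / \<omega> * L ^ (?d - 1) * N"
        by simp
      finally show ?thesis unfolding \<eta>(2) .
    qed
    have Tui: "integrable lborel (\<lambda>x. T x * \<bar>u x\<bar> ^ ?d)"
      using Tnn T(1) by (intro integrableI_nonneg) (auto simp: le_less_trans)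
    have B2: "(LINT x|lborel. T x * \<bar>u x\<bar> ^ ?d) \<le> 2 ^ (?d + 1) * G + (\<kappa> / 4) / \<omega> * L ^ (?d - 1) * N"
    proof -
      have "ennreal (LINT x|lborel. T x * \<bar>u x\<bar> ^ ?d) \<le> ennreal (2 ^ (?d + 1) * G + (\<kappa> / 4) / \<omega> * L ^ (?d - 1) * N)"
        using Tnn nn_integral_eq_integral[OF Tui] T(1) by simp
      then show ?thesis using G0 N0 L1 \<kappa> \<omega>(2) by (subst (asm) ennreal_le_iff) auto
    qed
    have Vui: "integrable lborel (\<lambda>x. V x * \<bar>u x\<bar> ^ ?d)"
    proof (rule Bochner_Integration.integrable_bound)
      show "integrable lborel (\<lambda>x. \<bar>Vb x * \<bar>u x\<bar> ^ ?d\<bar> + T x * \<bar>u x\<bar> ^ ?d)"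
        by (intro Bochner_Integration.integrable_add integrable_abs C(2)[OF u] Tui)
      show "AE x in lborel. norm (V x * \<bar>u x\<bar> ^ ?d) \<le> norm (\<bar>Vb x * \<bar>u x\<bar> ^ ?d\<bar> + T x * \<bar>u x\<bar> ^ ?d)"
        by (intro AE_I2) (auto simp: Vb_def T_def out_def abs_mult)
    qed measurable
    \<comment> \<open>\<open>V \<le> Vb + T\<close> pointwise: where \<open>V\<close> is cut away it
      is replaced by its absolute value.\<close>
    have "(LINT x|lborel. V x * \<bar>u x\<bar> ^ ?d) \<le> (LINT x|lborel. Vb x * \<bar>u x\<bar> ^ ?d + T x * \<bar>u x\<bar> ^ ?d)"
      by (intro integral_mono Bochner_Integration.integrable_add Vui C(2)[OF u] Tui)
        (auto simp: Vb_def T_def out_def intro!: mult_right_mono)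
    also have "\<dots> = (LINT x|lborel. Vb x * \<bar>u x\<bar> ^ ?d) + (LINT x|lborel. T x * \<bar>u x\<bar> ^ ?d)"
      using C(2)[OF u] Tui by simp
    also have "\<dots> \<le> ((m + 3 * \<kappa> / 4) / \<omega> * L ^ (?d - 1) * N + C * G) + (2 ^ (?d + 1) * G + (\<kappa> / 4) / \<omega> * L ^ (?d - 1) * N)"
      by (intro add_mono B1 B2)
    also have "\<dots> = (C + 2 ^ (?d + 1)) * G + ((m + 3 * \<kappa> / 4) / \<omega> + (\<kappa> / 4) / \<omega>) * L ^ (?d - 1) * N"
      by (simp add: algebra_simps)
    also have "(m + 3 * \<kappa> / 4) / \<omega> + (\<kappa> / 4) / \<omega> = (m + \<kappa>) / \<omega>"
      by (simp only: add_divide_distrib[symmetric]) simp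
    finally show ?thesis using Vui by (simp add: G_def L_def N_def)
  qed
  have "\<rho>0 \<ge> exp 1" by (simp add: \<rho>0_def)
  then have "\<rho>0 > 1" using exp_gt_one[of "1::real"] by linarith
  then show ?thesis
    using main C(1) by (intro that[of "C + 2 ^ (?d + 1)" \<rho>0]) auto
qed

section \<open>Logarithmic trial functions\<close>

lemma clamp_has_derivative:
  fixes F F' :: "real \<Rightarrow> real"
  assumes ab: "a < b" and F: "\<And>r. a \<le> r \<Longrightarrow> r \<le> b \<Longrightarrow> (F has_real_derivative F' r) (at r)"
    and r: "r \<notin> {a, b}"
  shows "((\<lambda>r. F (max a (min b r))) has_real_derivative (if a \<le> r \<and> r \<le> b then F' r else 0)) (at r)"
proof -
  consider "r < a" | "a < r" "r < b" | "r > b" using r by force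
  then show ?thesis
  proof cases
    case 1
    have "((\<lambda>r. F a) has_real_derivative 0) (at r)" by simp
    then have "((\<lambda>r. F (max a (min b r))) has_real_derivative 0) (at r)"
      by (rule has_field_derivative_transform_within_open[where S="{..<a}"]) (use 1 ab in \<open>auto simp: max_def min_def\<close>)
    then show ?thesis using 1 by simp
  next
    case 2
    have "(F has_real_derivative F' r) (at r)" using F 2 by simp
    then have "((\<lambda>r. F (max a (min b r))) has_real_derivative F' r) (at r)"
      by (rule has_field_derivative_transform_within_open[where S="{a<..<b}"]) (use 2 in \<open>auto simp: max_def min_def\<close>)
    then show ?thesis using 2 by simp
  next
    case 3
    have "((\<lambda>r. F b) has_real_derivative 0) (at r)" by simp
    then have "((\<lambda>r. F (max a (min b r))) has_real_derivative 0) (at r)"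
      by (rule has_field_derivative_transform_within_open[where S="{b<..}"]) (use 3 ab in \<open>auto simp: max_def min_def\<close>)
    then show ?thesis using 3 ab by simp
  qed
qed

text \<open>The profile \<open>F\<close> is chosen so that the radial field has divergence
  \<open>- 1 / norm x ^ DIM('a)\<close> on the annulus. Continued by \<open>ln R\<close> times
  \<open>x\<close> inside the unit ball and by 0 beyond \<open>R\<close>, it has total divergence 0,
  and the volume of the unit ball yields the integral.\<close>

lemma integral_norm_power_annulus:
  assumes R: "R > 1"
  defines "A \<equiv> \<lambda>x::'a::euclidean_space. if 1 \<le> norm x \<and> norm x \<le> R then 1 / norm x ^ DIM('a) else 0"
  shows "integrable lborel A" "(LINT x|lborel. A x) = real DIM('a) * unit_ball_vol (real DIM('a)) * ln R"
proof -
  let ?d = "DIM('a)"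
  define F where "F r = (ln R - ln r) / r ^ ?d" for r :: real
  define F' where "F' r = - 1 / r ^ Suc ?d - real ?d * F r / r" for r :: real
  have dF: "(F has_real_derivative F' r) (at r)" if "1 \<le> r" "r \<le> R" for r
  proof -
    have "((\<lambda>r. ln R - ln r) has_real_derivative - (1 / r)) (at r)"
      using that by (auto intro!: derivative_eq_intros)
    from DERIV_divide[OF this DERIV_pow[of ?d r]] that
    have "(F has_real_derivative ((- (1 / r)) * r ^ ?d - (ln R - ln r) * (real ?d * r ^ (?d - 1))) / (r ^ ?d * r ^ ?d)) (at r)"
      unfolding F_def[abs_def] by simp
    also have "((- (1 / r)) * r ^ ?d - (ln R - ln r) * (real ?d * r ^ (?d - 1))) / (r ^ ?d * r ^ ?d) = F' r"
    proof -
      have p: "r ^ ?d = r * r ^ (?d - 1)" by (rule power_eq_if[THEN trans]) simp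
      show ?thesis using that unfolding F'_def F_def power_Suc p by (simp add: field_simps)
    qed
    finally show ?thesis .
  qed
  have cF': "continuous_on {1..R} F'"
    unfolding F'_def F_def by (intro continuous_intros) auto
  define f where "f r = F (max 1 (min R r))" for r
  define f' where "f' r = (if 1 \<le> r \<and> r \<le> R then F' r else 0)" for r
  obtain K where K: "K-lipschitz_on UNIV f"
    using lipschitz_on_comp_clamp[of 1 R F F'] dF cF' R unfolding f_def[abs_def] by (metis less_imp_le)
  have [measurable]: "f' \<in> borel_measurable borel"
    unfolding f'_def[abs_def] F'_def[abs_def] F_def[abs_def] by measurable
  define D where "D x = 1 * (real ?d * f (norm x) + norm x * f' (norm x)) + f (norm x) * ((0::'a) \<bullet> x)" for x :: 'a
  have D: "integrable lborel D" "(LINT x|lborel. D x) = 0"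
  proof -
    have *: "f r = 0" if "r > R" for r using that R by (simp add: f_def F_def)
    have **: "(f has_real_derivative f' r) (at r)" if "r \<notin> {1, R}" for r
      unfolding f_def[abs_def] f'_def by (rule clamp_has_derivative[OF R dF that])
    show "integrable lborel D" "(LINT x|lborel. D x) = 0"
      unfolding D_def[abs_def]
      by (rule radial_divergence[where S="{1, R}" and w="\<lambda>_. 1" and G="\<lambda>_. 0", OF K *]; simp add: ** )+
  qed
  have Di: "D x = real ?d * ln R * indicator (cball 0 1) x - A x" if nx: "norm x \<notin> {0, 1, R}" for x
  proof -
    consider "norm x < 1" | "1 < norm x" "norm x < R" | "norm x > R" using nx by force
    then show ?thesis
    proof cases
      case 2
      have "norm x * F' (norm x) = - 1 / norm x ^ ?d - real ?d * F (norm x)"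
        using 2 by (auto simp: F'_def field_simps)
      then show ?thesis using 2 R by (simp add: D_def f_def f'_def A_def max_def min_def)
    qed (use R in \<open>auto simp: D_def f_def f'_def A_def F_def max_def min_def\<close>)
  qed
  have [measurable]: "A \<in> borel_measurable borel" unfolding A_def by measurable
  have ae: "AE x in lborel. real ?d * ln R * indicator (cball 0 1) x - D x = A x"
  proof (rule eventually_mono[OF AE_norm_notin_finite[of "{0, 1, R}"]])
    show "real ?d * ln R * indicator (cball 0 1) x - D x = A x" if "norm x \<notin> {0, 1, R}" for x
      using Di[OF that] by simp
  qed simp
  have ii: "integrable lborel (\<lambda>x::'a. real ?d * ln R * indicator (cball 0 1) x)"
    by (intro integrable_mult_right integrable_real_indicator) (auto simp: emeasure_cball)
  have i: "integrable lborel (\<lambda>x. real ?d * ln R * indicator (cball 0 1) x - D x)"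
    using ii D by (intro Bochner_Integration.integrable_diff)
  show "integrable lborel A"
    by (rule integrable_cong_AE_imp[OF i _ ae]) simp
  have "(LINT x|lborel. A x) = (LINT x|lborel. real ?d * ln R * indicator (cball 0 1) x - D x)"
    using ae borel_measurable_integrable[OF i] by (intro integral_cong_AE) auto
  also have "\<dots> = (LINT x|lborel. real ?d * ln R * indicator (cball (0::'a) 1) x) - (LINT x|lborel. D x)"
    by (rule Bochner_Integration.integral_diff[OF ii D(1)])
  also have "\<dots> = real ?d * unit_ball_vol (real ?d) * ln R"
    using D(2) by (simp add: content_cball)
  finally show "(LINT x|lborel. A x) = real ?d * unit_ball_vol (real ?d) * ln R" .
qed

text \<open>Radial profile of the capacitary potential of the unit ball in the ball of radius
  \<open>R\<close>, for the exponent equal to the dimension.\<close>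

definition log_cutoff :: "real \<Rightarrow> real \<Rightarrow> real" where
  "log_cutoff R r = (ln R - ln (max 1 (min R r))) / ln R"

definition log_cutoff_gradient :: "real \<Rightarrow> 'a::euclidean_space \<Rightarrow> 'a" where
  "log_cutoff_gradient R x = ((if 1 \<le> norm x \<and> norm x \<le> R then - (1 / norm x) / ln R else 0) / norm x) *\<^sub>R x"

context
  fixes R :: real assumes R: "R > 1"
begin

lemma log_cutoff_bounds: "0 \<le> log_cutoff R r" "log_cutoff R r \<le> 1"
  using R by (auto simp: log_cutoff_def max_def min_def)

section \<open>The truncated logarithm as a Sobolev function\<close>

lemma log_cutoff_eq: "r \<le> 1 \<Longrightarrow> log_cutoff R r = 1" "r \<ge> R \<Longrightarrow> log_cutoff R r = 0"
  using R by (auto simp: log_cutoff_def)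

lemma log_cutoff_derivative:
  assumes "r \<notin> {1, R}"
  shows "(log_cutoff R has_real_derivative (if 1 \<le> r \<and> r \<le> R then - (1 / r) / ln R else 0)) (at r)"
proof -
  have "((\<lambda>r. (ln R - ln r) / ln R) has_real_derivative - (1 / r) / ln R) (at r)" if "1 \<le> r" "r \<le> R" for r
    using that R by (auto intro!: derivative_eq_intros)
  from clamp_has_derivative[OF R this assms] show ?thesis
    by (simp add: log_cutoff_def[abs_def])
qed

lemma log_cutoff_lipschitz: "\<exists>K. K-lipschitz_on UNIV (log_cutoff R)"
proof -
  have "((\<lambda>r. (ln R - ln r) / ln R) has_real_derivative - (1 / r) / ln R) (at r)" if "1 \<le> r" "r \<le> R" for r
    using that R by (auto intro!: derivative_eq_intros)
  moreover have "continuous_on {1..R} (\<lambda>r. - (1 / r) / ln R)"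
    using R by (intro continuous_intros) auto
  ultimately show ?thesis
    using lipschitz_on_comp_clamp[of 1 R "\<lambda>r. (ln R - ln r) / ln R" "\<lambda>r. - (1 / r) / ln R"] R
    unfolding log_cutoff_def[abs_def] by (metis less_imp_le)
qed

lemma log_cutoff_measurable [measurable]: "log_cutoff R \<in> borel_measurable borel"
  unfolding log_cutoff_def[abs_def] by measurable

lemma log_cutoff_gradient_measurable [measurable]:
  "(log_cutoff_gradient R :: 'a::euclidean_space \<Rightarrow> 'a) \<in> borel_measurable borel"
  unfolding log_cutoff_gradient_def[abs_def] by measurable

lemma norm_log_cutoff_gradient:
  fixes x :: "'a::euclidean_space"
  shows "norm (log_cutoff_gradient R x) = (if 1 \<le> norm x \<and> norm x \<le> R then 1 / (norm x * ln R) else 0)"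
  using R by (auto simp: log_cutoff_gradient_def abs_mult)

lemma integrable_bounded_support:
  fixes v :: "'a::euclidean_space \<Rightarrow> 'b::euclidean_space"
  assumes [measurable]: "v \<in> borel_measurable borel" and "\<And>x. norm (v x) \<le> B" "\<And>x. norm x > r \<Longrightarrow> v x = 0"
  shows "integrable lborel v"
proof (rule Bochner_Integration.integrable_bound)
  show "integrable lborel (\<lambda>x::'a. indicator (cball 0 r) x * B)"
    by (intro integrable_mult_left integrable_real_indicator) (use emeasure_bounded_finite[OF bounded_cball[of "0::'a"]] in auto)
  show "AE x in lborel. norm (v x) \<le> norm (indicator (cball 0 r) x * B)"
    using assms(2,3) by (intro AE_I2) (auto simp: indicator_def intro: order_trans[OF _ abs_ge_self])
qed simp

lemma locally_integrable_bounded_support: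
  fixes v :: "'a::euclidean_space \<Rightarrow> 'b::euclidean_space"
  assumes "v \<in> borel_measurable borel" "\<And>x. norm (v x) \<le> B" "\<And>x. norm x > r \<Longrightarrow> v x = 0"
  shows "locally_integrable v"
proof -
  have "integrable lebesgue v"
    using integrable_bounded_support[OF assms] integrable_completion[of v lborel] assms(1) by simp
  then show ?thesis
    unfolding locally_integrable_def set_integrable_def
    by (auto intro!: integrable_mult_indicator dest: borel_compact)
qed

text \<open>The product of the profile with a test function is Lipschitz with bounded support and
  obeys the product rule off the origin and two spheres. Its directional derivative integrates to 0,
  which is the weak gradient identity.\<close>

lemma log_cutoff_weak_gradient:
  "has_weak_gradient (\<lambda>x::'a::euclidean_space. log_cutoff R (norm x)) (log_cutoff_gradient R)"
proof -
  let ?u = "\<lambda>x::'a. log_cutoff R (norm x)" and ?g = "log_cutoff_gradient R :: 'a \<Rightarrow> 'a"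
  have ub: "norm (?u x) \<le> 1" "norm x > R \<Longrightarrow> ?u x = 0" for x
    using log_cutoff_bounds log_cutoff_eq(2) by auto
  have gb: "norm (?g x) \<le> 1 / ln R" "norm x > R \<Longrightarrow> ?g x = 0" for x
  proof -
    show "norm (?g x) \<le> 1 / ln R"
      unfolding norm_log_cutoff_gradient using R by (auto intro!: divide_left_mono mult_pos_pos simp: mult_le_cancel_right1)
    show "norm x > R \<Longrightarrow> ?g x = 0" by (simp add: log_cutoff_gradient_def)
  qed
  have loc: "locally_integrable ?u" "locally_integrable ?g"
    by (rule locally_integrable_bounded_support[OF _ ub] locally_integrable_bounded_support[OF _ gb]; simp)+
  obtain K where K: "K-lipschitz_on UNIV (log_cutoff R)" using log_cutoff_lipschitz by blast
  have "(LINT x|lborel. ?u x * frechet_derivative \<phi> (at x) i) = - (LINT x|lborel. (?g x \<bullet> i) * \<phi> x)"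
    if t: "test_function \<phi>" for \<phi> and i :: 'a
  proof -
    have [measurable]: "\<phi> \<in> borel_measurable borel" "(\<lambda>x. frechet_derivative \<phi> (at x) i) \<in> borel_measurable borel"
      by (intro borel_measurable_continuous_onI continuous_on_test_function test_function_derivative_continuous t)+
    obtain B where B: "\<And>x. \<bar>\<phi> x\<bar> \<le> B" "\<And>x. \<bar>frechet_derivative \<phi> (at x) i\<bar> \<le> B"
      using test_function_bounded[OF t, of i] by metis
    have B0: "B \<ge> 0" using B(1)[of 0] by linarith
    define G where "G x = (\<Sum>i\<in>Basis. frechet_derivative \<phi> (at x) i *\<^sub>R i)" for x
    have G: "(\<phi> has_derivative (\<lambda>h. G x \<bullet> h)) (at x)" for x
    proof -
      have "frechet_derivative \<phi> (at x) = (\<lambda>h. G x \<bullet> h)"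
      proof (rule ext)
        fix h
        show "frechet_derivative \<phi> (at x) h = G x \<bullet> h"
          unfolding test_function_derivative_expand[OF t, of x h]
          by (simp add: G_def inner_sum_left inner_commute[of h] mult.commute)
      qed
      then show ?thesis using test_function_has_derivative[OF t, of x] by simp
    qed
    have cG: "continuous_on UNIV G"
      unfolding G_def by (intro continuous_intros test_function_derivative_continuous t)
    obtain K' where K': "K'-lipschitz_on UNIV (\<lambda>x. ?u x * \<phi> x)"
      by (rule lipschitz_on_mult_C1[OF lipschitz_on_comp_norm[OF K] ub(2) G cG])
    define D where "D x = (?g x \<bullet> i) * \<phi> x + ?u x * frechet_derivative \<phi> (at x) i" for x
    have [measurable]: "D \<in> borel_measurable borel" unfolding D_def by measurable
    have ae: "AE x in lborel. ((\<lambda>t. ?u (x + t *\<^sub>R i) * \<phi> (x + t *\<^sub>R i)) has_real_derivative D x) (at 0)"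
    proof (rule eventually_mono[OF AE_norm_notin_finite[of "{0, 1, R}"]])
      fix x :: 'a assume x: "norm x \<notin> {0, 1, R}"
      then have x0: "x \<noteq> 0" by auto
      have 1: "((\<lambda>t. ?u (x + t *\<^sub>R i)) has_real_derivative (if 1 \<le> norm x \<and> norm x \<le> R then - (1 / norm x) / ln R else 0) * ((x \<bullet> i) / norm x)) (at 0)"
        by (rule DERIV_chain2[where f="log_cutoff R"]) (use log_cutoff_derivative[of "norm x"] x norm_ray_derivative[OF x0] in auto)
      have 2: "((\<lambda>t. \<phi> (x + t *\<^sub>R i)) has_real_derivative G x \<bullet> i) (at 0)"
      proof -
        have "((\<lambda>t. x + t *\<^sub>R i) has_derivative (\<lambda>t. t *\<^sub>R i)) (at 0)"
          by (auto intro!: derivative_eq_intros)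
        from has_derivative_compose[OF this, of \<phi> "\<lambda>h. G x \<bullet> h"] G[of x]
        have "((\<lambda>t. \<phi> (x + t *\<^sub>R i)) has_derivative (\<lambda>t. G x \<bullet> (t *\<^sub>R i))) (at 0)" by simp
        then show ?thesis by (simp add: has_field_derivative_def mult.commute[of _ "G x \<bullet> i"])
      qed
      have "G x \<bullet> i = frechet_derivative \<phi> (at x) i"
        using frechet_derivative_at[OF G[of x]] by (metis)
      then show "((\<lambda>t. ?u (x + t *\<^sub>R i) * \<phi> (x + t *\<^sub>R i)) has_real_derivative D x) (at 0)"
        using DERIV_mult[OF 1 2] by (simp add: D_def log_cutoff_gradient_def mult_ac)
    qed simp
    have D0: "(LINT x|lborel. D x) = 0"
      by (rule integral_derivative_eq_0(2)[OF K' _ _ ae, of R]) (use ub in auto)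
    have i1: "integrable lborel (\<lambda>x. ?u x * frechet_derivative \<phi> (at x) i)"
    proof (rule integrable_bounded_support[where B="1 * B" and r=R])
      show "norm (?u x * frechet_derivative \<phi> (at x) i) \<le> 1 * B" for x
        unfolding norm_mult using ub(1)[of x] B(2)[of x] by (intro mult_mono) auto
    qed (use ub(2) in auto)
    have i2: "integrable lborel (\<lambda>x. (?g x \<bullet> i) * \<phi> x)"
    proof (rule integrable_bounded_support[where B="(1 / ln R * norm i) * B" and r=R])
      fix x
      have "\<bar>?g x \<bullet> i\<bar> \<le> norm (?g x) * norm i" by (rule Cauchy_Schwarz_ineq2)
      also have "\<dots> \<le> 1 / ln R * norm i" using gb(1) by (intro mult_right_mono) auto
      finally have "norm (?g x \<bullet> i) \<le> 1 / ln R * norm i" by simp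
      then show "norm ((?g x \<bullet> i) * \<phi> x) \<le> (1 / ln R * norm i) * B"
        unfolding norm_mult using B(1)[of x] R by (intro mult_mono) auto
    qed (use gb(2) in auto)
    from i1 i2 D0 show ?thesis unfolding D_def by simp
  qed
  moreover have "(LINT x|lebesgue. ?u x * frechet_derivative \<phi> (at x) i) = (LINT x|lborel. ?u x * frechet_derivative \<phi> (at x) i)"
    "(LINT x|lebesgue. (?g x \<bullet> i) * \<phi> x) = (LINT x|lborel. (?g x \<bullet> i) * \<phi> x)"
    if t: "test_function \<phi>" for \<phi> and i :: 'a
  proof -
    have [measurable]: "\<phi> \<in> borel_measurable borel" "(\<lambda>x. frechet_derivative \<phi> (at x) i) \<in> borel_measurable borel"
      by (intro borel_measurable_continuous_onI continuous_on_test_function test_function_derivative_continuous t)+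
    show "(LINT x|lebesgue. ?u x * frechet_derivative \<phi> (at x) i) = (LINT x|lborel. ?u x * frechet_derivative \<phi> (at x) i)"
      "(LINT x|lebesgue. (?g x \<bullet> i) * \<phi> x) = (LINT x|lborel. (?g x \<bullet> i) * \<phi> x)"
      by (rule integral_completion, measurable)+
  qed
  ultimately show ?thesis
    unfolding has_weak_gradient_def using loc by simp
qed

text \<open>The integrand is that of the annulus integral divided by \<open>ln R ^ DIM('a)\<close>,
  and the integral gives back one factor \<open>ln R\<close>. The result matches the capacity bound
  to leading order.\<close>

lemma log_cutoff_energy:
  assumes d: "DIM('a::euclidean_space) \<ge> 2"
  shows "integrable lborel (\<lambda>x::'a. norm (log_cutoff_gradient R x) ^ DIM('a))"
    "(LINT x|lborel. norm (log_cutoff_gradient R (x::'a)) ^ DIM('a)) =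
       real DIM('a) * unit_ball_vol (real DIM('a)) / ln R ^ (DIM('a) - 1)"
proof -
  let ?d = "DIM('a)"
  define A where "A x = (if 1 \<le> norm x \<and> norm x \<le> R then 1 / norm x ^ ?d else 0)" for x :: 'a
  have eq: "norm (log_cutoff_gradient R x) ^ ?d = A x / ln R ^ ?d" for x :: 'a
    by (auto simp: norm_log_cutoff_gradient A_def power_divide power_mult_distrib power_0_left)
  have A: "integrable lborel A" "(LINT x|lborel. A x) = real ?d * unit_ball_vol (real ?d) * ln R"
    using integral_norm_power_annulus[OF R, where 'a='a] by (simp_all add: A_def[abs_def])
  have p: "ln R ^ ?d = ln R * ln R ^ (?d - 1)" by (rule power_eq_if[THEN trans]) simp
  show "integrable lborel (\<lambda>x::'a. norm (log_cutoff_gradient R x) ^ ?d)"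
    unfolding eq using A(1) by simp
  show "(LINT x|lborel. norm (log_cutoff_gradient R (x::'a)) ^ ?d) = real ?d * unit_ball_vol (real ?d) / ln R ^ (?d - 1)"
    unfolding eq using A(2) R p by simp
qed

text \<open>The trial function lies between the indicators of the balls of radius 1 and
  \<open>R\<close>. The upper bound is crude, but a constant in front of \<open>R ^ DIM('a)\<close>
  disappears in the logarithmic limit.\<close>

lemma log_cutoff_mass:
  shows "integrable lborel (\<lambda>x::'a::euclidean_space. \<bar>log_cutoff R (norm x)\<bar> ^ DIM('a))"
    "0 < (LINT x|lborel. \<bar>log_cutoff R (norm (x::'a))\<bar> ^ DIM('a))"
    "(LINT x|lborel. \<bar>log_cutoff R (norm (x::'a))\<bar> ^ DIM('a)) \<le> unit_ball_vol (real DIM('a)) * R ^ DIM('a)"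
proof -
  let ?d = "DIM('a)"
  have le1: "\<bar>log_cutoff R s\<bar> ^ ?d \<le> 1" for s
    using log_cutoff_bounds[of s] by (auto intro!: power_le_one)
  show i: "integrable lborel (\<lambda>x::'a. \<bar>log_cutoff R (norm x)\<bar> ^ ?d)"
    by (rule integrable_bounded_support[where B=1 and r=R]) (use le1 log_cutoff_eq(2) in \<open>auto simp: power_0_left\<close>)
  have ci: "integrable lborel (indicator (cball (0::'a) s) :: 'a \<Rightarrow> real)" for s
    by (intro integrable_real_indicator) (use emeasure_bounded_finite[OF bounded_cball[of "0::'a"]] in auto)
  have "(LINT x|lborel. indicator (cball (0::'a) 1) x) \<le> (LINT x|lborel. \<bar>log_cutoff R (norm (x::'a))\<bar> ^ ?d)"
    by (intro integral_mono i ci) (auto simp: indicator_def log_cutoff_eq)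
  then show "0 < (LINT x|lborel. \<bar>log_cutoff R (norm (x::'a))\<bar> ^ ?d)"
    using unit_ball_vol_pos[of "real ?d"] by (simp add: content_cball del: unit_ball_vol_pos)
  have "(LINT x|lborel. \<bar>log_cutoff R (norm (x::'a))\<bar> ^ ?d) \<le> (LINT x|lborel. indicator (cball (0::'a) R) x)"
    by (intro integral_mono i ci) (use le1 in \<open>auto simp: indicator_def log_cutoff_eq power_0_left\<close>)
  then show "(LINT x|lborel. \<bar>log_cutoff R (norm (x::'a))\<bar> ^ ?d) \<le> unit_ball_vol (real ?d) * R ^ ?d"
    using R by (simp add: content_cball)
qed

end

text \<open>For fixed \<open>x\<close> the profile is \<open>1 - c / ln R\<close> as soon as
  \<open>R\<close> exceeds 1 and \<open>norm x\<close>, hence tends to 1, and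
  \<open>\<bar>V\<bar>\<close> dominates.\<close>

lemma log_cutoff_tendsto:
  fixes V :: "'a::euclidean_space \<Rightarrow> real"
  assumes [measurable]: "V \<in> borel_measurable borel" and V: "integrable lborel V"
  shows "((\<lambda>R. LINT x|lborel. V x * \<bar>log_cutoff R (norm x)\<bar> ^ DIM('a)) \<longlongrightarrow> (LINT x|lborel. V x)) at_top"
proof (rule integral_dominated_convergence_at_top[where w="\<lambda>x. \<bar>V x\<bar>"])
  show "\<forall>\<^sub>F R in at_top. AE x in lborel. norm (V x * \<bar>log_cutoff R (norm x)\<bar> ^ DIM('a)) \<le> \<bar>V x\<bar>"
    using eventually_gt_at_top[of "1::real"]
  proof eventually_elim
    case (elim R)
    have "\<bar>log_cutoff R s\<bar> ^ DIM('a) \<le> 1" for s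
      using log_cutoff_bounds[OF elim, of s] by (auto intro!: power_le_one)
    then show ?case by (auto simp: abs_mult power_abs intro!: AE_I2 mult_left_le)
  qed
  show "AE x in lborel. ((\<lambda>R. V x * \<bar>log_cutoff R (norm x)\<bar> ^ DIM('a)) \<longlongrightarrow> V x) at_top"
  proof (rule AE_I2)
    fix x :: 'a
    define c where "c = ln (max 1 (norm x))"
    have "((\<lambda>R. 1 - c * inverse (ln R)) \<longlongrightarrow> 1 - c * 0) at_top"
      by (intro tendsto_intros filterlim_compose[OF tendsto_inverse_0_at_top ln_at_top] filterlim_ident)
    moreover have "\<forall>\<^sub>F R in at_top. 1 - c * inverse (ln R) = log_cutoff R (norm x)"
      using eventually_gt_at_top[of "max 1 (norm x)"]
    proof eventually_elim
      case (elim R)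
      then have "ln R > 0" "max 1 (min R (norm x)) = max 1 (norm x)" by auto
      then show ?case by (simp add: log_cutoff_def c_def field_simps)
    qed
    ultimately have "((\<lambda>R. log_cutoff R (norm x)) \<longlongrightarrow> 1) at_top"
      using Lim_transform_eventually by force
    then have "((\<lambda>R. V x * \<bar>log_cutoff R (norm x)\<bar> ^ DIM('a)) \<longlongrightarrow> V x * \<bar>1\<bar> ^ DIM('a)) at_top"
      by (intro tendsto_intros)
    then show "((\<lambda>R. V x * \<bar>log_cutoff R (norm x)\<bar> ^ DIM('a)) \<longlongrightarrow> V x) at_top" by simp
  qed
qed (use V in \<open>auto simp: log_cutoff_def\<close>)

section \<open>The area of the unit sphere\<close>

text \<open>The neighbourhood is the shell between the radii \<open>1 - \<epsilon>\<close> and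
  \<open>1 + \<epsilon>\<close>, so the quotient is the volume of the unit ball times a symmetric
  difference quotient of \<open>r ^ DIM('a)\<close> at 1.\<close>

lemma surface_area_unit_sphere:
  "surface_area (sphere (0::'a::euclidean_space) 1) = real DIM('a) * unit_ball_vol (real DIM('a))"
proof -
  let ?S = "sphere (0::'a) 1" and ?d = "DIM('a)" and ?\<beta> = "unit_ball_vol (real DIM('a))"
  obtain b :: 'a where "b \<in> Basis" using nonempty_Basis by blast
  then have "b \<in> ?S" by simp
  then have ne: "?S \<noteq> {}" by blast
  have set_eq: "{x. infdist x ?S \<le> \<epsilon>} = cball 0 (1 + \<epsilon>) - ball 0 (1 - \<epsilon>)" if "0 < \<epsilon>" "\<epsilon> < 1" for \<epsilon>
  proof (intro set_eqI iffI)
    fix x :: 'a assume "x \<in> {x. infdist x ?S \<le> \<epsilon>}"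
    moreover obtain a where "a \<in> ?S" "infdist x ?S = dist x a"
      using infdist_attains_inf[OF closed_sphere ne, of x] by blast
    ultimately have "norm (x - a) \<le> \<epsilon>" "norm a = 1" by (auto simp: dist_norm)
    then show "x \<in> cball 0 (1 + \<epsilon>) - ball 0 (1 - \<epsilon>)"
      using norm_triangle_ineq3[of x a] by auto
  next
    fix x :: 'a assume "x \<in> cball 0 (1 + \<epsilon>) - ball 0 (1 - \<epsilon>)"
    then have x: "norm x \<le> 1 + \<epsilon>" "norm x \<ge> 1 - \<epsilon>" by auto
    then have x0: "norm x > 0" using that by linarith
    \<comment> \<open>The radial projection of \<open>x\<close> onto the sphere is a point at
      distance \<open>\<bar>norm x - 1\<bar>\<close>.\<close>
    have "x - (1 / norm x) *\<^sub>R x = (1 - 1 / norm x) *\<^sub>R x" by (simp add: scaleR_left_diff_distrib)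
    then have "norm (x - (1 / norm x) *\<^sub>R x) = \<bar>1 - 1 / norm x\<bar> * norm x" by simp
    also have "\<dots> = \<bar>(1 - 1 / norm x) * norm x\<bar>" by (simp add: abs_mult)
    also have "(1 - 1 / norm x) * norm x = norm x - 1" using x0 by (simp add: left_diff_distrib)
    finally have "dist x ((1 / norm x) *\<^sub>R x) \<le> \<epsilon>" using x by (simp add: dist_norm)
    then show "x \<in> {x. infdist x ?S \<le> \<epsilon>}"
      using x0 by (auto intro!: infdist_le2[of "(1 / norm x) *\<^sub>R x"])
  qed
  have meas: "measure lebesgue {x. infdist x ?S \<le> \<epsilon>} / (2 * \<epsilon>) = ?\<beta> * (((1 + \<epsilon>) ^ ?d - (1 - \<epsilon>) ^ ?d) / (2 * \<epsilon>))"
    if "0 < \<epsilon>" "\<epsilon> < 1" for \<epsilon>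
  proof -
    have "measure lborel (cball (0::'a) (1 + \<epsilon>) - ball 0 (1 - \<epsilon>)) = measure lborel (cball (0::'a) (1 + \<epsilon>)) - measure lborel (ball (0::'a) (1 - \<epsilon>))"
      using that by (intro measure_Diff) (auto simp: emeasure_ball emeasure_cball)
    then show ?thesis
      unfolding set_eq[OF that] using that
      by (simp add: content_cball content_ball right_diff_distrib diff_divide_distrib)
  qed
  have "((\<lambda>\<epsilon>. (1 + \<epsilon>) ^ ?d - (1 - \<epsilon>) ^ ?d) has_real_derivative 2 * real ?d) (at 0)"
    by (auto intro!: derivative_eq_intros)
  then have "((\<lambda>\<epsilon>::real. ((1 + \<epsilon>) ^ ?d - (1 - \<epsilon>) ^ ?d) / \<epsilon>) \<longlongrightarrow> 2 * real ?d) (at 0)"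
    by (simp add: has_field_derivative_iff)
  then have "((\<lambda>\<epsilon>::real. ((1 + \<epsilon>) ^ ?d - (1 - \<epsilon>) ^ ?d) / \<epsilon>) \<longlongrightarrow> 2 * real ?d) (at_right 0)"
    by (rule filterlim_mono) (auto simp: at_le)
  then have "((\<lambda>\<epsilon>::real. ?\<beta> * ((((1 + \<epsilon>) ^ ?d - (1 - \<epsilon>) ^ ?d) / \<epsilon>) / 2)) \<longlongrightarrow> ?\<beta> * (2 * real ?d / 2)) (at_right 0)"
    by (intro tendsto_intros) auto
  moreover have "\<forall>\<^sub>F \<epsilon> in at_right 0. ?\<beta> * ((((1 + \<epsilon>) ^ ?d - (1 - \<epsilon>) ^ ?d) / \<epsilon>) / 2) = measure lebesgue {x. infdist x ?S \<le> \<epsilon>} / (2 * \<epsilon>)"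
    unfolding eventually_at_right_field by (rule exI[of _ 1]) (use meas in \<open>simp add: mult.commute\<close>)
  ultimately have "((\<lambda>\<epsilon>. measure lebesgue {x. infdist x ?S \<le> \<epsilon>} / (2 * \<epsilon>)) \<longlongrightarrow> ?\<beta> * (2 * real ?d / 2)) (at_right 0)"
    by (rule Lim_transform_eventually)
  then show ?thesis
    unfolding surface_area_def by (subst tendsto_Lim) (auto simp: mult.commute)
qed

section \<open>Asymptotics of the ground state energy\<close>

definition admissible :: "('a::euclidean_space \<Rightarrow> real) set" where
  "admissible = {u \<in> W1 (real DIM('a)). \<not> (AE x in lebesgue. u x = 0)}"

definition rayleigh :: "('a::euclidean_space \<Rightarrow> real) \<Rightarrow> ('a \<Rightarrow> real) \<Rightarrow> real" where
  "rayleigh V u = Q V u / (LINT x|lebesgue. \<bar>u x\<bar> ^ DIM('a))"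

lemma lam_eq: "lam V = (INF u \<in> admissible. rayleigh V u)"
  by (simp add: lam_def admissible_def rayleigh_def)

lemma rayleigh_borel:
  fixes u :: "'a::euclidean_space \<Rightarrow> real"
  assumes V: "V \<in> borel_measurable lebesgue" "V' \<in> borel_measurable borel" "AE x in lborel. V x = V' x"
    and wm: "weak_gradient u \<in> borel_measurable lebesgue" and um: "u \<in> borel_measurable lebesgue"
    and u': "sobolev_pair DIM('a) u' g'" "AE x in lborel. u x = u' x" "AE x in lborel. weak_gradient u x = g' x"
  shows "rayleigh V u = (LINT x|lborel. norm (g' x) ^ DIM('a) - V' x * \<bar>u' x\<bar> ^ DIM('a)) / (LINT x|lborel. \<bar>u' x\<bar> ^ DIM('a))"
proof -
  have [measurable]: "u' \<in> borel_measurable borel" "g' \<in> borel_measurable borel"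
    using u'(1) by (auto simp: sobolev_pair_def borel_weak_gradient_def)
  note [measurable] = V(1,2) wm um
  have "Q V u = (LINT x|lborel. norm (g' x) ^ DIM('a) - V' x * \<bar>u' x\<bar> ^ DIM('a))"
    unfolding Q_def
  proof (rule lebesgue_integral_AE_borel(2))
    show "AE x in lborel. norm (weak_gradient u x) ^ DIM('a) - V x * \<bar>u x\<bar> ^ DIM('a) = norm (g' x) ^ DIM('a) - V' x * \<bar>u' x\<bar> ^ DIM('a)"
      using V(3) u'(2,3) by eventually_elim simp
  qed measurable
  moreover have "(LINT x|lebesgue. \<bar>u x\<bar> ^ DIM('a)) = (LINT x|lborel. \<bar>u' x\<bar> ^ DIM('a))"
    using u'(2) by (intro lebesgue_integral_AE_borel(2)) auto
  ultimately show ?thesis by (simp add: rayleigh_def)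
qed

context
  fixes V :: "'a::euclidean_space \<Rightarrow> real" and V' :: "'a \<Rightarrow> real" and q m :: real
  assumes d: "DIM('a) \<ge> 2" and V: "V \<in> borel_measurable lebesgue"
    and V'_measurable [measurable]: "V' \<in> borel_measurable borel" and VV': "AE x in lborel. V x = V' x"
    and V'i: "integrable lborel V'" and V'q: "integrable lborel (\<lambda>x. \<bar>V' x\<bar> powr q)" and q: "q > 1"
    and m: "m = (LINT x|lborel. V' x)" "m > 0"
begin

private definition "\<beta> = unit_ball_vol (real DIM('a))"
private definition "\<omega> = real DIM('a) * \<beta>"
private definition "p = 1 / (real DIM('a) - 1)"
text \<open>The solution \<open>L\<close> of
  \<open>\<alpha> * c * L ^ (DIM('a) - 1) = \<omega>\<close>, read as the logarithm of a radius up
  to an additive constant. A \<open>c\<close> above \<open>m\<close> serves the lower bound for the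
  energy, a \<open>c\<close> below \<open>m\<close> the upper bound.\<close>

private definition "lev c \<alpha> = (\<omega> / (\<alpha> * c)) powr p"

private lemma \<beta>_pos: "\<beta> > 0" by (simp add: \<beta>_def)
private lemma \<omega>_pos: "\<omega> > 0" using \<beta>_pos by (simp add: \<omega>_def)
private lemma p_pos: "p > 0" using d by (simp add: p_def)

private lemma lev_power:
  assumes "\<alpha> > 0" "c > 0"
  shows "lev c \<alpha> ^ (DIM('a) - 1) = \<omega> / (\<alpha> * c)"
proof -
  have "lev c \<alpha> ^ (DIM('a) - 1) = (\<omega> / (\<alpha> * c)) powr (p * real (DIM('a) - 1))"
    unfolding lev_def using assms \<omega>_pos by (subst powr_power) (auto simp: mult.commute)
  also have "p * real (DIM('a) - 1) = 1"
    using d by (simp add: p_def of_nat_diff)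
  finally show ?thesis using assms \<omega>_pos by simp
qed

private lemma lev_scaled:
  assumes "\<alpha> > 0" "c > 0"
  shows "\<alpha> powr p * lev c \<alpha> = (\<omega> / c) powr p"
proof -
  have "\<alpha> powr p * lev c \<alpha> = (\<alpha> * (\<omega> / (\<alpha> * c))) powr p"
    unfolding lev_def using assms \<omega>_pos by (subst powr_mult[symmetric]) auto
  then show ?thesis using assms by simp
qed

private lemma lev_at_top:
  assumes "c > 0"
  shows "filterlim (lev c) at_top (at_right 0)"
  unfolding lev_def[abs_def] using assms \<omega>_pos p_pos by real_asymp

section \<open>Two-sided bounds for the ground state energy\<close>

private lemma alpha_V: "(\<lambda>x. \<alpha> * V x) \<in> borel_measurable lebesgue" "(\<lambda>x. \<alpha> * V' x) \<in> borel_measurable borel"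
  "AE x in lborel. \<alpha> * V x = \<alpha> * V' x"
  using V VV' by auto

text \<open>The radius is defined by \<open>1 + ln \<rho> = lev (m + 2 * \<kappa>) \<alpha>\<close>.
  The logarithmic term of \<open>weighted_bound\<close> then takes the share
  \<open>(m + \<kappa>) / (m + 2 * \<kappa>)\<close> of the Sobolev energy, and for small
  \<open>\<alpha>\<close> the term with \<open>C\<close> fits into the remaining share
  \<open>\<kappa> / (m + 2 * \<kappa>)\<close>. So the potential term is at most this energy, whose
  mass coefficient gives the bound.\<close>

private lemma rayleigh_ge:
  assumes \<kappa>: "\<kappa> > 0"
  shows "\<forall>\<^sub>F \<alpha> in at_right 0. \<forall>u\<in>admissible.
    - ((real DIM('a) + 1) / exp (lev (m + 2 * \<kappa>) \<alpha> - 1) ^ DIM('a)) \<le> rayleigh (\<lambda>x. \<alpha> * V x) u"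
proof -
  let ?d = "DIM('a)"
  obtain C \<rho>0 where C: "C \<ge> 0" and \<rho>0: "\<rho>0 > 1"
    and wi: "\<And>\<rho> u g. \<rho> \<ge> \<rho>0 \<Longrightarrow> sobolev_pair ?d u g \<Longrightarrow> integrable lborel (\<lambda>x. V' x * \<bar>u x\<bar> ^ ?d)"
    and wb: "\<And>\<rho> u g. \<rho> \<ge> \<rho>0 \<Longrightarrow> sobolev_pair ?d u g \<Longrightarrow>
      (LINT x|lborel. V' x * \<bar>u x\<bar> ^ ?d) \<le> C * (LINT x|lborel. norm (g x) ^ ?d)
        + (m + \<kappa>) / \<omega> * (1 + ln \<rho>) ^ (?d - 1) * sobolev_energy ?d \<rho> u g"
    by (rule weighted_bound[OF d V'_measurable V'i V'q q m \<kappa>, folded \<beta>_def, folded \<omega>_def]) (rule that)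
  define c where "c = m + 2 * \<kappa>"
  have c: "c > 0" using m(2) \<kappa> by (simp add: c_def)
  have "\<forall>\<^sub>F \<alpha> in at_right 0. lev c \<alpha> \<ge> 1 + ln \<rho>0"
    using lev_at_top[OF c] by (auto simp: filterlim_at_top)
  moreover have "\<forall>\<^sub>F \<alpha> in at_right 0. \<alpha> * C < \<kappa> / c"
  proof -
    have "((\<lambda>\<alpha>. \<alpha> * C) \<longlongrightarrow> 0 * C) (at_right 0)" by (intro tendsto_intros)
    then show ?thesis using \<kappa> c by (intro order_tendstoD(2)) auto
  qed
  moreover have "\<forall>\<^sub>F \<alpha>::real in at_right 0. \<alpha> > 0" by (rule eventually_at_right_less)
  ultimately show ?thesis
  proof eventually_elim
    case (elim \<alpha>)
    define L where "L = lev c \<alpha>"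
    define \<rho> where "\<rho> = exp (L - 1)"
    have \<rho>: "\<rho> \<ge> \<rho>0" "\<rho> > 0" "1 + ln \<rho> = L"
    proof -
      have "ln \<rho>0 \<le> L - 1" using elim(1) by (simp add: L_def)
      then have "exp (ln \<rho>0) \<le> exp (L - 1)" by (simp only: exp_le_cancel_iff)
      then show "\<rho> \<ge> \<rho>0" unfolding \<rho>_def using \<rho>0 by simp
    qed (auto simp: \<rho>_def)
    show ?case
    proof
      fix u :: "'a \<Rightarrow> real" assume u: "u \<in> admissible"
      then have uW: "u \<in> W1 (real ?d)" and nz: "\<not> (AE x in lborel. u x = 0)"
        by (auto simp: admissible_def AE_completion_iff)
      obtain u' g' where u': "sobolev_pair ?d u' g'" "AE x in lborel. u x = u' x" "AE x in lborel. weak_gradient u x = g' x"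
        using W1_sobolev_pair[OF uW] d by auto
      have um: "u \<in> borel_measurable lebesgue" "weak_gradient u \<in> borel_measurable lebesgue"
        using uW by (auto simp: W1_def Lp_def)
      have ui: "integrable lborel (\<lambda>x. \<bar>u' x\<bar> ^ ?d)" and gi: "integrable lborel (\<lambda>x. norm (g' x) ^ ?d)"
        using u'(1) by (auto simp: sobolev_pair_def)
      define G where "G = (LINT x|lborel. norm (g' x) ^ ?d)"
      define U where "U = (LINT x|lborel. \<bar>u' x\<bar> ^ ?d)"
      define E where "E = (real ?d + 1) / \<rho> ^ ?d"
      define N where "N = sobolev_energy ?d \<rho> u' g'"
      have N: "N = G + E * U" by (simp add: N_def sobolev_energy_def G_def E_def U_def)
      have G0: "G \<ge> 0" unfolding G_def by (intro Bochner_Integration.integral_nonneg) auto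
      have E0: "E \<ge> 0" unfolding E_def using \<rho>(2) by simp
      have U0: "U > 0"
      proof -
        have "U \<ge> 0" unfolding U_def by (intro Bochner_Integration.integral_nonneg) auto
        moreover have "U \<noteq> 0"
        proof
          assume "U = 0"
          then have "AE x in lborel. \<bar>u' x\<bar> ^ ?d = 0"
            unfolding U_def using integral_nonneg_eq_0_iff_AE[OF ui] by auto
          with u'(2) have "AE x in lborel. u x = 0" by eventually_elim simp
          with nz show False by simp
        qed
        ultimately show ?thesis by simp
      qed
      have GN: "G \<le> N" using N E0 U0 by simp
      have "\<alpha> * (LINT x|lborel. V' x * \<bar>u' x\<bar> ^ ?d) \<le> \<alpha> * (C * G + (m + \<kappa>) / \<omega> * L ^ (?d - 1) * N)"
        using wb[OF \<rho>(1) u'(1)] elim(3) unfolding \<rho>(3) G_def N_def by (intro mult_left_mono) auto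
      also have "\<dots> = \<alpha> * C * G + (m + \<kappa>) / c * N"
        unfolding L_def lev_power[OF elim(3) c] using \<omega>_pos elim(3) by (simp add: distrib_left)
      also have "\<dots> \<le> \<kappa> / c * N + (m + \<kappa>) / c * N"
        using elim(2) GN G0 \<kappa> c C elim(3) by (intro add_right_mono mult_mono) auto
      also have "\<dots> = (\<kappa> / c + (m + \<kappa>) / c) * N" by (simp add: distrib_right)
      also have "\<kappa> / c + (m + \<kappa>) / c = 1" using c by (simp add: add_divide_distrib[symmetric] c_def)
      finally have le: "\<alpha> * (LINT x|lborel. V' x * \<bar>u' x\<bar> ^ ?d) \<le> G + E * U" by (simp add: N)
      have "(LINT x|lborel. norm (g' x) ^ ?d - \<alpha> * V' x * \<bar>u' x\<bar> ^ ?d) = G - \<alpha> * (LINT x|lborel. V' x * \<bar>u' x\<bar> ^ ?d)"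
        using gi wi[OF \<rho>(1) u'(1)] by (simp add: G_def mult.assoc)
      then have "rayleigh (\<lambda>x. \<alpha> * V x) u = (G - \<alpha> * (LINT x|lborel. V' x * \<bar>u' x\<bar> ^ ?d)) / U"
        using rayleigh_borel[OF alpha_V um(2,1) u'] by (simp add: U_def)
      also have "\<dots> \<ge> (- E * U) / U"
        using le U0 by (intro divide_right_mono) auto
      also have "(- E * U) / U = - E" using U0 by simp
      finally show "- ((real ?d + 1) / exp (lev (m + 2 * \<kappa>) \<alpha> - 1) ^ ?d) \<le> rayleigh (\<lambda>x. \<alpha> * V x) u"
        by (simp add: E_def \<rho>_def L_def c_def)
    qed
  qed
qed

text \<open>With \<open>ln R = lev (m - 2 * \<kappa>) \<alpha>\<close> the gradient energy of the
  trial function is exactly \<open>\<alpha> * (m - 2 * \<kappa>)\<close>, while the potential term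
  exceeds \<open>\<alpha> * (m - \<kappa>)\<close> once \<open>R\<close> is large. The difference
  \<open>- \<alpha> * \<kappa>\<close> is divided by the bound \<open>\<beta> * R ^ DIM('a)\<close>
  for the mass.\<close>

private lemma rayleigh_le:
  assumes \<kappa>: "\<kappa> > 0" "2 * \<kappa> < m"
  shows "\<forall>\<^sub>F \<alpha> in at_right 0. \<exists>u\<in>admissible.
    rayleigh (\<lambda>x. \<alpha> * V x) u \<le> - (\<alpha> * \<kappa> / (\<beta> * exp (lev (m - 2 * \<kappa>) \<alpha>) ^ DIM('a)))"
proof -
  let ?d = "DIM('a)"
  define c where "c = m - 2 * \<kappa>"
  have c: "c > 0" using \<kappa> by (simp add: c_def)
  define M where "M R = (LINT x|lborel. V' x * \<bar>log_cutoff R (norm x)\<bar> ^ ?d)" for R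
  have expl: "filterlim (\<lambda>\<alpha>. exp (lev c \<alpha>)) at_top (at_right 0)"
    by (rule filterlim_compose[OF exp_at_top lev_at_top[OF c]])
  have "((\<lambda>\<alpha>. M (exp (lev c \<alpha>))) \<longlongrightarrow> m) (at_right 0)"
    unfolding M_def m by (rule filterlim_compose[OF log_cutoff_tendsto[OF V'_measurable V'i] expl])
  then have "\<forall>\<^sub>F \<alpha> in at_right 0. M (exp (lev c \<alpha>)) > m - \<kappa>"
    using \<kappa> by (intro order_tendstoD(1)) auto
  moreover have "\<forall>\<^sub>F \<alpha>::real in at_right 0. \<alpha> > 0" by (rule eventually_at_right_less)
  ultimately show ?thesis
  proof eventually_elim
    case (elim \<alpha>)
    define L where "L = lev c \<alpha>"
    have L: "L > 0" unfolding L_def lev_def using elim(2) c \<omega>_pos by simp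
    define R where "R = exp L"
    have R: "R > 1" "ln R = L" using L by (auto simp: R_def)
    define u where "u x = log_cutoff R (norm x)" for x :: 'a
    define g where "g = (log_cutoff_gradient R :: 'a \<Rightarrow> 'a)"
    have [measurable]: "u \<in> borel_measurable borel" "g \<in> borel_measurable borel"
      unfolding u_def g_def using R(1) by measurable
    have wg: "has_weak_gradient u g"
      using log_cutoff_weak_gradient[OF R(1), where 'a='a] by (simp add: u_def[abs_def] g_def)
    have ui: "integrable lborel (\<lambda>x. \<bar>u x\<bar> ^ ?d)" "0 < (LINT x|lborel. \<bar>u x\<bar> ^ ?d)"
      "(LINT x|lborel. \<bar>u x\<bar> ^ ?d) \<le> \<beta> * R ^ ?d"
      unfolding u_def \<beta>_def by (fact log_cutoff_mass[OF R(1)])+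
    have gi: "integrable lborel (\<lambda>x. norm (g x) ^ ?d)" "(LINT x|lborel. norm (g x) ^ ?d) = \<omega> / L ^ (?d - 1)"
      unfolding g_def \<omega>_def \<beta>_def using log_cutoff_energy[OF R(1) d] by (simp_all add: R(2))
    have W: "u \<in> W1 (real ?d)" "AE x in lborel. weak_gradient u x = g x"
      using has_weak_gradient_W1[OF wg _ _ ui(1) gi(1)] d by auto
    have um: "u \<in> borel_measurable lebesgue" "weak_gradient u \<in> borel_measurable lebesgue"
      using W(1) by (auto simp: W1_def Lp_def)
    have sp: "sobolev_pair ?d u g"
      unfolding sobolev_pair_def using has_weak_gradient_borel[OF wg] ui(1) gi(1) by auto
    have "\<not> (AE x in lborel. u x = 0)"
    proof
      assume "AE x in lborel. u x = 0"
      then have "AE x in lborel. \<bar>u x\<bar> ^ ?d = 0" by eventually_elim (simp add: power_0_left)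
      then have "(LINT x|lborel. \<bar>u x\<bar> ^ ?d) = 0"
        by (rule integral_eq_zero_AE)
      with ui(2) show False by simp
    qed
    then have adm: "u \<in> admissible" using W(1) by (simp add: admissible_def AE_completion_iff)
    have ub: "\<bar>u x\<bar> ^ ?d \<le> 1" for x
      using log_cutoff_bounds[OF R(1), of "norm x"] by (auto simp: u_def intro!: power_le_one)
    have Vi: "integrable lborel (\<lambda>x. V' x * \<bar>u x\<bar> ^ ?d)"
      by (rule Bochner_Integration.integrable_bound[OF V'i])
        (use ub in \<open>auto simp: abs_mult power_abs intro!: AE_I2 mult_left_le\<close>)
    have MR: "M R = (LINT x|lborel. V' x * \<bar>u x\<bar> ^ ?d)" by (simp add: M_def u_def)
    have "(LINT x|lborel. norm (g x) ^ ?d - \<alpha> * V' x * \<bar>u x\<bar> ^ ?d) = \<omega> / L ^ (?d - 1) - \<alpha> * M R"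
      using gi Vi by (simp add: MR mult.assoc)
    also have "\<omega> / L ^ (?d - 1) = \<alpha> * c"
      unfolding L_def lev_power[OF elim(2) c] using \<omega>_pos by simp
    also have "\<alpha> * c - \<alpha> * M R \<le> - (\<alpha> * \<kappa>)"
    proof -
      have "M R \<ge> c + \<kappa>" using elim(1) by (simp add: R_def L_def c_def)
      then have "\<alpha> * (c + \<kappa>) \<le> \<alpha> * M R" using elim(2) by simp
      then show ?thesis by (simp add: distrib_left)
    qed
    finally have Qle: "(LINT x|lborel. norm (g x) ^ ?d - \<alpha> * V' x * \<bar>u x\<bar> ^ ?d) \<le> - (\<alpha> * \<kappa>)" .
    have "rayleigh (\<lambda>x. \<alpha> * V x) u = (LINT x|lborel. norm (g x) ^ ?d - \<alpha> * V' x * \<bar>u x\<bar> ^ ?d) / (LINT x|lborel. \<bar>u x\<bar> ^ ?d)"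
      by (rule rayleigh_borel[OF alpha_V um(2,1) sp _ W(2)]) simp
    also have "\<dots> \<le> - (\<alpha> * \<kappa>) / (LINT x|lborel. \<bar>u x\<bar> ^ ?d)"
      using Qle ui(2) by (intro divide_right_mono) auto
    also have "\<dots> \<le> - (\<alpha> * \<kappa>) / (\<beta> * R ^ ?d)"
      using ui(2,3) \<kappa>(1) elim(2) \<beta>_pos R(1) by (auto intro!: divide_left_mono mult_pos_pos)
    finally show ?case
      using adm by (intro bexI[of _ u]) (auto simp: R_def L_def c_def)
  qed
qed

private lemma lam_bounds:
  assumes \<kappa>: "\<kappa> > 0" "2 * \<kappa> < m"
  shows "\<forall>\<^sub>F \<alpha> in at_right 0. \<alpha> > 0 \<and>
    - ((real DIM('a) + 1) / exp (lev (m + 2 * \<kappa>) \<alpha> - 1) ^ DIM('a)) \<le> lam (\<lambda>x. \<alpha> * V x) \<and>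
    lam (\<lambda>x. \<alpha> * V x) \<le> - (\<alpha> * \<kappa> / (\<beta> * exp (lev (m - 2 * \<kappa>) \<alpha>) ^ DIM('a)))"
  using rayleigh_ge[OF \<kappa>(1)] rayleigh_le[OF \<kappa>] eventually_at_right_less[of "0::real"]
proof eventually_elim
  case (elim \<alpha>)
  obtain u where u: "u \<in> admissible" "rayleigh (\<lambda>x. \<alpha> * V x) u \<le> - (\<alpha> * \<kappa> / (\<beta> * exp (lev (m - 2 * \<kappa>) \<alpha>) ^ DIM('a)))"
    using elim(2) by blast
  \<comment> \<open>\<open>lam\<close> is an infimum in the reals, so it lies below the quotient of
    \<open>u\<close> only once the set of quotients is known to be bounded below; the lower estimate
    supplies this.\<close>
  have bdd: "bdd_below (rayleigh (\<lambda>x. \<alpha> * V x) ` admissible)"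
    using elim(1) by (intro bdd_belowI2) auto
  have "- ((real DIM('a) + 1) / exp (lev (m + 2 * \<kappa>) \<alpha> - 1) ^ DIM('a)) \<le> lam (\<lambda>x. \<alpha> * V x)"
    unfolding lam_eq using u(1) elim(1) by (intro cINF_greatest) auto
  moreover have "lam (\<lambda>x. \<alpha> * V x) \<le> rayleigh (\<lambda>x. \<alpha> * V x) u"
    unfolding lam_eq by (rule cINF_lower[OF bdd u(1)])
  ultimately show ?case using u(2) elim(3) by auto
qed

text \<open>Both bounds for \<open>lam\<close> are negative, so they enclose its absolute value
  between positive numbers and the logarithm may be taken. Apart from the two \<open>lev\<close>
  terms only constants and \<open>ln \<alpha>\<close> remain, and \<open>\<alpha> powr p\<close>
  sends their contribution to 0.\<close>

private lemma log_lam_bounds: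
  assumes \<kappa>: "\<kappa> > 0" "2 * \<kappa> < m"
  shows "\<forall>\<^sub>F \<alpha> in at_right 0.
    real DIM('a) * (\<omega> / (m + 2 * \<kappa>)) powr p - \<alpha> powr p * (real DIM('a) + ln (real DIM('a) + 1))
      \<le> \<alpha> powr p * ln (1 / \<bar>lam (\<lambda>x. \<alpha> * V x)\<bar>) \<and>
    \<alpha> powr p * ln (1 / \<bar>lam (\<lambda>x. \<alpha> * V x)\<bar>)
      \<le> real DIM('a) * (\<omega> / (m - 2 * \<kappa>)) powr p + \<alpha> powr p * (ln \<beta> - ln \<kappa> - ln \<alpha>)"
  using lam_bounds[OF \<kappa>]
proof eventually_elim
  case (elim \<alpha>)
  let ?d = "DIM('a)"
  define \<Lambda> where "\<Lambda> = \<bar>lam (\<lambda>x. \<alpha> * V x)\<bar>"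
  define a where "a = \<alpha> * \<kappa> / (\<beta> * exp (lev (m - 2 * \<kappa>) \<alpha>) ^ ?d)"
  define b where "b = (real ?d + 1) / exp (lev (m + 2 * \<kappa>) \<alpha> - 1) ^ ?d"
  have \<alpha>: "\<alpha> > 0" using elim by simp
  have a: "a > 0" unfolding a_def using \<alpha> \<kappa> \<beta>_pos by simp
  have ab: "a \<le> \<Lambda>" "\<Lambda> \<le> b" using elim a unfolding \<Lambda>_def a_def b_def by auto
  have \<Lambda>: "\<Lambda> > 0" using a ab by linarith
  have lnb: "ln b = ln (real ?d + 1) - real ?d * (lev (m + 2 * \<kappa>) \<alpha> - 1)"
    unfolding b_def by (subst ln_div) (auto simp: ln_realpow)
  have lna: "ln a = ln \<alpha> + ln \<kappa> - ln \<beta> - real ?d * lev (m - 2 * \<kappa>) \<alpha>"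
    unfolding a_def using \<alpha> \<kappa> \<beta>_pos by (simp add: ln_div ln_mult ln_realpow)
  have "ln (1 / \<Lambda>) = - ln \<Lambda>" using \<Lambda> by (simp add: ln_div)
  moreover have "ln a \<le> ln \<Lambda>" "ln \<Lambda> \<le> ln b" using a ab \<Lambda> by auto
  ultimately have 1: "real ?d * lev (m + 2 * \<kappa>) \<alpha> - (real ?d + ln (real ?d + 1)) \<le> ln (1 / \<Lambda>)"
    and 2: "ln (1 / \<Lambda>) \<le> real ?d * lev (m - 2 * \<kappa>) \<alpha> + (ln \<beta> - ln \<kappa> - ln \<alpha>)"
    by (auto simp: lna lnb right_diff_distrib)
  have s: "\<alpha> powr p * (real ?d * lev c \<alpha>) = real ?d * (\<omega> / c) powr p" if "c > 0" for c
    using lev_scaled[OF \<alpha> that] by (metis mult.left_commute)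
  have "\<alpha> powr p * (real ?d * lev (m + 2 * \<kappa>) \<alpha> - (real ?d + ln (real ?d + 1))) \<le> \<alpha> powr p * ln (1 / \<Lambda>)"
    using 1 by (rule mult_left_mono) simp
  moreover have "\<alpha> powr p * ln (1 / \<Lambda>) \<le> \<alpha> powr p * (real ?d * lev (m - 2 * \<kappa>) \<alpha> + (ln \<beta> - ln \<kappa> - ln \<alpha>))"
    using 2 by (rule mult_left_mono) simp
  ultimately show ?case
    using s[of "m + 2 * \<kappa>"] s[of "m - 2 * \<kappa>"] \<kappa> m(2)
    by (simp only: \<Lambda>_def[symmetric] distrib_left[of "\<alpha> powr p"] right_diff_distrib[of "\<alpha> powr p" "real ?d * _"])
qed

text \<open>\<open>\<kappa>\<close> is fixed before \<open>\<alpha>\<close> tends to 0. The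
  resulting bounds \<open>H \<kappa>\<close> and \<open>H (- \<kappa>)\<close> close up as
  \<open>\<kappa>\<close> decreases, by continuity of \<open>H\<close> at 0.\<close>

lemma lam_asymptotics:
  "((\<lambda>\<alpha>. \<alpha> powr (1 / (real DIM('a) - 1)) * ln (1 / \<bar>lam (\<lambda>x. \<alpha> * V x)\<bar>))
      \<longlongrightarrow> real DIM('a) * (real DIM('a) * unit_ball_vol (real DIM('a))) powr (1 / (real DIM('a) - 1))
          * m powr (- (1 / (real DIM('a) - 1)))) (at_right 0)"
proof -
  let ?d = "DIM('a)"
  let ?F = "\<lambda>\<alpha>. \<alpha> powr p * ln (1 / \<bar>lam (\<lambda>x. \<alpha> * V x)\<bar>)"
  define H where "H \<kappa> = real ?d * (\<omega> / (m + 2 * \<kappa>)) powr p" for \<kappa>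
  have "isCont H 0"
    unfolding H_def using m(2) \<omega>_pos by (intro continuous_intros) auto
  then have H: "(H \<longlongrightarrow> H 0) (at 0)" by (simp add: isCont_def)
  have Hr: "(H \<longlongrightarrow> H 0) (at_right 0)" and Hl: "((\<lambda>\<kappa>. H (- \<kappa>)) \<longlongrightarrow> H 0) (at_right 0)"
  proof -
    show "(H \<longlongrightarrow> H 0) (at_right 0)" using H by (rule filterlim_mono) (auto simp: at_le)
    have "(H \<longlongrightarrow> H 0) (at_left 0)" using H by (rule filterlim_mono) (auto simp: at_le)
    then show "((\<lambda>\<kappa>. H (- \<kappa>)) \<longlongrightarrow> H 0) (at_right 0)" by (simp add: filterlim_at_left_to_right)
  qed
  have small: "\<forall>\<^sub>F \<kappa> in at_right 0. \<kappa> > 0 \<and> 2 * \<kappa> < m"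
    unfolding eventually_at_right_field using m(2) by (intro exI[of _ "m / 2"]) auto
  have z1: "((\<lambda>\<alpha>. \<alpha> powr p * K) \<longlongrightarrow> 0) (at_right 0)" for K
    using p_pos by real_asymp
  have z2: "((\<lambda>\<alpha>. \<alpha> powr p * (ln \<beta> - ln \<kappa> - ln \<alpha>)) \<longlongrightarrow> 0) (at_right 0)" for \<kappa>
    using p_pos by real_asymp
  have "(?F \<longlongrightarrow> H 0) (at_right 0)"
  proof (rule order_tendstoI)
    fix a assume "a < H 0"
    then have "\<forall>\<^sub>F \<kappa> in at_right 0. H \<kappa> > a" using Hr by (intro order_tendstoD(1))
    then have "\<forall>\<^sub>F \<kappa> in at_right 0. H \<kappa> > a \<and> \<kappa> > 0 \<and> 2 * \<kappa> < m" using small by eventually_elim auto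
    then obtain \<kappa> where \<kappa>: "H \<kappa> > a" "\<kappa> > 0" "2 * \<kappa> < m"
      using eventually_happens'[OF trivial_limit_at_right_real] by blast
    have "\<forall>\<^sub>F \<alpha> in at_right 0. \<alpha> powr p * (real ?d + ln (real ?d + 1)) < H \<kappa> - a"
      using z1 \<kappa>(1) by (intro order_tendstoD(2)) auto
    with log_lam_bounds[OF \<kappa>(2,3)] show "\<forall>\<^sub>F \<alpha> in at_right 0. a < ?F \<alpha>"
      by eventually_elim (simp add: H_def)
  next
    fix a assume "H 0 < a"
    then have "\<forall>\<^sub>F \<kappa> in at_right 0. H (- \<kappa>) < a" using Hl by (intro order_tendstoD(2))
    then have "\<forall>\<^sub>F \<kappa> in at_right 0. H (- \<kappa>) < a \<and> \<kappa> > 0 \<and> 2 * \<kappa> < m" using small by eventually_elim auto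
    then obtain \<kappa> where \<kappa>: "H (- \<kappa>) < a" "\<kappa> > 0" "2 * \<kappa> < m"
      using eventually_happens'[OF trivial_limit_at_right_real] by blast
    have "\<forall>\<^sub>F \<alpha> in at_right 0. \<alpha> powr p * (ln \<beta> - ln \<kappa> - ln \<alpha>) < a - H (- \<kappa>)"
      using z2 \<kappa>(1) by (intro order_tendstoD(2)) auto
    with log_lam_bounds[OF \<kappa>(2,3)] show "\<forall>\<^sub>F \<alpha> in at_right 0. ?F \<alpha> < a"
      by eventually_elim (simp add: H_def)
  qed
  moreover have "H 0 = real ?d * \<omega> powr p * m powr (- p)"
    using m(2) \<omega>_pos by (simp add: H_def powr_divide powr_minus_divide)
  ultimately show ?thesis by (simp add: p_def \<omega>_def \<beta>_def)
qed

end

theorem theorem2p2: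
  fixes V :: "real ^ 'n \<Rightarrow> real" and q :: real
  assumes "CARD('n) > 1"
    and "q > 1"
    and "V \<in> Lp q \<inter> Lp 1"
    and "(LINT x|lebesgue. V x) > 0"
  shows "((\<lambda>\<alpha>. \<alpha> powr (1 / (real CARD('n) - 1)) * ln (1 / \<bar>lam (\<lambda>x. \<alpha> * V x)\<bar>))
      \<longlongrightarrow> real CARD('n) * surface_area (sphere (0 :: real ^ 'n) 1) powr (1 / (real CARD('n) - 1))
          * (LINT x|lebesgue. V x) powr (- (1 / (real CARD('n) - 1)))) (at_right 0)"
proof -
  have dim: "DIM(real ^ 'n) = CARD('n)" by simp
  have Vm: "V \<in> borel_measurable lebesgue" using assms(3) by (simp add: Lp_def)
  obtain V' where V': "V' \<in> borel_measurable borel" "AE x in lborel. V x = V' x"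
    using borel_representative[OF Vm] by metis
  have i1: "integrable lborel V'"
  proof -
    have "integrable lborel (\<lambda>x. norm (V' x) ^ 1)"
      using assms(3) Lp_borel[OF Vm V', of 1] by simp
    then show ?thesis using V'(1) by (simp add: integrable_abs_iff)
  qed
  have iq: "integrable lborel (\<lambda>x. \<bar>V' x\<bar> powr q)"
  proof -
    have "integrable lebesgue (\<lambda>x. norm (V x) powr q)" using assms(3) by (simp add: Lp_def)
    moreover have "integrable lebesgue (\<lambda>x. norm (V x) powr q) \<longleftrightarrow> integrable lborel (\<lambda>x. \<bar>V' x\<bar> powr q)"
      using V' Vm by (intro lebesgue_integral_AE_borel(1)) auto
    ultimately show ?thesis by simp
  qed
  have eq: "(LINT x|lebesgue. V x) = (LINT x|lborel. V' x)"
    by (rule lebesgue_integral_AE_borel(2)[OF Vm V'])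
  have "DIM(real ^ 'n) \<ge> 2" using assms(1) by simp
  from lam_asymptotics[OF this Vm V' i1 iq assms(2) eq assms(4)]
  show ?thesis unfolding surface_area_unit_sphere dim .
qed

end
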